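(* Let $(\varepsilon_t)_{t\in\mathbb{Z}}$ be i.i.d. copies of a random variable $\varepsilon$, $Y$ measurable and $X_t=Y(\varepsilon_t,\varepsilon_{t-1},\dots)$. Fix $\tau\in(0,1)$ and suppose: (A) there exist $\delta>0$ and $\sigma\in(0,1)$ such that $\sup_{\xi\in\mathcal{X}_\tau(\delta)}\|1\{X_n<\xi\}-1\{X_n'<\xi\}\|_2=O(\sigma^n)$; (B) $F_X$ is Lipschitz continuous in a neighborhood of $\xi_0(\tau)$ and has a positive and continuous Lebesgue density at $\xi_0(\tau)$. Let $\lambda_n=2\pi j_n/n$ with $j_n\in\mathbb{Z}$ be a sequence with $\lambda_n\to\lambda\in(0,\pi)$, where $g_\tau(\lambda)>0$. Then for any fixed integer $k\ge 0$, the collection of quantile periodograms $$Q_{n,\tau}(\lambda_n-2\pi k/n),\,Q_{n,\tau}(\lambda_n-2\pi(k-1)/n),\,\dots,\,Q_{n,\tau}(\lambda_n+2\pi k/n)$$ converges jointly in distribution to independent exponential random variables with mean $g_\tau(\lambda)$.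
   Context: $(\varepsilon_t^* )$ is an independent i.i.d. copy of $(\varepsilon_t)$ and $X_t'=Y(\varepsilon_t,\dots,\varepsilon_1,\varepsilon_0^*,\varepsilon_{-1}^*,\dots)$. $\|Z\|_2=(\mathbb{E}|Z|^2)^{1/2}$. $F_X(x)=\mathbb{P}(X_0\le x)$, $\xi_0(\tau)=\inf\{x:F_X(x)\ge\tau\}$, $\mathcal{X}_\tau(\delta)=\{\xi\in\mathbb{R}:|\xi_0(\tau)-\xi|\le\delta\}$. $V_t(\tau,\xi)=\tau-1\{X_t<\xi\}$, $V_t(\tau)=V_t(\tau,\xi_0(\tau))$, $r_\tau(j)=\mathbb{E}V_0(\tau)V_j(\tau)$, and the $\tau$-th quantile spectrum is $g_\tau(\lambda)=\frac{1}{2\pi}\sum_{j\in\mathbb{Z}}r_\tau(j)\cos(j\lambda)$. Given observations $X_1,\dots,X_n$, $\hat\xi_n(\tau)$ is a minimizer over $x\in\mathbb{R}$ of $\sum_{t=1}^n\rho_\tau(X_t-x)$ with $\rho_\tau(x)=x(\tau-1\{x<0\})$, $\hat V_t(\tau)=V_t(\tau,\hat\xi_n(\tau))$, and the quantile periodogram is $Q_{n,\tau}(\lambda)=\frac{1}{2\pi}\big|n^{-1/2}\sum_{t=1}^n\hat V_t(\tau)e^{-it\lambda}\big|^2$ ($i=\sqrt{-1}$). *)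

theory Defs
  imports "HOL-Probability.Probability" "HOL-Library.Landau_Symbols"
begin

definition Xproc :: "((nat \<Rightarrow> 'e) \<Rightarrow> real) \<Rightarrow> (int \<Rightarrow> 'a \<Rightarrow> 'e) \<Rightarrow> int \<Rightarrow> 'a \<Rightarrow> real" where
  "Xproc Y eps t \<omega> = Y (\<lambda>i. eps (t - int i) \<omega>)"

definition cdfX :: "'a measure \<Rightarrow> ((nat \<Rightarrow> 'e) \<Rightarrow> real) \<Rightarrow> (int \<Rightarrow> 'a \<Rightarrow> 'e) \<Rightarrow> real \<Rightarrow> real" where
  "cdfX M Y eps x = measure M {\<omega> \<in> space M. Xproc Y eps 0 \<omega> \<le> x}"

definition quantile0 :: "(real \<Rightarrow> real) \<Rightarrow> real \<Rightarrow> real" where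
  "quantile0 F tau = Inf {x. tau \<le> F x}"

definition Vfun :: "real \<Rightarrow> real \<Rightarrow> real \<Rightarrow> real" where
  "Vfun tau xi x = tau - (if x < xi then 1 else 0)"

definition rho :: "real \<Rightarrow> real \<Rightarrow> real" where
  "rho tau x = x * (tau - (if x < 0 then 1 else 0))"

definition acovV :: "'a measure \<Rightarrow> ((nat \<Rightarrow> 'e) \<Rightarrow> real) \<Rightarrow> (int \<Rightarrow> 'a \<Rightarrow> 'e) \<Rightarrow> real \<Rightarrow> int \<Rightarrow> real" where
  "acovV M Y eps tau j =
     (let xi0 = quantile0 (cdfX M Y eps) tau in
      \<integral>\<omega>. Vfun tau xi0 (Xproc Y eps 0 \<omega>) * Vfun tau xi0 (Xproc Y eps j \<omega>) \<partial>M)"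

definition qspec :: "'a measure \<Rightarrow> ((nat \<Rightarrow> 'e) \<Rightarrow> real) \<Rightarrow> (int \<Rightarrow> 'a \<Rightarrow> 'e) \<Rightarrow> real \<Rightarrow> real \<Rightarrow> real" where
  "qspec M Y eps tau lam = (\<Sum>\<^sub>\<infinity>j::int. acovV M Y eps tau j * cos (real_of_int j * lam)) / (2 * pi)"

text \<open>Coupling (condition (A)) realised on a canonical product space carrying two independent
  i.i.d. copies of the innovations with law L: coordinate (True, t) is eps_t, (False, t) is eps*_t.\<close>
definition coupSpace :: "'e measure \<Rightarrow> (bool \<times> int \<Rightarrow> 'e) measure" where
  "coupSpace L = PiM UNIV (\<lambda>_. L)"

definition Xcoup :: "((nat \<Rightarrow> 'e) \<Rightarrow> real) \<Rightarrow> int \<Rightarrow> (bool \<times> int \<Rightarrow> 'e) \<Rightarrow> real" where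
  "Xcoup Y t \<omega> = Y (\<lambda>i. \<omega> (True, t - int i))"

definition Xcoup' :: "((nat \<Rightarrow> 'e) \<Rightarrow> real) \<Rightarrow> int \<Rightarrow> (bool \<times> int \<Rightarrow> 'e) \<Rightarrow> real" where
  "Xcoup' Y t \<omega> = Y (\<lambda>i. if 1 \<le> t - int i then \<omega> (True, t - int i) else \<omega> (False, t - int i))"

definition coupL2 :: "'e measure \<Rightarrow> ((nat \<Rightarrow> 'e) \<Rightarrow> real) \<Rightarrow> nat \<Rightarrow> real \<Rightarrow> real" where
  "coupL2 L Y n xi = sqrt (\<integral>\<omega>. ((if Xcoup Y (int n) \<omega> < xi then 1 else 0)
                                   - (if Xcoup' Y (int n) \<omega> < xi then 1 else 0 :: real))\<^sup>2 \<partial>coupSpace L)"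

definition qpgram :: "((nat \<Rightarrow> 'e) \<Rightarrow> real) \<Rightarrow> (int \<Rightarrow> 'a \<Rightarrow> 'e) \<Rightarrow> real \<Rightarrow> (nat \<Rightarrow> 'a \<Rightarrow> real)
                      \<Rightarrow> nat \<Rightarrow> real \<Rightarrow> 'a \<Rightarrow> real" where
  "qpgram Y eps tau xihat n lam \<omega> =
     (1 / (2 * pi)) * (cmod ((1 / sqrt (real n)) *
        (\<Sum>t=1..n. complex_of_real (Vfun tau (xihat n \<omega>) (Xproc Y eps (int t) \<omega>))
                     * exp (- \<i> * complex_of_real (real t * lam)))))\<^sup>2"

text \<open>Convergence in distribution of random vectors indexed by a finite set I (values are
  extensional functions I -> real, i.e. elements of the product space PiM I borel):
  each Z n is a random vector, and E f(Z_n) -> int f d mu for every bounded continuous f.\<close>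
definition conv_distr_vec :: "'a measure \<Rightarrow> int set \<Rightarrow> (nat \<Rightarrow> 'a \<Rightarrow> (int \<Rightarrow> real))
                               \<Rightarrow> (int \<Rightarrow> real) measure \<Rightarrow> bool" where
  "conv_distr_vec M I Z mu \<longleftrightarrow>
     (\<forall>n. Z n \<in> M \<rightarrow>\<^sub>M PiM I (\<lambda>_. borel)) \<and>
     (\<forall>f :: (int \<Rightarrow> real) \<Rightarrow> real. continuous_on UNIV f \<and> bounded (range f) \<longrightarrow>
        (\<lambda>n. \<integral>\<omega>. f (Z n \<omega>) \<partial>M) \<longlonglongrightarrow> (\<integral>x. f x \<partial>mu))"

end

theory Submission
  imports Defs "HOL-Real_Asymp.Real_Asymp"
begin

text \<open>Replacing the innovations before a given time by an independent copy bounds covariances and the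
  factorization error of characteristic functions of separated blocks by geometrically small
  coupling distances. Bernstein blocks thus give a central limit theorem for weighted sums of
  \<open>V_t(\<tau>)\<close> with bounded weights. At Fourier frequencies the weights sum to zero, so the plug-in error
  needs no centring; since the empirical quantile is root-n consistent, this error is controlled by
  monotonicity on a finite grid of mesh \<open>\<theta> / sqrt n\<close> and second moments alone. Finally, averaging
  characteristic functions over Gaussian arguments gives the joint Laplace transform of the
  periodograms, and by Stone--Weierstrass in the variables \<open>exp (- Q)\<close> this determines weak convergence.\<close>

section \<open>Coupling with an independent past\<close>

text \<open>The obstacle is the estimated quantile: the summands depend on a random level, where an
  empirical process would usually call for chaining or higher moments. Two features avoid this.
  Covariances are bounded by a standard deviation times a coupling distance, so an indicator
  increment between levels at distance \<open>d\<close> keeps a factor \<open>sqrt d\<close>. And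
  convergence is tested on characteristic functions, where a small error independent of
  \<open>n\<close> may be left over until the very end; hence the mesh parameter is fixed before
  \<open>n\<close> grows and the number of grid points stays bounded. The periodogram is quadratic
  in the weighted sums. For a standard normal \<open>xi\<close> the mean of
  \<open>exp (i T xi)\<close> is \<open>exp (- T^2 / 2)\<close>, so its Laplace transform reduces to
  linear statistics. Integer Laplace arguments suffice, because \<open>exp (- m Q)\<close> are the
  monomials in \<open>exp (- Q)\<close>. Each frequency contributes a cosine and a sine sum with
  equal limiting variance, and two factors \<open>(1 + g m)^(-1/2)\<close> produce the exponential
  law.\<close>

lemma abs_bound_imp_square_bound: "\<bar>x\<bar> \<le> B \<Longrightarrow> x\<^sup>2 \<le> B\<^sup>2" for x :: real
  using power_mono[of "\<bar>x\<bar>" B 2] by simp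

lemma Cauchy_Schwarz_integral:
  fixes f g :: "'a \<Rightarrow> real"
  assumes [measurable]: "f \<in> borel_measurable M" "g \<in> borel_measurable M"
    and f: "integrable M (\<lambda>x. (f x)\<^sup>2)" and g: "integrable M (\<lambda>x. (g x)\<^sup>2)"
  shows "\<bar>\<integral>x. f x * g x \<partial>M\<bar> \<le> sqrt (\<integral>x. (f x)\<^sup>2 \<partial>M) * sqrt (\<integral>x. (g x)\<^sup>2 \<partial>M)"
proof -
  have fg: "integrable M (\<lambda>x. f x * g x)"
  proof (rule Bochner_Integration.integrable_bound[OF Bochner_Integration.integrable_add[OF f g]])
    show "AE x in M. norm (f x * g x) \<le> norm ((f x)\<^sup>2 + (g x)\<^sup>2)"
    proof (rule AE_I2)
      fix x
      have "2 * (\<bar>f x\<bar> * \<bar>g x\<bar>) \<le> (f x)\<^sup>2 + (g x)\<^sup>2"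
        using sum_squares_bound[of "\<bar>f x\<bar>" "\<bar>g x\<bar>"] by (simp add: mult.assoc)
      moreover have "0 \<le> \<bar>f x\<bar> * \<bar>g x\<bar>" by simp
      ultimately show "norm (f x * g x) \<le> norm ((f x)\<^sup>2 + (g x)\<^sup>2)"
        unfolding real_norm_def abs_mult by linarith
    qed
  qed simp
  let ?a = "\<integral>x. (f x)\<^sup>2 \<partial>M" and ?b = "\<integral>x. (g x)\<^sup>2 \<partial>M" and ?c = "\<integral>x. f x * g x \<partial>M"
  have q: "0 \<le> ?a * l\<^sup>2 + 2 * ?c * l + ?b" for l
  proof -
    have "0 \<le> (\<integral>x. (l * f x + g x)\<^sup>2 \<partial>M)" by simp
    also have "\<dots> = (\<integral>x. l\<^sup>2 * (f x)\<^sup>2 + 2 * l * (f x * g x) + (g x)\<^sup>2 \<partial>M)"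
      by (intro Bochner_Integration.integral_cong) (auto simp: power2_eq_square algebra_simps)
    also have "\<dots> = l\<^sup>2 * ?a + 2 * l * ?c + ?b"
      using f g fg by simp
    also have "\<dots> = ?a * l\<^sup>2 + 2 * ?c * l + ?b"
      by simp
    finally show ?thesis .
  qed
  have "?c\<^sup>2 \<le> ?a * ?b"
  proof (cases "?a = 0")
    case True
    have "?c = 0"
    proof (rule ccontr)
      assume "?c \<noteq> 0"
      \<comment> \<open>This \<open>l\<close> makes the linear polynomial
        \<open>2 * ?c * l + ?b\<close> equal to -1.\<close>
      then show False using q[of "- (?b + 1) / (2 * ?c)"] True by simp
    qed
    with True show ?thesis by simp
  next
    case False
    then have "?a > 0" by (simp add: less_le)
    then show ?thesis
      using q[of "- ?c / ?a"] by (simp add: power2_eq_square field_simps)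
  qed
  then have "sqrt (?c\<^sup>2) \<le> sqrt (?a * ?b)" by (rule real_sqrt_le_mono)
  then show ?thesis by (simp add: real_sqrt_mult)
qed

lemma (in prob_space) expectation_abs_le_sqrt:
  assumes "f \<in> borel_measurable M" "integrable M (\<lambda>x. (f x)\<^sup>2)"
  shows "expectation (\<lambda>x. \<bar>f x\<bar> :: real) \<le> sqrt (expectation (\<lambda>x. (f x)\<^sup>2))"
  using Cauchy_Schwarz_integral[of "\<lambda>x. \<bar>f x\<bar>" M "\<lambda>_. 1"] assms by (simp add: prob_space)

lemma (in prob_space) integrable_bounded:
  fixes f :: "'a \<Rightarrow> 'z::{banach, second_countable_topology}"
  shows "f \<in> borel_measurable M \<Longrightarrow> (\<And>\<omega>. norm (f \<omega>) \<le> B) \<Longrightarrow> integrable M f"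
  by (rule integrable_const_bound[where B = B]) auto

lemma norm_integral_le_integral:
  fixes f :: "'a \<Rightarrow> 'b::{banach, second_countable_topology}"
  assumes "integrable M f" "integrable M g" "\<And>x. x \<in> space M \<Longrightarrow> norm (f x) \<le> g x"
  shows "norm (\<integral>x. f x \<partial>M) \<le> (\<integral>x. g x \<partial>M)"
  using assms by (intro order_trans[OF integral_norm_bound integral_mono]) auto

lemma norm_iexp_diff_le: "cmod (iexp x - iexp y) \<le> \<bar>x - y\<bar>"
proof -
  have "iexp x - iexp y = iexp y * (iexp (x - y) - 1)"
    by (simp add: right_diff_distrib exp_add[symmetric] algebra_simps flip: exp_add)
  then show ?thesis
    using iexp_approx1[of "x - y" 0] by (simp add: norm_mult)
qed

section \<open>Innovation sequences and their laws on the coupling space\<close>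

locale iid_innovations = prob_space M
  for M :: "'a measure" +
  fixes N :: "'e measure" and eps :: "int \<Rightarrow> 'a \<Rightarrow> 'e"
  assumes eps_meas[measurable]: "\<And>t. eps t \<in> M \<rightarrow>\<^sub>M N"
    and eps_indep: "indep_vars (\<lambda>_. N) eps UNIV"
    and eps_ident: "\<And>t. distr M N (eps t) = distr M N (eps 0)"
begin

abbreviation "L \<equiv> distr M N (eps 0)"
abbreviation "Seq \<equiv> PiM UNIV (\<lambda>_::int. N)"

lemma sets_PiM_L[measurable_cong]: "sets (PiM I (\<lambda>_. L)) = sets (PiM I (\<lambda>_. N))"
  by (intro sets_PiM_cong) auto

lemma prob_space_L: "prob_space L"
  by (rule prob_space_distr) simp

sublocale coup: prob_space "coupSpace L"
  unfolding coupSpace_def by (intro prob_space_PiM prob_space_L)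

lemma sets_coupSpace[measurable_cong]: "sets (coupSpace L) = sets (PiM UNIV (\<lambda>_. N))"
  unfolding coupSpace_def by (rule sets_PiM_L)

lemma measurable_reindex:
  "(\<lambda>\<omega> i. \<omega> (f i)) \<in> PiM UNIV (\<lambda>_. N) \<rightarrow>\<^sub>M PiM UNIV (\<lambda>_. N)"
  by (rule measurable_PiM_single') (auto simp: PiE_def space_PiM)

lemma measurable_eps_shift[measurable]: "(\<lambda>\<omega> i. eps (f i) \<omega>) \<in> M \<rightarrow>\<^sub>M PiM UNIV (\<lambda>_. N)"
  by (rule measurable_PiM_single') (auto simp: PiE_def measurable_space[OF eps_meas])

text \<open>A product of copies of one law does not see an injective renaming of coordinates. The
  target is written with \<open>N\<close>, where \<open>Y\<close> is measurable; it has the same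
  sets as the product built from \<open>L\<close>.\<close>

lemma distr_PiM_L_reindex:
  fixes f :: "'i \<Rightarrow> 'j"
  assumes "inj f"
  shows "distr (PiM UNIV (\<lambda>_. L)) (PiM UNIV (\<lambda>_. N)) (\<lambda>\<omega> i. \<omega> (f i)) = PiM UNIV (\<lambda>_. L)"
proof -
  have "distr (PiM UNIV (\<lambda>_. L)) (PiM UNIV (\<lambda>_. L)) (\<lambda>\<omega>. \<lambda>n\<in>UNIV. \<omega> (f n)) = PiM UNIV (\<lambda>_. L)"
    using assms prob_space_L by (intro distr_PiM_reindex) auto
  moreover have "distr (PiM UNIV (\<lambda>_. L)) (PiM UNIV (\<lambda>_. L)) (\<lambda>\<omega> i. \<omega> (f i)) =
    distr (PiM UNIV (\<lambda>_. L)) (PiM UNIV (\<lambda>_. N)) (\<lambda>\<omega> i. \<omega> (f i))"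
    by (intro distr_cong sets_PiM_L refl)
  ultimately show ?thesis
    by (simp only: restrict_UNIV)
qed

lemma distr_coupSpace_reindex:
  fixes f :: "'i \<Rightarrow> bool \<times> int"
  assumes "inj f"
  shows "distr (coupSpace L) (PiM UNIV (\<lambda>_. N)) (\<lambda>\<omega> i. \<omega> (f i)) = PiM UNIV (\<lambda>_. L)"
  unfolding coupSpace_def by (rule distr_PiM_L_reindex[OF assms])

lemma distr_eps_shift:
  fixes f :: "'i \<Rightarrow> int"
  assumes "inj f"
  shows "distr M (PiM UNIV (\<lambda>_. N)) (\<lambda>\<omega> i. eps (f i) \<omega>) = PiM UNIV (\<lambda>_. L)"
proof -
  have 1: "distr M Seq (\<lambda>\<omega> i. eps i \<omega>) = PiM UNIV (\<lambda>_. L)"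
  proof -
    have "PiM UNIV (\<lambda>i. distr M N (eps i)) = PiM UNIV (\<lambda>_. L)"
      by (intro PiM_cong refl eps_ident)
    then show ?thesis
      using iffD1[OF indep_vars_iff_distr_eq_PiM[OF UNIV_not_empty eps_meas] eps_indep]
      by (simp only: restrict_UNIV)
  qed
  have "distr M (PiM UNIV (\<lambda>_. N)) (\<lambda>\<omega> i. eps (f i) \<omega>) =
      distr (distr M Seq (\<lambda>\<omega> i. eps i \<omega>)) (PiM UNIV (\<lambda>_. N)) (\<lambda>\<omega> i. \<omega> (f i))"
    by (subst distr_distr[OF measurable_reindex measurable_eps_shift]) (simp add: comp_def)
  also have "\<dots> = PiM UNIV (\<lambda>_. L)"
    unfolding 1 by (rule distr_PiM_L_reindex[OF assms])
  finally show ?thesis .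
qed

text \<open>Bridge between the given space and the canonical one: the process lives on
  \<open>M\<close>, the coupling on \<open>coupSpace L\<close>, and both push forward to the same
  product law along injective index maps. An index map that switches to the copy in the past is
  injective too.\<close>

lemma integral_eps_eq_coup:
  fixes H :: "('i \<Rightarrow> 'e) \<Rightarrow> 'b::{banach, second_countable_topology}"
  assumes H[measurable]: "H \<in> borel_measurable (PiM UNIV (\<lambda>_. N))" and "inj f" "inj g"
  shows "(\<integral>\<omega>. H (\<lambda>i. eps (f i) \<omega>) \<partial>M) = (\<integral>\<omega>. H (\<lambda>i. \<omega> (g i)) \<partial>coupSpace L)"
proof -
  have "(\<integral>\<omega>. H (\<lambda>i. eps (f i) \<omega>) \<partial>M) = (\<integral>x. H x \<partial>distr M (PiM UNIV (\<lambda>_. N)) (\<lambda>\<omega> i. eps (f i) \<omega>))"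
    by (simp only: integral_distr[OF measurable_eps_shift H])
  also have "\<dots> = (\<integral>x. H x \<partial>distr (coupSpace L) (PiM UNIV (\<lambda>_. N)) (\<lambda>\<omega> i. \<omega> (g i)))"
    unfolding distr_eps_shift[OF \<open>inj f\<close>] distr_coupSpace_reindex[OF \<open>inj g\<close>] ..
  also have "\<dots> = (\<integral>\<omega>. H (\<lambda>i. \<omega> (g i)) \<partial>coupSpace L)"
    by (intro integral_distr H) (simp add: measurable_cong_sets[OF sets_coupSpace refl] measurable_reindex)
  finally show ?thesis .
qed

text \<open>Source of stationarity: a time shift is an injective reindexing of the
  innovations.\<close>

lemma integral_eps_cong:
  fixes H :: "('i \<Rightarrow> 'e) \<Rightarrow> 'b::{banach, second_countable_topology}"
  assumes H[measurable]: "H \<in> borel_measurable (PiM UNIV (\<lambda>_. N))" and "inj f" "inj g"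
  shows "(\<integral>\<omega>. H (\<lambda>i. eps (f i) \<omega>) \<partial>M) = (\<integral>\<omega>. H (\<lambda>i. eps (g i) \<omega>) \<partial>M)"
proof -
  have "(\<integral>\<omega>. H (\<lambda>i. eps (f i) \<omega>) \<partial>M) = (\<integral>x. H x \<partial>distr M (PiM UNIV (\<lambda>_. N)) (\<lambda>\<omega> i. eps (f i) \<omega>))"
    by (simp only: integral_distr[OF measurable_eps_shift H])
  also have "\<dots> = (\<integral>x. H x \<partial>distr M (PiM UNIV (\<lambda>_. N)) (\<lambda>\<omega> i. eps (g i) \<omega>))"
    unfolding distr_eps_shift[OF \<open>inj f\<close>] distr_eps_shift[OF \<open>inj g\<close>] ..
  also have "\<dots> = (\<integral>\<omega>. H (\<lambda>i. eps (g i) \<omega>) \<partial>M)"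
    by (simp only: integral_distr[OF measurable_eps_shift H])
  finally show ?thesis .
qed

lemma indep_vars_coup: "coup.indep_vars (\<lambda>_. L) (\<lambda>i \<omega>. \<omega> i) UNIV"
proof (subst coup.indep_vars_iff_distr_eq_PiM)
  show "(\<lambda>\<omega>. \<omega> i) \<in> coupSpace L \<rightarrow>\<^sub>M L" for i
    unfolding coupSpace_def by simp
  have "PiM UNIV (\<lambda>_::bool \<times> int. L) = PiM UNIV (\<lambda>i. distr (PiM UNIV (\<lambda>_::bool \<times> int. L)) L (\<lambda>\<omega>. \<omega> i))"
    by (intro PiM_cong refl distr_PiM_component[symmetric] prob_space_L) simp
  then show "distr (coupSpace L) (PiM UNIV (\<lambda>_. L)) (\<lambda>x. \<lambda>i\<in>UNIV. x i) =
     PiM UNIV (\<lambda>i. distr (coupSpace L) L (\<lambda>\<omega>. \<omega> i))"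
    unfolding coupSpace_def restrict_UNIV by (simp only: distr_id2)
qed simp

text \<open>The sequence \<open>\<lambda>i. \<omega> (1 \<le> i, i)\<close> uses the independent copy at all times up to 0. It has the law of the
  original sequence but is independent of its past, which turns the covariance into a coupling error.\<close>

lemma integral_past_future:
  fixes F :: "(nat \<Rightarrow> 'e) \<Rightarrow> complex" and G :: "(int \<Rightarrow> 'e) \<Rightarrow> complex"
  assumes F: "F \<in> borel_measurable (PiM UNIV (\<lambda>_. N))"
    and G: "G \<in> borel_measurable (PiM UNIV (\<lambda>_. N))"
    and bF: "\<And>x. norm (F x) \<le> BF" and bG: "\<And>x. norm (G x) \<le> BG"
  shows "(\<integral>\<omega>. F (\<lambda>i. eps (s - int i) \<omega>) * G (\<lambda>i. eps (s + i) \<omega>) \<partial>M) -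
      (\<integral>\<omega>. F (\<lambda>i. eps (s - int i) \<omega>) \<partial>M) * (\<integral>\<omega>. G (\<lambda>i. eps (s + i) \<omega>) \<partial>M) =
    (\<integral>\<omega>. F (\<lambda>i. \<omega> (True, - int i)) * (G (\<lambda>i. \<omega> (True, i)) - G (\<lambda>i. \<omega> (1 \<le> i, i))) \<partial>coupSpace L)"
proof -
  let ?C = "coupSpace L"
  let ?F = "\<lambda>\<omega>. F (\<lambda>i. \<omega> (True, - int i))" and ?G = "\<lambda>\<omega>. G (\<lambda>i. \<omega> (True, i))" and ?G' = "\<lambda>\<omega>. G (\<lambda>i. \<omega> (1 \<le> i, i))"
  have m: "?F \<in> borel_measurable ?C" "?G \<in> borel_measurable ?C" "?G' \<in> borel_measurable ?C"
    using measurable_compose[OF measurable_reindex F, of "\<lambda>i. (True, - int i)"]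
      measurable_compose[OF measurable_reindex G, of "\<lambda>i. (True, i)"]
      measurable_compose[OF measurable_reindex G, of "\<lambda>i. (1 \<le> i, i)"]
    by (simp_all add: measurable_cong_sets[OF sets_coupSpace refl])
  have int: "integrable ?C ?F" "integrable ?C ?G" "integrable ?C ?G'"
    using bF bG by (auto intro: coup.integrable_const_bound[where B = BF, OF _ m(1)]
      coup.integrable_const_bound[where B = BG, OF _ m(2)] coup.integrable_const_bound[where B = BG, OF _ m(3)])
  have intFG: "integrable ?C (\<lambda>\<omega>. ?F \<omega> * ?G \<omega>)"
    by (intro coup.integrable_const_bound[where B = "BF * BG"] borel_measurable_times m)
       (auto simp: norm_mult intro!: mult_mono bF bG order_trans[OF norm_ge_zero bF])
  have FG: "(\<lambda>x. F (\<lambda>i. x (- int i)) * G x) \<in> borel_measurable (PiM UNIV (\<lambda>_. N))"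
    by (intro borel_measurable_times measurable_compose[OF measurable_reindex F] G)
  have 1: "(\<integral>\<omega>. F (\<lambda>i. eps (s - int i) \<omega>) * G (\<lambda>i. eps (s + i) \<omega>) \<partial>M) = (\<integral>\<omega>. ?F \<omega> * ?G \<omega> \<partial>?C)"
    using integral_eps_eq_coup[OF FG, of "\<lambda>i. s + i" "\<lambda>i. (True, i)"] by (simp add: inj_on_def)
  have 2: "(\<integral>\<omega>. F (\<lambda>i. eps (s - int i) \<omega>) \<partial>M) = (\<integral>\<omega>. ?F \<omega> \<partial>?C)"
    by (rule integral_eps_eq_coup[OF F]) (auto simp: inj_on_def)
  \<comment> \<open>The map sending \<open>i\<close> to \<open>(1 \<le> i, i)\<close> is injective,
    so putting the copy in the place of the past does not change the law of this functional.\<close>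
  have 3: "(\<integral>\<omega>. G (\<lambda>i. eps (s + i) \<omega>) \<partial>M) = (\<integral>\<omega>. ?G' \<omega> \<partial>?C)"
    by (rule integral_eps_eq_coup[OF G]) (auto simp: inj_on_def)
  \<comment> \<open>\<open>?F\<close> reads only coordinates in \<open>?A\<close>, the original
    innovations at times up to 0. \<open>?G'\<close> reads originals at positive times and copies
    otherwise, all of them outside \<open>?A\<close>.\<close>
  let ?A = "{(True, i) | i. i \<le> (0::int)}"
  have ind: "coup.indep_var (PiM ?A (\<lambda>_. L)) (\<lambda>\<omega>. restrict \<omega> ?A) (PiM (- ?A) (\<lambda>_. L)) (\<lambda>\<omega>. restrict \<omega> (- ?A))"
    using coup.indep_var_restrict[OF indep_vars_coup, of ?A "- ?A"] by simp
  have mA: "(\<lambda>x i. x (f i)) \<in> PiM B (\<lambda>_. L) \<rightarrow>\<^sub>M PiM UNIV (\<lambda>_. N)" if "range f \<subseteq> B" for f :: "'i \<Rightarrow> bool \<times> int" and B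
  proof (rule measurable_PiM_single')
    have fB: "f i \<in> B" for i using that by auto
    show "(\<lambda>x. x (f i)) \<in> PiM B (\<lambda>_. L) \<rightarrow>\<^sub>M N" for i
      using measurable_component_singleton[OF fB, where M = "\<lambda>_. L"] by simp
    show "(\<lambda>x i. x (f i)) \<in> space (PiM B (\<lambda>_. L)) \<rightarrow> (\<Pi>\<^sub>E i\<in>UNIV. space N)"
    proof (rule Pi_I)
      fix x assume "x \<in> space (PiM B (\<lambda>_. L))"
      then have "x j \<in> space N" if "j \<in> B" for j
        using that PiE_mem by (fastforce simp: space_PiM)
      then show "(\<lambda>i. x (f i)) \<in> (\<Pi>\<^sub>E i\<in>UNIV. space N)"
        using fB by (simp add: PiE_def)
    qed
  qed
  have "coup.indep_var borel ((\<lambda>x. F (\<lambda>i. x (True, - int i))) \<circ> (\<lambda>\<omega>. restrict \<omega> ?A))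
     borel ((\<lambda>x. G (\<lambda>i. x (1 \<le> i, i))) \<circ> (\<lambda>\<omega>. restrict \<omega> (- ?A)))"
    by (rule coup.indep_var_compose[OF ind]) (rule measurable_compose[OF mA F] measurable_compose[OF mA G], force)+
  then have "coup.indep_var borel ?F borel ?G'"
    by (simp add: comp_def)
  then have 4: "(\<integral>\<omega>. ?F \<omega> * ?G' \<omega> \<partial>?C) = (\<integral>\<omega>. ?F \<omega> \<partial>?C) * (\<integral>\<omega>. ?G' \<omega> \<partial>?C)"
    and intFG': "integrable ?C (\<lambda>\<omega>. ?F \<omega> * ?G' \<omega>)"
    using coup.indep_var_lebesgue_integral coup.indep_var_integrable int by blast+
  show ?thesis
    unfolding 1 2 3 4[symmetric] using intFG intFG' by (simp add: right_diff_distrib)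
qed

end

section \<open>Causal processes and the cost of replacing the past\<close>

locale stationary_process = iid_innovations +
  fixes Y :: "(nat \<Rightarrow> 'b) \<Rightarrow> real"
  assumes Y_meas[measurable]: "Y \<in> borel_measurable (PiM UNIV (\<lambda>_. N))"
begin

abbreviation "X \<equiv> Xproc Y eps"

lemma X_measurable[measurable]: "X t \<in> borel_measurable M"
  unfolding Xproc_def[abs_def] by (rule measurable_compose[OF measurable_eps_shift Y_meas])

lemma Xcoup_measurable[measurable]: "Xcoup Y t \<in> borel_measurable (coupSpace L)"
  unfolding Xcoup_def[abs_def] measurable_cong_sets[OF sets_coupSpace refl]
  by (rule measurable_compose[OF measurable_reindex Y_meas])

lemma Xcoup'_alt: "Xcoup' Y t \<omega> = Y (\<lambda>i. \<omega> (1 \<le> t - int i, t - int i))"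
  unfolding Xcoup'_def by (intro arg_cong[where f = Y]) auto

lemma Xcoup'_measurable[measurable]: "Xcoup' Y t \<in> borel_measurable (coupSpace L)"
  unfolding Xcoup'_alt[abs_def] measurable_cong_sets[OF sets_coupSpace refl]
  by (rule measurable_compose[OF measurable_reindex Y_meas])

text \<open>For \<open>h = below xi\<close> this is \<open>coupL2\<close>. The time is an integer
  because the function is evaluated at differences \<open>t - s\<close>.\<close>

definition coup_dist :: "(real \<Rightarrow> real) \<Rightarrow> int \<Rightarrow> real" where
  "coup_dist h n = sqrt (\<integral>\<omega>. (h (Xcoup Y n \<omega>) - h (Xcoup' Y n \<omega>))\<^sup>2 \<partial>coupSpace L)"

lemma integral_h_stationary:
  fixes h :: "real \<Rightarrow> 'c::{banach, second_countable_topology}"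
  assumes "h \<in> borel_measurable borel"
  shows "(\<integral>\<omega>. h (X s \<omega>) \<partial>M) = (\<integral>\<omega>. h (X t \<omega>) \<partial>M)"
  using integral_eps_cong[OF measurable_compose[OF Y_meas assms], of "\<lambda>i. s - int i" "\<lambda>i. t - int i"]
  by (simp add: Xproc_def inj_on_def)

lemma integral_h_stationary2:
  fixes h :: "real \<Rightarrow> real \<Rightarrow> real"
  assumes "(\<lambda>x. h (fst x) (snd x)) \<in> borel_measurable (borel \<Otimes>\<^sub>M borel)"
  shows "(\<integral>\<omega>. h (X s \<omega>) (X t \<omega>) \<partial>M) = (\<integral>\<omega>. h (X (s + u) \<omega>) (X (t + u) \<omega>) \<partial>M)"
proof -
  have 1: "(\<lambda>x. (Y (\<lambda>i. x (s - int i)), Y (\<lambda>i. x (t - int i)))) \<in> PiM UNIV (\<lambda>_. N) \<rightarrow>\<^sub>M borel \<Otimes>\<^sub>M borel"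
    by (intro measurable_Pair measurable_compose[OF measurable_reindex Y_meas])
  show ?thesis
    using integral_eps_cong[OF measurable_compose[OF 1 assms], of "\<lambda>i. i" "\<lambda>i. i + u"]
    by (simp add: Xproc_def inj_on_def algebra_simps)
qed

text \<open>The variable at time \<open>s\<close> is a function of the past, so the covariance
  equals the mean of this variable times a coupling difference of the later one. Cauchy-Schwarz is
  applied without estimating \<open>h\<close> by \<open>B\<close>: the root of the second moment is
  what later makes increments over short intervals small.\<close>

lemma covariance_decay:
  assumes h[measurable]: "h \<in> borel_measurable borel" and B: "\<And>x. \<bar>h x\<bar> \<le> B"
  shows "\<bar>(\<integral>\<omega>. h (X s \<omega>) * h (X (s + int n) \<omega>) \<partial>M) - (\<integral>\<omega>. h (X 0 \<omega>) \<partial>M)\<^sup>2\<bar>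
    \<le> sqrt (\<integral>\<omega>. (h (X 0 \<omega>))\<^sup>2 \<partial>M) * coup_dist h (int n)"
proof -
  let ?C = "coupSpace L"
  define F where "F = (\<lambda>p. complex_of_real (h (Y p)))"
  define G where "G = (\<lambda>w. complex_of_real (h (Y (\<lambda>i. w (int n - int i)))))"
  have F: "F \<in> borel_measurable (PiM UNIV (\<lambda>_. N))"
    unfolding F_def by measurable
  have G: "G \<in> borel_measurable (PiM UNIV (\<lambda>_. N))"
    unfolding G_def by (rule measurable_compose[OF measurable_reindex F[unfolded F_def]])
  have "complex_of_real ((\<integral>\<omega>. h (X s \<omega>) * h (X (s + int n) \<omega>) \<partial>M) - (\<integral>\<omega>. h (X s \<omega>) \<partial>M) * (\<integral>\<omega>. h (X (s + int n) \<omega>) \<partial>M))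
    = complex_of_real (\<integral>\<omega>. h (Xcoup Y 0 \<omega>) * (h (Xcoup Y (int n) \<omega>) - h (Xcoup' Y (int n) \<omega>)) \<partial>?C)"
    using integral_past_future[OF F G, of B B s] B
    by (simp add: F_def G_def Xproc_def Xcoup_def Xcoup'_alt add_diff_eq flip: of_real_mult of_real_diff)
  then have "\<bar>(\<integral>\<omega>. h (X s \<omega>) * h (X (s + int n) \<omega>) \<partial>M) - (\<integral>\<omega>. h (X 0 \<omega>) \<partial>M)\<^sup>2\<bar>
    = \<bar>\<integral>\<omega>. h (Xcoup Y 0 \<omega>) * (h (Xcoup Y (int n) \<omega>) - h (Xcoup' Y (int n) \<omega>)) \<partial>?C\<bar>"
    using integral_h_stationary[OF h, of s 0] integral_h_stationary[OF h, of "s + int n" 0]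
    by (simp only: of_real_eq_iff power2_eq_square)
  also have "\<dots> \<le> sqrt (\<integral>\<omega>. (h (Xcoup Y 0 \<omega>))\<^sup>2 \<partial>?C) * coup_dist h (int n)"
    unfolding coup_dist_def
  proof (rule Cauchy_Schwarz_integral)
    have B2: "\<bar>h x - h y\<bar> \<le> 2 * B" for x y
      using B[of x] B[of y] by linarith
    show "integrable ?C (\<lambda>\<omega>. (h (Xcoup Y 0 \<omega>))\<^sup>2)"
      by (rule coup.integrable_const_bound[where B = "B\<^sup>2"]) (simp_all add: B abs_bound_imp_square_bound)
    show "integrable ?C (\<lambda>\<omega>. (h (Xcoup Y (int n) \<omega>) - h (Xcoup' Y (int n) \<omega>))\<^sup>2)"
      by (rule coup.integrable_const_bound[where B = "(2 * B)\<^sup>2"])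
        (simp_all add: abs_bound_imp_square_bound[OF B2, simplified])
  qed measurable
  also have "(\<integral>\<omega>. (h (Xcoup Y 0 \<omega>))\<^sup>2 \<partial>?C) = (\<integral>\<omega>. (h (X 0 \<omega>))\<^sup>2 \<partial>M)"
    using integral_eps_eq_coup[of "\<lambda>p. (h (Y p))\<^sup>2" "\<lambda>i. 0 - int i" "\<lambda>i. (True, 0 - int i)"]
    by (simp add: Xproc_def Xcoup_def inj_on_def)
  finally show ?thesis .
qed

text \<open>The exponential over \<open>A\<close> is a function of the innovations up to
  \<open>s\<close> with modulus one. When the past is replaced, the exponential over
  \<open>J\<close> changes by at most the weighted changes of its terms; their L1 norms are bounded
  by L2 norms, which are the coupling distances.\<close>

lemma char_factorize:
  assumes h[measurable]: "h \<in> borel_measurable borel" and B: "\<And>x. \<bar>h x\<bar> \<le> B"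
    and fin: "finite A" "finite J" and A: "\<And>t. t \<in> A \<Longrightarrow> t \<le> s" and J: "\<And>t. t \<in> J \<Longrightarrow> s < t"
  shows "cmod ((\<integral>\<omega>. iexp (\<Sum>t\<in>A \<union> J. a t * h (X t \<omega>)) \<partial>M) -
      (\<integral>\<omega>. iexp (\<Sum>t\<in>A. a t * h (X t \<omega>)) \<partial>M) * (\<integral>\<omega>. iexp (\<Sum>t\<in>J. a t * h (X t \<omega>)) \<partial>M))
    \<le> (\<Sum>t\<in>J. \<bar>a t\<bar> * coup_dist h (t - s))"
proof -
  let ?C = "coupSpace L"
  \<comment> \<open>The past sequence has the innovation of time \<open>s - i\<close> at index
    \<open>i\<close>. \<open>X t\<close> starts reading it at index \<open>s - t\<close>, a natural
    number because \<open>t \<le> s\<close>.\<close>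
  define F where "F = (\<lambda>p. iexp (\<Sum>t\<in>A. a t * h (Y (\<lambda>i. p (i + nat (s - t))))))"
  define G where "G = (\<lambda>w. iexp (\<Sum>t\<in>J. a t * h (Y (\<lambda>i. w (t - s - int i)))))"
  have hY: "(\<lambda>p. h (Y p)) \<in> borel_measurable (PiM UNIV (\<lambda>_. N))" by measurable
  have mF[measurable]: "F \<in> borel_measurable (PiM UNIV (\<lambda>_. N))"
    unfolding F_def using measurable_compose[OF measurable_reindex hY] by measurable
  have mG[measurable]: "G \<in> borel_measurable (PiM UNIV (\<lambda>_. N))"
    unfolding G_def using measurable_compose[OF measurable_reindex hY] by measurable
  have FX: "F (\<lambda>i. eps (s - int i) \<omega>) = iexp (\<Sum>t\<in>A. a t * h (X t \<omega>))" for \<omega>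
  proof -
    have "Y (\<lambda>i. eps (s - int (i + nat (s - t))) \<omega>) = X t \<omega>" if "t \<in> A" for t
      using A[OF that] by (simp add: Xproc_def algebra_simps)
    then show ?thesis
      unfolding F_def by simp
  qed
  have GX: "G (\<lambda>i. eps (s + i) \<omega>) = iexp (\<Sum>t\<in>J. a t * h (X t \<omega>))" for \<omega>
    unfolding G_def by (simp add: Xproc_def algebra_simps)
  have FGX: "iexp (\<Sum>t\<in>A. a t * h (X t \<omega>)) * iexp (\<Sum>t\<in>J. a t * h (X t \<omega>)) = iexp (\<Sum>t\<in>A \<union> J. a t * h (X t \<omega>))" for \<omega>
  proof -
    have "A \<inter> J = {}" using A J by force
    then show ?thesis
      using fin by (simp add: sum.union_disjoint exp_add distrib_left)
  qed
  have GC: "G (\<lambda>i. \<omega> (True, i)) = iexp (\<Sum>t\<in>J. a t * h (Xcoup Y (t - s) \<omega>))"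
    "G (\<lambda>i. \<omega> (1 \<le> i, i)) = iexp (\<Sum>t\<in>J. a t * h (Xcoup' Y (t - s) \<omega>))" for \<omega>
    unfolding G_def Xcoup_def Xcoup'_alt by simp_all
  have nF: "cmod (F p) \<le> 1" and nG: "cmod (G w) \<le> 1" for p w
    unfolding F_def G_def by simp_all
  have B2: "\<bar>h x - h y\<bar> \<le> 2 * B" for x y
    using B[of x] B[of y] by linarith
  have iC: "integrable ?C (\<lambda>\<omega>. h (Xcoup Y n \<omega>) - h (Xcoup' Y n \<omega>))"
    "integrable ?C (\<lambda>\<omega>. (h (Xcoup Y n \<omega>) - h (Xcoup' Y n \<omega>))\<^sup>2)" for n
    subgoal by (rule coup.integrable_const_bound[where B = "2 * B"]) (simp_all add: B2)
    subgoal by (rule coup.integrable_const_bound[where B = "(2 * B)\<^sup>2"])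
       (simp_all add: abs_bound_imp_square_bound[OF B2, simplified])
    done
  have "cmod ((\<integral>\<omega>. iexp (\<Sum>t\<in>A \<union> J. a t * h (X t \<omega>)) \<partial>M) -
      (\<integral>\<omega>. iexp (\<Sum>t\<in>A. a t * h (X t \<omega>)) \<partial>M) * (\<integral>\<omega>. iexp (\<Sum>t\<in>J. a t * h (X t \<omega>)) \<partial>M))
    = cmod (\<integral>\<omega>. F (\<lambda>i. \<omega> (True, - int i)) * (G (\<lambda>i. \<omega> (True, i)) - G (\<lambda>i. \<omega> (1 \<le> i, i))) \<partial>?C)"
    using integral_past_future[OF mF mG nF nG, of s] by (simp only: FX GX FGX)
  also have "\<dots> \<le> (\<integral>\<omega>. (\<Sum>t\<in>J. \<bar>a t\<bar> * \<bar>h (Xcoup Y (t - s) \<omega>) - h (Xcoup' Y (t - s) \<omega>)\<bar>) \<partial>?C)"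
  proof (rule norm_integral_le_integral)
    have mm: "(\<lambda>\<omega>. F (\<lambda>i. \<omega> (True, - int i))) \<in> borel_measurable ?C"
      unfolding measurable_cong_sets[OF sets_coupSpace refl]
      by (rule measurable_compose[OF measurable_reindex mF])
    show "integrable ?C (\<lambda>\<omega>. F (\<lambda>i. \<omega> (True, - int i)) * (G (\<lambda>i. \<omega> (True, i)) - G (\<lambda>i. \<omega> (1 \<le> i, i))))"
    proof (rule coup.integrable_const_bound[where B = 2])
      show "AE \<omega> in ?C. cmod (F (\<lambda>i. \<omega> (True, - int i)) * (G (\<lambda>i. \<omega> (True, i)) - G (\<lambda>i. \<omega> (1 \<le> i, i)))) \<le> 2"
      proof (rule AE_I2)
        fix \<omega>
        have "cmod (G (\<lambda>i. \<omega> (True, i)) - G (\<lambda>i. \<omega> (1 \<le> i, i))) \<le> 1 + 1"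
          by (intro order_trans[OF norm_triangle_ineq4] add_mono nG)
        then show "cmod (F (\<lambda>i. \<omega> (True, - int i)) * (G (\<lambda>i. \<omega> (True, i)) - G (\<lambda>i. \<omega> (1 \<le> i, i)))) \<le> 2"
          using mult_mono[OF nF[of "\<lambda>i. \<omega> (True, - int i)"], of _ "1 + 1"] unfolding norm_mult by simp
      qed
      show "(\<lambda>\<omega>. F (\<lambda>i. \<omega> (True, - int i)) * (G (\<lambda>i. \<omega> (True, i)) - G (\<lambda>i. \<omega> (1 \<le> i, i)))) \<in> borel_measurable ?C"
        unfolding GC by (intro borel_measurable_times mm) measurable
    qed
    show "integrable ?C (\<lambda>\<omega>. \<Sum>t\<in>J. \<bar>a t\<bar> * \<bar>h (Xcoup Y (t - s) \<omega>) - h (Xcoup' Y (t - s) \<omega>)\<bar>)"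
      using iC by (intro Bochner_Integration.integrable_sum integrable_mult_right integrable_abs)
    fix \<omega>
    have "cmod (F (\<lambda>i. \<omega> (True, - int i)) * (G (\<lambda>i. \<omega> (True, i)) - G (\<lambda>i. \<omega> (1 \<le> i, i)))) \<le>
       1 * \<bar>(\<Sum>t\<in>J. a t * h (Xcoup Y (t - s) \<omega>)) - (\<Sum>t\<in>J. a t * h (Xcoup' Y (t - s) \<omega>))\<bar>"
      unfolding norm_mult GC by (intro mult_mono nF norm_iexp_diff_le) auto
    also have "\<dots> = \<bar>\<Sum>t\<in>J. a t * (h (Xcoup Y (t - s) \<omega>) - h (Xcoup' Y (t - s) \<omega>))\<bar>"
      by (simp add: sum_subtractf right_diff_distrib)
    also have "\<dots> \<le> (\<Sum>t\<in>J. \<bar>a t\<bar> * \<bar>h (Xcoup Y (t - s) \<omega>) - h (Xcoup' Y (t - s) \<omega>)\<bar>)"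
      by (rule order_trans[OF sum_abs]) (simp add: abs_mult)
    finally show "cmod (F (\<lambda>i. \<omega> (True, - int i)) * (G (\<lambda>i. \<omega> (True, i)) - G (\<lambda>i. \<omega> (1 \<le> i, i)))) \<le> \<dots>" .
  qed
  also have "\<dots> = (\<Sum>t\<in>J. \<bar>a t\<bar> * (\<integral>\<omega>. \<bar>h (Xcoup Y (t - s) \<omega>) - h (Xcoup' Y (t - s) \<omega>)\<bar> \<partial>?C))"
    using iC by (subst Bochner_Integration.integral_sum) (auto intro!: integrable_mult_right integrable_abs)
  also have "\<dots> \<le> (\<Sum>t\<in>J. \<bar>a t\<bar> * coup_dist h (t - s))"
    unfolding coup_dist_def
    by (intro sum_mono mult_left_mono coup.expectation_abs_le_sqrt iC) auto
  finally show ?thesis .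
qed

end

section \<open>Covariances, blocks and characteristic functions\<close>

text \<open>Every distance from \<open>s\<close> is attained at most once on each side, hence the
  factor 2.\<close>

lemma sum_dist_le_suminf:
  fixes f :: "nat \<Rightarrow> real" and S :: "int set"
  assumes "finite S" "summable f" "\<And>k. 0 \<le> f k"
  shows "(\<Sum>t\<in>S. f (nat \<bar>s - t\<bar>)) \<le> 2 * (\<Sum>k. f k)"
proof -
  have half: "(\<Sum>t\<in>R. f (nat \<bar>s - t\<bar>)) \<le> (\<Sum>k. f k)"
    if "finite R" "inj_on (\<lambda>t. nat \<bar>s - t\<bar>) R" for R
    using sum_le_suminf[of f "(\<lambda>t. nat \<bar>s - t\<bar>) ` R"] assms(2,3) that by (simp add: sum.reindex)
  have "(\<Sum>t\<in>S. f (nat \<bar>s - t\<bar>)) = (\<Sum>t\<in>S \<inter> {..s}. f (nat \<bar>s - t\<bar>)) + (\<Sum>t\<in>S \<inter> {s<..}. f (nat \<bar>s - t\<bar>))"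
    using assms by (subst sum.union_disjoint[symmetric]) (auto intro!: sum.cong)
  also have "\<dots> \<le> (\<Sum>k. f k) + (\<Sum>k. f k)"
    using assms by (intro add_mono half) (auto simp: inj_on_def)
  finally show ?thesis by simp
qed

lemma sum_power_dist_le:
  fixes \<sigma> :: real and S :: "int set"
  assumes "finite S" "0 < \<sigma>" "\<sigma> < 1"
  shows "(\<Sum>t\<in>S. \<sigma> ^ nat \<bar>s - t\<bar>) \<le> 2 / (1 - \<sigma>)"
  using sum_dist_le_suminf[of S "\<lambda>k. \<sigma> ^ k" s] assms by (simp add: suminf_geometric summable_geometric)

lemma exp_minus_quadratic_bound:
  fixes x :: real assumes "0 \<le> x"
  shows "\<bar>exp (- x) - (1 - x)\<bar> \<le> x\<^sup>2 / 2"
proof -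
  have "1 - x \<le> exp (- x)" using exp_ge_add_one_self[of "- x"] by simp
  moreover have "exp (- x) \<le> 1 - x + x\<^sup>2 / 2"
  proof -
    have pos: "0 < 1 + x + x\<^sup>2 / 2" using assms by (intro add_pos_nonneg) auto
    have "exp (- x) \<le> 1 / (1 + x + x\<^sup>2 / 2)"
      using exp_lower_Taylor_quadratic[OF assms] pos by (simp add: exp_minus field_simps)
    \<comment> \<open>The product is \<open>1 + x^4 / 4\<close>, so the quadratic Taylor polynomial
      at \<open>- x\<close> dominates the reciprocal of the one at \<open>x\<close>.\<close>
    also have "1 \<le> (1 - x + x\<^sup>2 / 2) * (1 + x + x\<^sup>2 / 2)"
    proof -
      have "(1 - x + x\<^sup>2 / 2) * (1 + x + x\<^sup>2 / 2) = 1 + (x\<^sup>2 / 2)\<^sup>2"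
        by (simp add: power2_eq_square algebra_simps)
      then show ?thesis by simp
    qed
    then have "1 / (1 + x + x\<^sup>2 / 2) \<le> 1 - x + x\<^sup>2 / 2"
      using pos by (simp add: divide_le_eq)
    finally show ?thesis .
  qed
  ultimately show ?thesis by (simp add: abs_if)
qed

context stationary_process
begin

lemma coup_dist_nonneg: "0 \<le> coup_dist f n"
  unfolding coup_dist_def by simp

lemma covariance_le_geometric:
  assumes h[measurable]: "h \<in> borel_measurable borel" and B: "\<And>x. \<bar>h x\<bar> \<le> B"
    and c: "(\<integral>\<omega>. h (X 0 \<omega>) \<partial>M) = 0" and v: "(\<integral>\<omega>. (h (X 0 \<omega>))\<^sup>2 \<partial>M) \<le> v"
    and D: "\<And>n. coup_dist h (int n) \<le> D * \<sigma> ^ n"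
  shows "\<bar>\<integral>\<omega>. h (X s \<omega>) * h (X t \<omega>) \<partial>M\<bar> \<le> sqrt v * D * \<sigma> ^ nat \<bar>s - t\<bar>"
proof -
  have le: "\<bar>\<integral>\<omega>. h (X s \<omega>) * h (X t \<omega>) \<partial>M\<bar> \<le> sqrt v * D * \<sigma> ^ nat \<bar>s - t\<bar>" if "s \<le> t" for s t
  proof -
    have "sqrt (\<integral>\<omega>. (h (X 0 \<omega>))\<^sup>2 \<partial>M) * coup_dist h (int (nat (t - s))) \<le> sqrt v * (D * \<sigma> ^ nat (t - s))"
      using D[of 0] coup_dist_nonneg by (intro mult_mono D real_sqrt_le_mono v) (auto simp: order_trans[OF _ v])
    then show ?thesis
      using covariance_decay[OF h B, of s "nat (t - s)"] c that by (simp add: mult.assoc)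
  qed
  show ?thesis
    using le[of s t] le[of t s] by (cases "s \<le> t") (simp_all add: mult.commute abs_minus_commute)
qed

text \<open>Row sums of the geometric kernel are bounded uniformly, so the double sum grows only
  like the number of points. Bounded weights of any sign are allowed, which covers trigonometric and
  constant weights alike.\<close>

lemma weighted_variance_bound:
  assumes h[measurable]: "h \<in> borel_measurable borel" and B: "\<And>x. \<bar>h x\<bar> \<le> B"
    and cov: "\<And>s t. \<bar>\<integral>\<omega>. h (X s \<omega>) * h (X t \<omega>) \<partial>M\<bar> \<le> D * \<sigma> ^ nat \<bar>s - t\<bar>"
    and \<sigma>: "0 < \<sigma>" "\<sigma> < 1" and a: "\<And>t. t \<in> S \<Longrightarrow> \<bar>a t\<bar> \<le> K" and "finite S"
  shows "(\<integral>\<omega>. (\<Sum>t\<in>S. a t * h (X t \<omega>))\<^sup>2 \<partial>M) \<le> K\<^sup>2 * real (card S) * (2 * D / (1 - \<sigma>))"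
proof -
  have int: "integrable M (\<lambda>\<omega>. h (X s \<omega>) * h (X t \<omega>))" for s t
    by (rule integrable_const_bound[where B = "B * B"])
       (auto intro!: AE_I2 mult_mono B order_trans[OF abs_ge_zero B] simp: abs_mult)
  have "\<bar>\<integral>\<omega>. h (X 0 \<omega>) * h (X 0 \<omega>) \<partial>M\<bar> \<le> D" using cov[of 0 0] by simp
  then have D: "0 \<le> D" by linarith
  have "(\<integral>\<omega>. (\<Sum>t\<in>S. a t * h (X t \<omega>))\<^sup>2 \<partial>M) = (\<integral>\<omega>. (\<Sum>s\<in>S. \<Sum>t\<in>S. a s * a t * (h (X s \<omega>) * h (X t \<omega>))) \<partial>M)"
    by (simp add: power2_eq_square sum_product mult_ac)
  also have "\<dots> = (\<Sum>s\<in>S. \<Sum>t\<in>S. a s * a t * (\<integral>\<omega>. h (X s \<omega>) * h (X t \<omega>) \<partial>M))"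
    using int by (simp add: Bochner_Integration.integral_sum)
  also have "\<dots> \<le> (\<Sum>s\<in>S. \<Sum>t\<in>S. K\<^sup>2 * (D * \<sigma> ^ nat \<bar>s - t\<bar>))"
  proof (intro sum_mono)
    fix s t assume st: "s \<in> S" "t \<in> S"
    have "a s * a t * (\<integral>\<omega>. h (X s \<omega>) * h (X t \<omega>) \<partial>M) \<le> \<bar>a s\<bar> * \<bar>a t\<bar> * \<bar>\<integral>\<omega>. h (X s \<omega>) * h (X t \<omega>) \<partial>M\<bar>"
      by (simp flip: abs_mult)
    also have "\<dots> \<le> K * K * (D * \<sigma> ^ nat \<bar>s - t\<bar>)"
      using a[OF st(1)] by (intro mult_mono a st cov) auto
    finally show "a s * a t * (\<integral>\<omega>. h (X s \<omega>) * h (X t \<omega>) \<partial>M) \<le> K\<^sup>2 * (D * \<sigma> ^ nat \<bar>s - t\<bar>)"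
      by (simp add: power2_eq_square)
  qed
  also have "\<dots> = (\<Sum>s\<in>S. K\<^sup>2 * D * (\<Sum>t\<in>S. \<sigma> ^ nat \<bar>s - t\<bar>))"
    by (simp add: sum_distrib_left mult_ac)
  also have "\<dots> \<le> (\<Sum>s\<in>S. K\<^sup>2 * D * (2 / (1 - \<sigma>)))"
    using D by (intro sum_mono mult_left_mono sum_power_dist_le \<open>finite S\<close> \<sigma>) auto
  finally show ?thesis by (simp add: mult_ac)
qed

end

text \<open>Time is cut into periods of length \<open>m\<close>; the first \<open>q\<close> residues
  of a period are the gap in front of the block that fills the rest. With quotients and remainders
  the periods need not be counted: an index beyond the sample gives the empty set.\<close>

definition big_block :: "nat \<Rightarrow> nat \<Rightarrow> nat \<Rightarrow> nat \<Rightarrow> int set" where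
  "big_block m q n i = {t \<in> {1..int n}. t div int m = int i \<and> int q \<le> t mod int m}"

definition block_gaps :: "nat \<Rightarrow> nat \<Rightarrow> nat \<Rightarrow> int set" where
  "block_gaps m q n = {t \<in> {1..int n}. t mod int m < int q}"

lemma finite_big_block[simp]: "finite (big_block m q n i)"
  and finite_block_gaps[simp]: "finite (block_gaps m q n)"
  unfolding big_block_def block_gaps_def by (auto intro!: finite_subset[of _ "{1..int n}"])

lemma big_block_disjoint: "i \<noteq> j \<Longrightarrow> big_block m q n i \<inter> big_block m q n j = {}"
  unfolding big_block_def by auto

text \<open>Indices up to \<open>n\<close> suffice, since \<open>t div m\<close> never exceeds
  \<open>t\<close>.\<close>

lemma UN_big_block: "(\<Union>i<Suc n. big_block m q n i) = {1..int n} - block_gaps m q n"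
proof -
  have "t div int m \<in> int ` {..<Suc n}" if "t \<in> {1..int n}" for t
  proof -
    define k where "k = nat t"
    have k: "t = int k" "k \<le> n"
      using that by (auto simp: k_def)
    have "k div m \<in> {..<Suc n}"
      using order_trans[OF div_le_dividend k(2)] by (simp add: less_Suc_eq_le)
    then show ?thesis unfolding k(1) zdiv_int[symmetric] by blast
  qed
  then show ?thesis unfolding big_block_def block_gaps_def by (force simp: not_less)
qed

lemma card_big_block: assumes "m > 0" shows "card (big_block m q n i) \<le> m"
proof -
  have "big_block m q n i \<subseteq> {int i * int m ..< int i * int m + int m}"
  proof
    fix t assume "t \<in> big_block m q n i"
    then have "t = int i * int m + t mod int m"
      unfolding big_block_def using div_mult_mod_eq[of t "int m"] by auto
    then show "t \<in> {int i * int m ..< int i * int m + int m}"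
      using assms pos_mod_sign[of "int m" t] pos_mod_bound[of "int m" t]
      unfolding atLeastLessThan_iff by linarith
  qed
  then show ?thesis using card_mono[of "{int i * int m ..< int i * int m + int m}"] by fastforce
qed

lemma card_block_gaps: assumes "m > 0" shows "card (block_gaps m q n) \<le> (n div m + 1) * q"
proof -
  have "block_gaps m q n \<subseteq> (\<lambda>(i, r). int i * int m + int r) ` ({..n div m} \<times> {..<q})"
  proof
    fix t assume t: "t \<in> block_gaps m q n"
    define k where "k = nat t"
    have k: "t = int k" "k \<le> n"
      using t by (auto simp: k_def block_gaps_def)
    have km: "k mod m < q"
      using t unfolding block_gaps_def k(1) by (simp flip: zmod_int)
    have "k div m \<in> {..n div m}" using k(2) by (simp add: div_le_mono)
    moreover have "t = int (k div m) * int m + int (k mod m)"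
      unfolding k(1) of_nat_mult[symmetric] of_nat_add[symmetric] by simp
    ultimately show "t \<in> (\<lambda>(i, r). int i * int m + int r) ` ({..n div m} \<times> {..<q})"
      using km by (intro image_eqI[where x = "(k div m, k mod m)"]) auto
  qed
  then have "card (block_gaps m q n) \<le> card ({..n div m} \<times> {..<q})"
    by (intro surj_card_le) auto
  then show ?thesis by simp
qed

text \<open>The later point is at least \<open>q\<close> steps into its own period, which starts
  after the earlier point.\<close>

lemma big_block_dist:
  assumes "s \<in> big_block m q n i" "t \<in> big_block m q n j" "i < j"
  shows "int q \<le> t - s"
proof -
  have "m > 0"
    using assms unfolding big_block_def by (cases m) auto
  have "s = int i * int m + s mod int m" "t = int j * int m + t mod int m" "int q \<le> t mod int m"
    using assms unfolding big_block_def
    using div_mult_mod_eq[of t "int m"] div_mult_mod_eq[of s "int m"] by auto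
  moreover have "s mod int m < int m" using \<open>m > 0\<close> by simp
  moreover have "(int i + 1) * int m \<le> int j * int m" using \<open>i < j\<close> by (intro mult_right_mono) auto
  ultimately show ?thesis by (simp add: algebra_simps)
qed


text \<open>Abstract input of the central limit theorem: a bounded centred functional with
  geometrically decaying coupling distance. It is instantiated by \<open>Vfun tau\<close> at the
  true quantile.\<close>

locale mixing_functional = stationary_process +
  fixes h :: "real \<Rightarrow> real" and D \<sigma> :: real
  assumes h_meas[measurable]: "h \<in> borel_measurable borel"
    and h_le_1: "\<And>x. \<bar>h x\<bar> \<le> 1"
    and h_centred: "(\<integral>\<omega>. h (X 0 \<omega>) \<partial>M) = 0"
    and coup_dist_le: "\<And>n. coup_dist h (int n) \<le> D * \<sigma> ^ n"
    and \<sigma>: "0 < \<sigma>" "\<sigma> < 1"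
begin

lemma D_nonneg: "0 \<le> D"
proof -
  have "0 \<le> coup_dist h (int 0)" unfolding coup_dist_def by simp
  then show ?thesis using coup_dist_le[of 0] by simp
qed

lemma cov_le: "\<bar>\<integral>\<omega>. h (X s \<omega>) * h (X t \<omega>) \<partial>M\<bar> \<le> D * \<sigma> ^ nat \<bar>s - t\<bar>"
proof -
  have "(\<integral>\<omega>. (h (X 0 \<omega>))\<^sup>2 \<partial>M) \<le> (\<integral>\<omega>. 1 \<partial>M)"
    using abs_bound_imp_square_bound[OF h_le_1]
    by (intro integral_mono integrable_bounded[where B = 1]) auto
  then show ?thesis
    using covariance_le_geometric[OF h_meas h_le_1 h_centred, of 1 D \<sigma>] coup_dist_le by (simp add: prob_space)
qed

definition lin :: "(int \<Rightarrow> real) \<Rightarrow> int set \<Rightarrow> 'a \<Rightarrow> real" where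
  "lin a S \<omega> = (\<Sum>t\<in>S. a t * h (X t \<omega>))"

lemma lin_measurable[measurable]: "lin a S \<in> borel_measurable M"
  unfolding lin_def by measurable

lemma lin_bound: "\<bar>lin a S \<omega>\<bar> \<le> (\<Sum>t\<in>S. \<bar>a t\<bar>)"
proof -
  have "\<bar>a t * h (X t \<omega>)\<bar> \<le> \<bar>a t\<bar>" for t
    using mult_left_mono[OF h_le_1, of "\<bar>a t\<bar>"] by (simp add: abs_mult)
  then show ?thesis
    unfolding lin_def by (intro order_trans[OF sum_abs] sum_mono)
qed

lemma lin_union: "finite S \<Longrightarrow> finite R \<Longrightarrow> S \<inter> R = {} \<Longrightarrow> lin a (S \<union> R) \<omega> = lin a S \<omega> + lin a R \<omega>"
  unfolding lin_def by (rule sum.union_disjoint)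

lemma integrable_lin: "integrable M (lin a S)"
  by (rule integrable_bounded[OF lin_measurable]) (simp, rule lin_bound)

lemma integrable_lin_mult: "integrable M (\<lambda>\<omega>. lin a S \<omega> * lin b R \<omega>)"
  by (rule integrable_bounded[where B = "(\<Sum>t\<in>S. \<bar>a t\<bar>) * (\<Sum>t\<in>R. \<bar>b t\<bar>)"])
     (auto simp: abs_mult intro!: mult_mono lin_bound sum_nonneg)

lemma integrable_lin_square: "integrable M (\<lambda>\<omega>. (lin a S \<omega>)\<^sup>2)"
  unfolding power2_eq_square by (rule integrable_lin_mult)

lemma integral_lin: "(\<integral>\<omega>. lin a S \<omega> \<partial>M) = 0"
proof -
  have "integrable M (\<lambda>\<omega>. h (X t \<omega>))" for t
    by (rule integrable_bounded[where B = 1]) (auto simp: h_le_1)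
  moreover have "(\<integral>\<omega>. h (X t \<omega>) \<partial>M) = 0" for t
    using integral_h_stationary[OF h_meas, of t 0] h_centred by simp
  ultimately show ?thesis
    unfolding lin_def by (simp add: Bochner_Integration.integral_sum)
qed

lemma integral_lin_mult:
  "(\<integral>\<omega>. lin a S \<omega> * lin b R \<omega> \<partial>M) = (\<Sum>s\<in>S. \<Sum>t\<in>R. a s * b t * (\<integral>\<omega>. h (X s \<omega>) * h (X t \<omega>) \<partial>M))"
proof -
  have int: "integrable M (\<lambda>\<omega>. h (X s \<omega>) * h (X t \<omega>))" for s t
    by (rule integrable_bounded[where B = 1]) (auto intro!: mult_le_one simp: abs_mult h_le_1)
  have "(\<integral>\<omega>. lin a S \<omega> * lin b R \<omega> \<partial>M) = (\<integral>\<omega>. (\<Sum>s\<in>S. \<Sum>t\<in>R. a s * b t * (h (X s \<omega>) * h (X t \<omega>))) \<partial>M)"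
    by (simp add: lin_def sum_product mult_ac)
  also have "\<dots> = (\<Sum>s\<in>S. \<Sum>t\<in>R. a s * b t * (\<integral>\<omega>. h (X s \<omega>) * h (X t \<omega>) \<partial>M))"
    using int by (simp add: Bochner_Integration.integral_sum)
  finally show ?thesis .
qed

lemma integral_lin_square_le:
  assumes "\<And>t. t \<in> S \<Longrightarrow> \<bar>a t\<bar> \<le> K" "finite S"
  shows "(\<integral>\<omega>. (lin a S \<omega>)\<^sup>2 \<partial>M) \<le> K\<^sup>2 * real (card S) * (2 * D / (1 - \<sigma>))"
  unfolding lin_def by (rule weighted_variance_bound[OF h_meas h_le_1 cov_le \<sigma> assms])

lemma char_lin_bound: "cmod (\<integral>\<omega>. iexp (lin a S \<omega>) \<partial>M) \<le> 1"
  using norm_integral_le_integral[of M "\<lambda>\<omega>. iexp (lin a S \<omega>)" "\<lambda>_. 1"]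
  by (simp add: prob_space integrable_bounded[where B = 1])

lemma char_lin_diff_le:
  "cmod ((\<integral>\<omega>. iexp (lin a S \<omega>) \<partial>M) - (\<integral>\<omega>. iexp (lin b R \<omega>) \<partial>M)) \<le> sqrt (\<integral>\<omega>. (lin a S \<omega> - lin b R \<omega>)\<^sup>2 \<partial>M)"
proof -
  have i: "integrable M (\<lambda>\<omega>. iexp (lin a S \<omega>))" for a S
    by (rule integrable_bounded[where B = 1]) auto
  have "cmod ((\<integral>\<omega>. iexp (lin a S \<omega>) \<partial>M) - (\<integral>\<omega>. iexp (lin b R \<omega>) \<partial>M)) = cmod (\<integral>\<omega>. iexp (lin a S \<omega>) - iexp (lin b R \<omega>) \<partial>M)"
    using i by simp
  also have "\<dots> \<le> (\<integral>\<omega>. \<bar>lin a S \<omega> - lin b R \<omega>\<bar> \<partial>M)"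
    using i integrable_lin by (intro norm_integral_le_integral norm_iexp_diff_le) auto
  also have "\<dots> \<le> sqrt (\<integral>\<omega>. (lin a S \<omega> - lin b R \<omega>)\<^sup>2 \<partial>M)"
  proof (rule expectation_abs_le_sqrt)
    show "integrable M (\<lambda>\<omega>. (lin a S \<omega> - lin b R \<omega>)\<^sup>2)"
      unfolding power2_diff using integrable_lin_square integrable_lin_mult
      by (auto simp: mult.assoc)
  qed simp
  finally show ?thesis .
qed

text \<open>Induction splits off the latest block. The characteristic function of a block has
  modulus at most one, so earlier errors are passed on without growth.\<close>

lemma char_blocks_factorize:
  assumes "m > 0"
  shows "cmod ((\<integral>\<omega>. iexp (lin a (\<Union>i<k. big_block m q n i) \<omega>) \<partial>M) - (\<Prod>i<k. \<integral>\<omega>. iexp (lin a (big_block m q n i) \<omega>) \<partial>M))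
    \<le> (\<Sum>i<k. \<Sum>t\<in>big_block m q n i. \<bar>a t\<bar> * (D * \<sigma> ^ q))"
proof (induction k)
  case 0
  then show ?case by (simp add: lin_def prob_space)
next
  case (Suc k)
  let ?B = "big_block m q n k" and ?U = "\<Union>i<k. big_block m q n i"
  let ?c = "\<lambda>S. \<integral>\<omega>. iexp (lin a S \<omega>) \<partial>M"
  let ?p = "\<Prod>i<k. ?c (big_block m q n i)"
  have U: "(\<Union>i<Suc k. big_block m q n i) = ?U \<union> ?B"
    by (auto simp: less_Suc_eq)
  \<comment> \<open>The cut is the last time before period \<open>k\<close>. The gap at the start of
    that period falls on the future side, so every point of block \<open>k\<close> is more than
    \<open>q\<close> steps after the cut.\<close>
  let ?s = "int k * int m - 1"
  have le: "t \<le> ?s" if "t \<in> ?U" for t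
  proof -
    from that have "t div int m < int k" by (auto simp: big_block_def)
    then have "t div int m + 1 \<le> int k" by simp
    then have "(t div int m + 1) * int m \<le> int k * int m" by (intro mult_right_mono) auto
    moreover have "t = t div int m * int m + t mod int m" by simp
    moreover have "t mod int m < int m" using \<open>m > 0\<close> by simp
    ultimately show ?thesis unfolding distrib_right mult_1 by linarith
  qed
  have gt: "int q < t - ?s" if "t \<in> ?B" for t
  proof -
    have "t = int k * int m + t mod int m" "int q \<le> t mod int m"
      using that div_mult_mod_eq[of t "int m"] unfolding big_block_def by auto
    then show ?thesis by linarith
  qed
  have "cmod (?c (?U \<union> ?B) - ?c ?U * ?c ?B) \<le> (\<Sum>t\<in>?B. \<bar>a t\<bar> * coup_dist h (t - ?s))"
    unfolding lin_def
    by (rule char_factorize[OF h_meas h_le_1]) (use le gt in \<open>force+\<close>)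
  also have "\<dots> \<le> (\<Sum>t\<in>?B. \<bar>a t\<bar> * (D * \<sigma> ^ q))"
  proof (intro sum_mono mult_left_mono)
    fix t assume "t \<in> ?B"
    then have t: "int q < t - ?s" by (rule gt)
    then have "coup_dist h (t - ?s) \<le> D * \<sigma> ^ nat (t - ?s)"
      using coup_dist_le[of "nat (t - ?s)"] by simp
    also have "\<dots> \<le> D * \<sigma> ^ q"
      using \<sigma> t by (intro mult_left_mono D_nonneg power_decreasing) auto
    finally show "coup_dist h (t - ?s) \<le> D * \<sigma> ^ q" .
  qed simp
  finally have 1: "cmod (?c (?U \<union> ?B) - ?c ?U * ?c ?B) \<le> (\<Sum>t\<in>?B. \<bar>a t\<bar> * (D * \<sigma> ^ q))" .
  have "cmod (?c ?U * ?c ?B - ?p * ?c ?B) = cmod (?c ?U - ?p) * cmod (?c ?B)"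
    by (simp add: norm_mult flip: left_diff_distrib)
  also have "\<dots> \<le> cmod (?c ?U - ?p) * 1"
    by (intro mult_left_mono char_lin_bound) simp
  finally have 2: "cmod (?c ?U * ?c ?B - ?p * ?c ?B) \<le> (\<Sum>i<k. \<Sum>t\<in>big_block m q n i. \<bar>a t\<bar> * (D * \<sigma> ^ q))"
    using Suc.IH by simp
  show ?case
    unfolding U sum.lessThan_Suc prod.lessThan_Suc
    using norm_diff_triangle_le[OF 1 2] by (simp add: add.commute)
qed

text \<open>Both quantities are compared with \<open>1 - V / 2\<close>. The uniform bound
  \<open>\<kappa>\<close> turns the third moment of the Taylor remainder into
  \<open>\<kappa> * V\<close>. As the error is proportional to the variance, its sum over blocks is
  controlled by the sum of the block variances, however many blocks there are.\<close>

lemma char_lin_small: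
  assumes "(\<Sum>t\<in>S. \<bar>a t\<bar>) \<le> \<kappa>"
  defines "V \<equiv> \<integral>\<omega>. (lin a S \<omega>)\<^sup>2 \<partial>M"
  shows "cmod ((\<integral>\<omega>. iexp (lin a S \<omega>) \<partial>M) - complex_of_real (exp (- (V / 2)))) \<le> (\<kappa> + \<kappa>\<^sup>2) * V"
proof -
  have bd: "\<bar>lin a S \<omega>\<bar> \<le> \<kappa>" for \<omega>
    using lin_bound assms(1) by (rule order_trans)
  have \<kappa>: "0 \<le> \<kappa>" by (rule order_trans[OF sum_nonneg assms(1)]) simp
  have V0: "0 \<le> V" unfolding V_def by simp
  have sq: "(lin a S \<omega>)\<^sup>2 \<le> \<kappa>\<^sup>2" for \<omega>
    by (rule abs_bound_imp_square_bound[OF bd])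
  have V\<kappa>: "V \<le> \<kappa>\<^sup>2"
  proof -
    have "V \<le> (\<integral>\<omega>. \<kappa>\<^sup>2 \<partial>M)"
      unfolding V_def using integrable_lin_square by (intro integral_mono sq) auto
    then show ?thesis by (simp add: prob_space)
  qed
  let ?f = "\<lambda>\<omega>. 1 + \<i> * lin a S \<omega> - complex_of_real ((lin a S \<omega>)\<^sup>2) / 2"
  have i1: "integrable M (\<lambda>\<omega>. iexp (lin a S \<omega>))"
    by (rule integrable_bounded[where B = 1]) auto
  have i2: "integrable M (\<lambda>\<omega>. complex_of_real (lin a S \<omega>))" "integrable M (\<lambda>\<omega>. complex_of_real ((lin a S \<omega>)\<^sup>2))"
    using integrable_lin integrable_lin_square by (auto simp del: of_real_power)
  have "(\<integral>\<omega>. ?f \<omega> \<partial>M) = complex_of_real (1 - V / 2)"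
    using i2 by (simp add: integral_lin prob_space V_def del: of_real_power)
  then have "cmod ((\<integral>\<omega>. iexp (lin a S \<omega>) \<partial>M) - complex_of_real (1 - V / 2)) = cmod (\<integral>\<omega>. iexp (lin a S \<omega>) - ?f \<omega> \<partial>M)"
    using i1 i2 by simp
  also have "\<dots> \<le> (\<integral>\<omega>. \<kappa> * (lin a S \<omega>)\<^sup>2 \<partial>M)"
  proof (rule norm_integral_le_integral)
    fix \<omega>
    let ?x = "lin a S \<omega>"
    have "(\<Sum>k\<le>2. (\<i> * ?x) ^ k / fact k) = ?f \<omega>"
      by (simp add: numeral_2_eq_2 power_mult_distrib)
    then have "cmod (iexp ?x - ?f \<omega>) \<le> \<bar>?x\<bar> ^ 3 / 6"
      using iexp_approx1[of ?x 2] by (simp add: fact_numeral eval_nat_numeral)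
    also have "\<bar>?x\<bar> ^ 3 = \<bar>?x\<bar> * ?x\<^sup>2"
      by (simp add: power3_eq_cube power2_eq_square flip: abs_mult)
    then have "\<bar>?x\<bar> ^ 3 / 6 \<le> \<bar>?x\<bar> * ?x\<^sup>2" by simp
    also have "\<dots> \<le> \<kappa> * ?x\<^sup>2"
      by (intro mult_right_mono bd) simp
    finally show "cmod (iexp ?x - ?f \<omega>) \<le> \<kappa> * ?x\<^sup>2" .
  qed (use i1 i2 integrable_lin_square in auto)
  also have "\<dots> = \<kappa> * V" by (simp add: V_def)
  finally have 1: "cmod ((\<integral>\<omega>. iexp (lin a S \<omega>) \<partial>M) - complex_of_real (1 - V / 2)) \<le> \<kappa> * V" .
  have "cmod (complex_of_real (exp (- (V / 2))) - complex_of_real (1 - V / 2)) = \<bar>exp (- (V / 2)) - (1 - V / 2)\<bar>"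
    by (simp only: flip: of_real_diff) (simp only: norm_of_real)
  also have "\<dots> \<le> (V / 2)\<^sup>2 / 2"
    using V0 by (intro exp_minus_quadratic_bound) simp
  also have "\<dots> \<le> V * V"
    by (simp add: power2_eq_square)
  also have "\<dots> \<le> \<kappa>\<^sup>2 * V"
    using V\<kappa> V0 by (rule mult_right_mono)
  finally have 2: "cmod (complex_of_real (1 - V / 2) - complex_of_real (exp (- (V / 2)))) \<le> \<kappa>\<^sup>2 * V"
    by (simp only: norm_minus_commute)
  show ?thesis
    using norm_diff_triangle_le[OF 1 2] by (simp only: distrib_right)
qed

end

section \<open>Trigonometric weights at Fourier frequencies\<close>

lemma cis_fourier_eq_1_iff:
  assumes "n > 0"
  shows "cis (2 * pi * real_of_int p / real n) = 1 \<longleftrightarrow> int n dvd p"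
proof
  assume "cis (2 * pi * real_of_int p / real n) = 1"
  then have "cos (2 * pi * real_of_int p / real n) = 1"
    by (simp add: complex_eq_iff)
  then obtain x :: int where "2 * pi * real_of_int p / real n = real_of_int x * 2 * pi"
    unfolding cos_one_2pi_int by auto
  then have "real_of_int p = real_of_int (x * int n)"
    using assms by (simp add: field_simps)
  then show "int n dvd p" by (simp only: of_int_eq_iff) simp
next
  assume "int n dvd p"
  then obtain x where "p = int n * x" by auto
  then have "2 * pi * real_of_int p / real n = 2 * pi * real_of_int x"
    using assms by simp
  then show "cis (2 * pi * real_of_int p / real n) = 1"
    by (simp add: cis_multiple_2pi)
qed

text \<open>A geometric sum whose ratio is an \<open>n\<close>-th root of unity; the ratio is 1
  exactly when \<open>n\<close> divides \<open>p\<close>.\<close>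

lemma sum_cis_fourier:
  assumes "n > 0"
  shows "(\<Sum>t=1..n. cis (real t * (2 * pi * real_of_int p / real n))) = (if int n dvd p then of_nat n else 0)"
proof -
  let ?z = "cis (2 * pi * real_of_int p / real n)"
  have *: "(\<Sum>t=1..n. cis (real t * (2 * pi * real_of_int p / real n))) = ?z * (\<Sum>t<n. ?z ^ t)"
  proof -
    have "(\<Sum>t=1..n. cis (real t * (2 * pi * real_of_int p / real n))) = (\<Sum>t=1..n. ?z ^ t)"
      by (intro sum.cong refl) (simp only: Complex.DeMoivre)
    also have "\<dots> = (\<Sum>t<n. ?z ^ Suc t)"
      by (simp add: sum.atLeast1_atMost_eq lessThan_atLeast0)
    finally show ?thesis by (simp add: sum_distrib_left)
  qed
  have "?z ^ n = cis (2 * pi * real_of_int p)"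
    using assms by (simp only: Complex.DeMoivre) simp
  then have zn: "?z ^ n = 1" by (simp add: cis_multiple_2pi)
  show ?thesis
  proof (cases "int n dvd p")
    case True
    then have "?z = 1" using cis_fourier_eq_1_iff[OF assms] by blast
    with True show ?thesis unfolding * by simp
  next
    case False
    then have "?z \<noteq> 1" using cis_fourier_eq_1_iff[OF assms] by blast
    with False show ?thesis unfolding * by (simp add: sum_gp_strict zn)
  qed
qed

text \<open>The coefficient \<open>z j = Complex a (- b)\<close> encodes the real weight
  \<open>a * cos + b * sin\<close> at the Fourier frequency with index \<open>p + j\<close>, so one
  complex number per frequency represents every real combination of cosine and sine weights.\<close>

definition trigw :: "int set \<Rightarrow> (int \<Rightarrow> complex) \<Rightarrow> int \<Rightarrow> nat \<Rightarrow> int \<Rightarrow> real" where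
  "trigw I z p n t = (\<Sum>j\<in>I. Re (z j * cis (real_of_int t * (2 * pi * real_of_int (p + j) / real n))))"

lemma trigw_bound: "\<bar>trigw I z p n t\<bar> \<le> (\<Sum>j\<in>I. cmod (z j))"
  unfolding trigw_def
  by (intro order_trans[OF sum_abs] sum_mono order_trans[OF abs_Re_le_cmod]) (simp add: norm_mult)

text \<open>This zero sum later cancels the deterministic drift of the distribution function between
  the true quantile and a grid point near its estimate.\<close>

lemma sum_trigw:
  assumes "n > 0" and "\<And>j. j \<in> I \<Longrightarrow> \<not> int n dvd p + j"
  shows "(\<Sum>t=1..n. trigw I z p n (int t)) = 0"
proof -
  have "(\<Sum>t=1..n. trigw I z p n (int t)) =
     (\<Sum>j\<in>I. Re (z j * (\<Sum>t=1..n. cis (real t * (2 * pi * real_of_int (p + j) / real n)))))"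
    unfolding trigw_def by (subst sum.swap) (simp add: sum_distrib_left)
  also have "\<dots> = 0"
    by (intro sum.neutral ballI) (simp only: sum_cis_fourier[OF \<open>n > 0\<close>] assms if_False, simp)
  finally show ?thesis .
qed

lemma Re_complex_of_real_mult: "Re (complex_of_real x * y) = x * Re y"
  by simp

text \<open>A product of real parts splits into a term at the sum of the two frequencies and one at
  their difference. Over \<open>1..n\<close> all of them sum to zero except the difference of a
  frequency with itself. The identity is exact because the shifted weight is not cut off at the end
  of the sample.\<close>

lemma sum_trigw_shift:
  assumes "n > 0" "finite I" and sum: "\<And>j l. j \<in> I \<Longrightarrow> l \<in> I \<Longrightarrow> \<not> int n dvd (p + j) + (p + l)"
    and diff: "\<And>j l. j \<in> I \<Longrightarrow> l \<in> I \<Longrightarrow> j \<noteq> l \<Longrightarrow> \<not> int n dvd j - l"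
  shows "(\<Sum>t=1..n. trigw I z p n (int t) * trigw I z p n (int t + h)) =
     real n / 2 * (\<Sum>j\<in>I. (cmod (z j))\<^sup>2 * cos (real_of_int h * (2 * pi * real_of_int (p + j) / real n)))"
proof -
  let ?w = "\<lambda>j. 2 * pi * real_of_int (p + j) / real n"
  have ReRe: "Re a * Re b = (Re (a * b) + Re (a * cnj b)) / 2" for a b
    by (simp add: algebra_simps)
  have A: "(\<Sum>t=1..n. Re (z j * cis (real t * ?w j)) * Re (z l * cis (real_of_int (int t + h) * ?w l))) =
     (if j = l then real n / 2 * ((cmod (z j))\<^sup>2 * cos (real_of_int h * ?w j)) else 0)"
    if "j \<in> I" "l \<in> I" for j l
  proof -
    have 1: "z j * cis (real t * ?w j) * (z l * cis (real_of_int (int t + h) * ?w l)) =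
        z j * z l * cis (real_of_int h * ?w l) * cis (real t * (2 * pi * real_of_int ((p + j) + (p + l)) / real n))" for t
      by (simp add: cis_mult mult_ac add_divide_distrib distrib_left distrib_right)
         (simp add: cis_mult[symmetric] mult_ac)
    have 2: "z j * cis (real t * ?w j) * cnj (z l * cis (real_of_int (int t + h) * ?w l)) =
        z j * cnj (z l) * cis (- (real_of_int h * ?w l)) * cis (real t * (2 * pi * real_of_int (j - l) / real n))" for t
    proof -
      have "real t * ?w j + - (real_of_int (int t + h) * ?w l) =
        - (real_of_int h * ?w l) + real t * (2 * pi * real_of_int (j - l) / real n)"
        by (simp add: field_simps add_divide_distrib diff_divide_distrib)
      then have "cis (real t * ?w j) * cis (- (real_of_int (int t + h) * ?w l)) =
        cis (- (real_of_int h * ?w l)) * cis (real t * (2 * pi * real_of_int (j - l) / real n))"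
        by (simp only: cis_mult)
      then show ?thesis by (simp add: cis_cnj[symmetric] mult_ac del: cis_cnj) 
    qed
    have "(\<Sum>t=1..n. Re (z j * cis (real t * ?w j)) * Re (z l * cis (real_of_int (int t + h) * ?w l))) =
      (Re (z j * z l * cis (real_of_int h * ?w l) * (\<Sum>t=1..n. cis (real t * (2 * pi * real_of_int ((p + j) + (p + l)) / real n)))) +
       Re (z j * cnj (z l) * cis (- (real_of_int h * ?w l)) * (\<Sum>t=1..n. cis (real t * (2 * pi * real_of_int (j - l) / real n))))) / 2"
      unfolding ReRe 1 2 by (simp only: sum_divide_distrib[symmetric] sum.distrib Re_sum[symmetric] sum_distrib_left)
    also have "\<dots> = Re (z j * cnj (z l) * cis (- (real_of_int h * ?w l)) * (if int n dvd j - l then of_nat n else 0)) / 2"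
      unfolding sum_cis_fourier[OF \<open>n > 0\<close>] using sum[OF that] by simp
    also have "\<dots> = (if j = l then real n / 2 * ((cmod (z j))\<^sup>2 * cos (real_of_int h * ?w j)) else 0)"
    proof (cases "j = l")
      case True
      have "z l * cnj (z l) * cis (- (real_of_int h * ?w l)) * of_nat n =
          complex_of_real ((cmod (z l))\<^sup>2 * real n) * cis (- (real_of_int h * ?w l))"
        by (simp only: complex_norm_square of_real_mult of_real_of_nat_eq mult_ac)
      then have "z j * cnj (z l) * cis (- (real_of_int h * ?w l)) * (if int n dvd j - l then of_nat n else 0) =
          complex_of_real ((cmod (z l))\<^sup>2 * real n) * cis (- (real_of_int h * ?w l))"
        using True by simp
      then show ?thesis using True by (simp only: Re_complex_of_real_mult) simp
    qed (use diff[OF that] in auto)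
    finally show ?thesis .
  qed
  have "(\<Sum>t=1..n. trigw I z p n (int t) * trigw I z p n (int t + h)) =
    (\<Sum>j\<in>I. \<Sum>l\<in>I. \<Sum>t=1..n. Re (z j * cis (real t * ?w j)) * Re (z l * cis (real_of_int (int t + h) * ?w l)))"
    unfolding trigw_def sum_product
    by (subst sum.swap, intro sum.cong refl, subst sum.swap) simp
  also have "\<dots> = (\<Sum>j\<in>I. \<Sum>l\<in>I. (if j = l then real n / 2 * ((cmod (z j))\<^sup>2 * cos (real_of_int h * ?w j)) else 0))"
    by (intro sum.cong refl A)
  also have "\<dots> = (\<Sum>j\<in>I. real n / 2 * ((cmod (z j))\<^sup>2 * cos (real_of_int h * ?w j)))"
    using \<open>finite I\<close> by (simp add: sum.delta')
  finally show ?thesis by (simp add: sum_distrib_left)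
qed

section \<open>A central limit theorem by blocking\<close>

lemma sum_card_big_block_le: "(\<Sum>i<Suc n. card (big_block m q n i)) \<le> n"
proof -
  have "(\<Sum>i<Suc n. card (big_block m q n i)) = card (\<Union>i<Suc n. big_block m q n i)"
    by (intro card_UN_disjoint[symmetric]) (auto simp: big_block_disjoint)
  also have "\<dots> \<le> card {1..int n}"
    unfolding UN_big_block by (intro card_mono) auto
  finally show ?thesis by simp
qed

lemma real_sum_card_big_block_le: "real (\<Sum>i<Suc n. card (big_block m q n i)) \<le> real n"
  by (simp only: of_nat_le_iff sum_card_big_block_le)

context mixing_functional
begin

lemma sum_lin_big_block:
  "lin a ({1..int n} - block_gaps m q n) \<omega> = (\<Sum>i<Suc n. lin a (big_block m q n i) \<omega>)"
  unfolding lin_def UN_big_block[symmetric]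
  by (intro sum.UNION_disjoint) (auto simp: big_block_disjoint)

text \<open>Points of distinct blocks are at least \<open>q\<close> apart, so each cross covariance
  carries the factor \<open>\<sigma> ^ q\<close>. Counting up to \<open>n^2\<close> pairs is crude
  but harmless against this factor.\<close>

lemma blocks_nearly_orthogonal:
  assumes a: "\<And>t. \<bar>a t\<bar> \<le> A"
  shows "\<bar>(\<integral>\<omega>. (lin a ({1..int n} - block_gaps m q n) \<omega>)\<^sup>2 \<partial>M) - (\<Sum>i<Suc n. \<integral>\<omega>. (lin a (big_block m q n i) \<omega>)\<^sup>2 \<partial>M)\<bar>
    \<le> (real n * A)\<^sup>2 * (D * \<sigma> ^ q)"
proof -
  let ?B = "big_block m q n" and ?J = "{..<Suc n}"
  let ?E = "\<lambda>i j. \<integral>\<omega>. lin a (?B i) \<omega> * lin a (?B j) \<omega> \<partial>M"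
  have A: "0 \<le> A" using a[of 0] by linarith
  have off: "\<bar>?E i j\<bar> \<le> real (card (?B i)) * real (card (?B j)) * (A\<^sup>2 * (D * \<sigma> ^ q))" if "i \<noteq> j" for i j
  proof -
    have "\<bar>?E i j\<bar> \<le> (\<Sum>s\<in>?B i. \<Sum>t\<in>?B j. A\<^sup>2 * (D * \<sigma> ^ q))"
      unfolding integral_lin_mult
    proof (intro order_trans[OF sum_abs] sum_mono)
      fix s t assume st: "s \<in> ?B i" "t \<in> ?B j"
      have "int q \<le> \<bar>s - t\<bar>"
        using big_block_dist[OF st] big_block_dist[OF st(2,1)] \<open>i \<noteq> j\<close> by linarith
      then have "\<sigma> ^ nat \<bar>s - t\<bar> \<le> \<sigma> ^ q"
        using \<sigma> by (intro power_decreasing) auto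
      then have "\<bar>\<integral>\<omega>. h (X s \<omega>) * h (X t \<omega>) \<partial>M\<bar> \<le> D * \<sigma> ^ q"
        using D_nonneg by (intro order_trans[OF cov_le] mult_left_mono)
      then show "\<bar>a s * a t * (\<integral>\<omega>. h (X s \<omega>) * h (X t \<omega>) \<partial>M)\<bar> \<le> A\<^sup>2 * (D * \<sigma> ^ q)"
        unfolding abs_mult power2_eq_square using A by (intro mult_mono a) auto
    qed
    then show ?thesis by (simp add: mult_ac)
  qed
  have "(\<integral>\<omega>. (lin a ({1..int n} - block_gaps m q n) \<omega>)\<^sup>2 \<partial>M) = (\<Sum>i\<in>?J. \<Sum>j\<in>?J. ?E i j)"
    unfolding sum_lin_big_block power2_eq_square sum_product
    by (subst Bochner_Integration.integral_sum, intro Bochner_Integration.integrable_sum integrable_lin_mult)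
       (intro sum.cong refl Bochner_Integration.integral_sum integrable_lin_mult)
  also have "\<dots> = (\<Sum>i\<in>?J. ?E i i + (\<Sum>j\<in>?J - {i}. ?E i j))"
    by (intro sum.cong refl sum.remove) auto
  finally have "\<bar>(\<integral>\<omega>. (lin a ({1..int n} - block_gaps m q n) \<omega>)\<^sup>2 \<partial>M) - (\<Sum>i\<in>?J. \<integral>\<omega>. (lin a (?B i) \<omega>)\<^sup>2 \<partial>M)\<bar>
    = \<bar>\<Sum>i\<in>?J. \<Sum>j\<in>?J - {i}. ?E i j\<bar>"
    by (simp add: sum.distrib power2_eq_square)
  also have "\<dots> \<le> (\<Sum>i\<in>?J. \<Sum>j\<in>?J - {i}. real (card (?B i)) * real (card (?B j)) * (A\<^sup>2 * (D * \<sigma> ^ q)))"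
    by (intro order_trans[OF sum_abs] sum_mono off) auto
  also have "\<dots> \<le> (\<Sum>i\<in>?J. \<Sum>j\<in>?J. real (card (?B i)) * real (card (?B j)) * (A\<^sup>2 * (D * \<sigma> ^ q)))"
    using D_nonneg \<sigma> by (intro sum_mono sum_mono2) auto
  also have "\<dots> = (real (\<Sum>i\<in>?J. card (?B i)))\<^sup>2 * (A\<^sup>2 * (D * \<sigma> ^ q))"
    unfolding of_nat_sum power2_eq_square[of "sum _ _"] sum_product by (simp only: sum_distrib_right)
  also have "\<dots> \<le> (real n)\<^sup>2 * (A\<^sup>2 * (D * \<sigma> ^ q))"
    using D_nonneg \<sigma> by (intro mult_right_mono power_mono real_sum_card_big_block_le)
      (auto simp del: sum.lessThan_Suc of_nat_sum)
  also have "\<dots> = (real n * A)\<^sup>2 * (D * \<sigma> ^ q)"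
    by (simp add: power_mult_distrib)
  finally show ?thesis .
qed

text \<open>Once the gaps are dropped and the blocks factorize, the product of the Gaussian factors
  is the exponential of minus half the sum of the block variances. Hence only the total variance has
  to converge, not its distribution over the blocks.\<close>

lemma block_clt:
  fixes c :: "nat \<Rightarrow> int \<Rightarrow> real"
  assumes K: "\<And>n t. \<bar>c n t\<bar> \<le> K"
  defines "a \<equiv> \<lambda>n t. c n t / sqrt (real n)"
  assumes v: "(\<lambda>n. \<integral>\<omega>. (lin (a n) {1..int n} \<omega>)\<^sup>2 \<partial>M) \<longlonglongrightarrow> v"
  shows "(\<lambda>n. \<integral>\<omega>. iexp (lin (a n) {1..int n} \<omega>) \<partial>M) \<longlonglongrightarrow> complex_of_real (exp (- (v / 2)))"
proof -
  \<comment> \<open>The gap length \<open>q\<close> must satisfy \<open>n \<sigma>^q \<rightarrow> 0\<close>, while blocks of length \<open>q^2\<close> must be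
    short compared with \<open>sqrt n\<close>; the gaps then carry only a fraction \<open>1 / q\<close> of the indices.\<close>
  define q where "q n = nat \<lfloor>real n powr (1 / 8)\<rfloor>" for n :: nat
  define m where "m n = (q n)\<^sup>2" for n
  have q_le: "real (q n) \<le> real n powr (1 / 8)" and q_ge: "real n powr (1 / 8) - 1 \<le> real (q n)" for n
    unfolding q_def using powr_ge_zero[of "real n" "1 / 8"] by linarith+
  have q_pos: "q n \<ge> 1" if "n \<ge> 1" for n
  proof -
    have "1 \<le> real n powr (1 / 8)" using that by (simp add: ge_one_powr_ge_zero)
    then show ?thesis unfolding q_def by linarith
  qed
  define A where "A n = K / sqrt (real n)" for n
  have K0: "0 \<le> K" using K[of 0 0] by linarith
  have A0: "0 \<le> A n" for n unfolding A_def using K0 by simp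
  have aA: "\<bar>a n t\<bar> \<le> A n" for n t
    unfolding a_def A_def using K by (simp add: divide_right_mono)
  have A2: "(A n)\<^sup>2 * real n = K\<^sup>2" if "n \<ge> 1" for n
    using that by (simp add: A_def power_divide)
  define D' where "D' = 2 * D / (1 - \<sigma>)"
  have D': "0 \<le> D'" unfolding D'_def using D_nonneg \<sigma> by simp
  let ?big = "\<lambda>n. {1..int n} - block_gaps (m n) (q n) n" and ?gap = "\<lambda>n. block_gaps (m n) (q n) n"
  let ?B = "\<lambda>n. big_block (m n) (q n) n"
  let ?V = "\<lambda>n S. \<integral>\<omega>. (lin (a n) S \<omega>)\<^sup>2 \<partial>M" and ?c = "\<lambda>n S. \<integral>\<omega>. iexp (lin (a n) S \<omega>) \<partial>M"
  have Vle: "?V n S \<le> (A n)\<^sup>2 * real (card S) * D'" if "finite S" for n S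
    unfolding D'_def by (rule integral_lin_square_le) (use that aA in auto)
  have gapn: "?gap n \<subseteq> {1..int n}" for n unfolding block_gaps_def by auto
  have split: "lin (a n) {1..int n} \<omega> = lin (a n) (?big n) \<omega> + lin (a n) (?gap n) \<omega>" for n \<omega>
  proof -
    have "{1..int n} = ?big n \<union> ?gap n" using gapn by auto
    then show ?thesis by (subst lin_union[symmetric]) auto
  qed
  have n1: "eventually (\<lambda>n::nat. n \<ge> 1) sequentially"
    by (rule eventually_ge_at_top)
  have gap0: "(\<lambda>n. ?V n (?gap n)) \<longlonglongrightarrow> 0"
  proof (rule tendsto_sandwich[of "\<lambda>_. 0"])
    show "eventually (\<lambda>n. ?V n (?gap n) \<le> K\<^sup>2 * D' * (1 / (real n powr (1 / 8) - 1) + real n powr (1 / 8) / real n)) sequentially"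
      using eventually_ge_at_top[of "2 ^ 9 :: nat"]
    proof eventually_elim
      case (elim n)
      have n: "n \<ge> 1" using elim by simp
      have q1: "1 \<le> real (q n)" using q_pos[OF n] by simp
      \<comment> \<open>Keeps the denominator \<open>n^(1/8) - 1\<close> positive; the threshold on
        \<open>n\<close> is taken above 1 for its sake.\<close>
      have q2: "1 < real n powr (1 / 8)"
        using elim by (intro gr_one_powr) auto
      have mpos: "m n > 0" using q_pos[OF n] by (simp add: m_def)
      have "real (card (?gap n)) \<le> real ((n div m n + 1) * q n)"
        using card_block_gaps[OF mpos] by (simp only: of_nat_le_iff)
      also have "\<dots> \<le> (real n / real (m n) + 1) * real (q n)"
        unfolding of_nat_mult of_nat_add of_nat_1
        by (intro mult_right_mono add_right_mono of_nat_div_le_of_nat) simp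
      also have "\<dots> = real n * (1 / real (q n) + real (q n) / real n)"
        using n q1 by (simp add: m_def power2_eq_square field_simps)
      also have "\<dots> \<le> real n * (1 / (real n powr (1 / 8) - 1) + real n powr (1 / 8) / real n)"
        using q1 q2 q_le[of n] q_ge[of n] by (intro mult_left_mono add_mono divide_left_mono divide_right_mono) auto
      finally have g: "real (card (?gap n)) \<le> real n * (1 / (real n powr (1 / 8) - 1) + real n powr (1 / 8) / real n)" .
      have "?V n (?gap n) \<le> (A n)\<^sup>2 * real (card (?gap n)) * D'"
        by (rule Vle) simp
      also have "\<dots> \<le> (A n)\<^sup>2 * (real n * (1 / (real n powr (1 / 8) - 1) + real n powr (1 / 8) / real n)) * D'"
        using g D' by (intro mult_right_mono mult_left_mono) auto
      also have "\<dots> = K\<^sup>2 * D' * (1 / (real n powr (1 / 8) - 1) + real n powr (1 / 8) / real n)"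
        unfolding A2[OF n, symmetric] by (simp add: mult_ac)
      finally show ?case .
    qed
    show "(\<lambda>n. K\<^sup>2 * D' * (1 / (real n powr (1 / 8) - 1) + real n powr (1 / 8) / real n)) \<longlonglongrightarrow> 0"
    proof -
      have "(\<lambda>n::nat. (1 / (real n powr (1 / 8) - 1) + real n powr (1 / 8) / real n)) \<longlonglongrightarrow> 0"
        by real_asymp
      from tendsto_mult_right_zero[OF this] show ?thesis by simp
    qed
  qed (auto intro!: always_eventually)
  \<comment> \<open>Uniform bound for a block sum, block length times largest weight, of order at
    most \<open>n^(-1/4)\<close>.\<close>
  define \<kappa> where "\<kappa> n = real (m n) * A n" for n
  have \<kappa>_lim: "\<kappa> \<longlonglongrightarrow> 0"
  proof (rule tendsto_sandwich[of "\<lambda>_. 0"])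
    show "eventually (\<lambda>n. \<kappa> n \<le> K * (real n powr (1 / 8) * real n powr (1 / 8) / sqrt (real n))) sequentially"
    proof (rule always_eventually, rule allI)
      fix n
      have "real (m n) \<le> real n powr (1 / 8) * real n powr (1 / 8)"
        unfolding m_def power2_eq_square of_nat_mult using q_le by (intro mult_mono) auto
      then have "real (m n) * (K / sqrt (real n)) \<le> (real n powr (1 / 8) * real n powr (1 / 8)) * (K / sqrt (real n))"
        using K0 by (intro mult_right_mono) auto
      then show "\<kappa> n \<le> K * (real n powr (1 / 8) * real n powr (1 / 8) / sqrt (real n))"
        by (simp add: \<kappa>_def A_def mult_ac)
    qed
    have "(\<lambda>n::nat. (real n powr (1 / 8) * real n powr (1 / 8) / sqrt (real n))) \<longlonglongrightarrow> 0"
      by real_asymp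
    from tendsto_mult_right_zero[OF this]
    show "(\<lambda>n. K * (real n powr (1 / 8) * real n powr (1 / 8) / sqrt (real n))) \<longlonglongrightarrow> 0" .
  qed (auto simp: \<kappa>_def A0 intro!: always_eventually)
  have \<sigma>_lim: "(\<lambda>n. real n * \<sigma> ^ q n) \<longlonglongrightarrow> 0"
  proof (rule tendsto_sandwich[of "\<lambda>_. 0"])
    define b where "b = - ln \<sigma>"
    have b: "b > 0" "\<sigma> = exp (- b)" unfolding b_def using \<sigma> by auto
    show "eventually (\<lambda>n. real n * \<sigma> ^ q n \<le> real n * exp (- b * (real n powr (1 / 8) - 1))) sequentially"
    proof (rule always_eventually, rule allI, rule mult_left_mono)
      fix n
      have "\<sigma> ^ q n = exp (- b * real (q n))"
        unfolding b(2) by (simp add: exp_of_nat_mult[symmetric] mult.commute)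
      also have "\<dots> \<le> exp (- b * (real n powr (1 / 8) - 1))"
        using b(1) q_ge[of n] by simp
      finally show "\<sigma> ^ q n \<le> exp (- b * (real n powr (1 / 8) - 1))" .
    qed simp
    show "(\<lambda>n. real n * exp (- b * (real n powr (1 / 8) - 1))) \<longlonglongrightarrow> 0"
      using b(1) by real_asymp
  qed (use \<sigma> in \<open>auto intro!: always_eventually\<close>)
  have VB_le: "(\<Sum>i<Suc n. ?V n (?B n i)) \<le> K\<^sup>2 * D'" if "n \<ge> 1" for n
  proof -
    have "(\<Sum>i<Suc n. ?V n (?B n i)) \<le> (\<Sum>i<Suc n. (A n)\<^sup>2 * real (card (?B n i)) * D')"
      by (intro sum_mono Vle) simp
    also have "\<dots> = (A n)\<^sup>2 * real (\<Sum>i<Suc n. card (?B n i)) * D'"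
      unfolding of_nat_sum by (simp only: sum_distrib_left sum_distrib_right)
    also have "\<dots> \<le> (A n)\<^sup>2 * real n * D'"
      using D' by (intro mult_right_mono mult_left_mono real_sum_card_big_block_le) auto
    finally show ?thesis by (simp only: A2[OF that])
  qed
  have big_le: "?V n (?big n) \<le> K\<^sup>2 * D'" if "n \<ge> 1" for n
  proof -
    have "?V n (?big n) \<le> (A n)\<^sup>2 * real (card (?big n)) * D'"
      by (rule Vle) simp
    also have "\<dots> \<le> (A n)\<^sup>2 * real n * D'"
      using D' card_mono[of "{1..int n}" "?big n"] by (intro mult_right_mono mult_left_mono) auto
    finally show ?thesis by (simp only: A2[OF that])
  qed
  \<comment> \<open>The L2 error of omitting the gaps is the root of the variance of the gap
    sum.\<close>
  have step1: "(\<lambda>n. ?c n {1..int n} - ?c n (?big n)) \<longlonglongrightarrow> 0"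
  proof (rule Lim_null_comparison)
    show "eventually (\<lambda>n. cmod (?c n {1..int n} - ?c n (?big n)) \<le> sqrt (?V n (?gap n))) sequentially"
      using char_lin_diff_le[of "a n" "{1..int n}" "a n" "?big n" for n] by (simp add: split)
    show "(\<lambda>n. sqrt (?V n (?gap n))) \<longlonglongrightarrow> 0"
      using tendsto_real_sqrt[OF gap0] by simp
  qed
  have step2: "(\<lambda>n. ?c n (?big n) - (\<Prod>i<Suc n. ?c n (?B n i))) \<longlonglongrightarrow> 0"
  proof (rule Lim_null_comparison)
    show "eventually (\<lambda>n. cmod (?c n (?big n) - (\<Prod>i<Suc n. ?c n (?B n i))) \<le> K * D * (real n * \<sigma> ^ q n)) sequentially"
      using n1
    proof eventually_elim
      case (elim n)
      have mpos: "m n > 0" using q_pos[OF elim] by (simp add: m_def)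
      have "cmod (?c n (?big n) - (\<Prod>i<Suc n. ?c n (?B n i))) \<le> (\<Sum>i<Suc n. \<Sum>t\<in>?B n i. \<bar>a n t\<bar> * (D * \<sigma> ^ q n))"
        using char_blocks_factorize[OF mpos, of "a n" "q n" n "Suc n"] unfolding UN_big_block .
      also have "\<dots> \<le> (\<Sum>i<Suc n. \<Sum>t\<in>?B n i. A n * (D * \<sigma> ^ q n))"
        using D_nonneg \<sigma> by (intro sum_mono mult_right_mono aA) auto
      also have "\<dots> = real (\<Sum>i<Suc n. card (?B n i)) * (A n * (D * \<sigma> ^ q n))"
        unfolding of_nat_sum sum_distrib_right by simp
      also have "\<dots> \<le> real n * (K * (D * \<sigma> ^ q n))"
      proof (intro mult_mono)
        show "A n \<le> K" using elim K0 unfolding A_def by (simp add: divide_le_eq mult_le_cancel_left1)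
        show "real (\<Sum>i<Suc n. card (?B n i)) \<le> real n" by (rule real_sum_card_big_block_le)
      qed (use D_nonneg \<sigma> A0 K0 in auto)
      finally show ?case by (simp add: mult_ac)
    qed
    show "(\<lambda>n. K * D * (real n * \<sigma> ^ q n)) \<longlonglongrightarrow> 0"
      by (rule tendsto_mult_right_zero[OF \<sigma>_lim])
  qed
  \<comment> \<open>All factors have modulus at most one, so the products differ by at most the sum
    of the differences of the factors.\<close>
  have step3: "(\<lambda>n. (\<Prod>i<Suc n. ?c n (?B n i)) - (\<Prod>i<Suc n. complex_of_real (exp (- (?V n (?B n i) / 2))))) \<longlonglongrightarrow> 0"
  proof (rule Lim_null_comparison)
    show "eventually (\<lambda>n. cmod ((\<Prod>i<Suc n. ?c n (?B n i)) - (\<Prod>i<Suc n. complex_of_real (exp (- (?V n (?B n i) / 2)))))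
      \<le> (\<kappa> n + (\<kappa> n)\<^sup>2) * (K\<^sup>2 * D')) sequentially"
      using n1
    proof eventually_elim
      case (elim n)
      have mpos: "m n > 0" using q_pos[OF elim] by (simp add: m_def)
      have "(\<Sum>t\<in>?B n i. \<bar>a n t\<bar>) \<le> \<kappa> n" for i
      proof -
        have "(\<Sum>t\<in>?B n i. \<bar>a n t\<bar>) \<le> real (card (?B n i)) * A n"
          using sum_bounded_above[of "?B n i" "\<lambda>t. \<bar>a n t\<bar>" "A n"] aA by simp
        also have "\<dots> \<le> \<kappa> n"
          unfolding \<kappa>_def using card_big_block[OF mpos] A0 by (intro mult_right_mono) auto
        finally show ?thesis .
      qed
      note small = char_lin_small[OF this]
      have "cmod ((\<Prod>i<Suc n. ?c n (?B n i)) - (\<Prod>i<Suc n. complex_of_real (exp (- (?V n (?B n i) / 2)))))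
        \<le> (\<Sum>i<Suc n. cmod (?c n (?B n i) - complex_of_real (exp (- (?V n (?B n i) / 2)))))"
        by (intro norm_prod_diff char_lin_bound) simp
      also have "\<dots> \<le> (\<Sum>i<Suc n. (\<kappa> n + (\<kappa> n)\<^sup>2) * ?V n (?B n i))"
        by (intro sum_mono small)
      also have "\<dots> = (\<kappa> n + (\<kappa> n)\<^sup>2) * (\<Sum>i<Suc n. ?V n (?B n i))"
        by (simp only: sum_distrib_left)
      also have "\<dots> \<le> (\<kappa> n + (\<kappa> n)\<^sup>2) * (K\<^sup>2 * D')"
        using A0 by (intro mult_left_mono VB_le elim) (auto simp: \<kappa>_def)
      finally show ?case .
    qed
    have "(\<lambda>n. (\<kappa> n + (\<kappa> n)\<^sup>2) * (K\<^sup>2 * D')) \<longlonglongrightarrow> (0 + 0\<^sup>2) * (K\<^sup>2 * D')"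
      by (intro tendsto_intros \<kappa>_lim)
    then show "(\<lambda>n. (\<kappa> n + (\<kappa> n)\<^sup>2) * (K\<^sup>2 * D')) \<longlonglongrightarrow> 0" by simp
  qed
  \<comment> \<open>The cross term is handled by Cauchy-Schwarz: the big blocks have bounded
    variance and the gaps a vanishing one.\<close>
  have d1: "(\<lambda>n. ?V n {1..int n} - ?V n (?big n)) \<longlonglongrightarrow> 0"
  proof (rule Lim_null_comparison)
    show "eventually (\<lambda>n. norm (?V n {1..int n} - ?V n (?big n)) \<le> 2 * (sqrt (K\<^sup>2 * D') * sqrt (?V n (?gap n))) + ?V n (?gap n)) sequentially"
      using n1
    proof eventually_elim
      case (elim n)
      have "?V n {1..int n} = (\<integral>\<omega>. (lin (a n) (?big n) \<omega>)\<^sup>2 + (2 * (lin (a n) (?big n) \<omega> * lin (a n) (?gap n) \<omega>) + (lin (a n) (?gap n) \<omega>)\<^sup>2) \<partial>M)"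
        unfolding split power2_sum by (simp add: mult_ac add_ac)
      also have "\<dots> = ?V n (?big n) + (2 * (\<integral>\<omega>. lin (a n) (?big n) \<omega> * lin (a n) (?gap n) \<omega> \<partial>M) + ?V n (?gap n))"
        using integrable_lin_square integrable_lin_mult by simp
      finally have "?V n {1..int n} = ?V n (?big n) + (2 * (\<integral>\<omega>. lin (a n) (?big n) \<omega> * lin (a n) (?gap n) \<omega> \<partial>M) + ?V n (?gap n))" .
      moreover have "0 \<le> ?V n (?gap n)" by simp
      ultimately have "norm (?V n {1..int n} - ?V n (?big n)) \<le> 2 * \<bar>\<integral>\<omega>. lin (a n) (?big n) \<omega> * lin (a n) (?gap n) \<omega> \<partial>M\<bar> + ?V n (?gap n)"
        unfolding real_norm_def by linarith
      moreover have "\<bar>\<integral>\<omega>. lin (a n) (?big n) \<omega> * lin (a n) (?gap n) \<omega> \<partial>M\<bar> \<le> sqrt (?V n (?big n)) * sqrt (?V n (?gap n))"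
        by (intro Cauchy_Schwarz_integral integrable_lin_square) auto
      moreover have "\<dots> \<le> sqrt (K\<^sup>2 * D') * sqrt (?V n (?gap n))"
        by (intro mult_right_mono real_sqrt_le_mono big_le elim) simp
      ultimately show ?case by linarith
    qed
    have "(\<lambda>n. 2 * (sqrt (K\<^sup>2 * D') * sqrt (?V n (?gap n))) + ?V n (?gap n)) \<longlonglongrightarrow> 2 * (sqrt (K\<^sup>2 * D') * sqrt 0) + 0"
      by (intro tendsto_intros gap0)
    then show "(\<lambda>n. 2 * (sqrt (K\<^sup>2 * D') * sqrt (?V n (?gap n))) + ?V n (?gap n)) \<longlonglongrightarrow> 0" by simp
  qed
  have d2: "(\<lambda>n. ?V n (?big n) - (\<Sum>i<Suc n. ?V n (?B n i))) \<longlonglongrightarrow> 0"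
  proof (rule Lim_null_comparison)
    show "eventually (\<lambda>n. norm (?V n (?big n) - (\<Sum>i<Suc n. ?V n (?B n i))) \<le> K\<^sup>2 * D * (real n * \<sigma> ^ q n)) sequentially"
      using n1
    proof eventually_elim
      case (elim n)
      have "norm (?V n (?big n) - (\<Sum>i<Suc n. ?V n (?B n i))) \<le> (real n * A n)\<^sup>2 * (D * \<sigma> ^ q n)"
        using blocks_nearly_orthogonal[of "a n" "A n" n "m n" "q n"] aA by simp
      also have "(real n * A n)\<^sup>2 = K\<^sup>2 * real n"
        unfolding A2[OF elim, symmetric] by (simp add: power2_eq_square)
      finally show ?case by (simp add: mult_ac)
    qed
    show "(\<lambda>n. K\<^sup>2 * D * (real n * \<sigma> ^ q n)) \<longlonglongrightarrow> 0"
      by (rule tendsto_mult_right_zero[OF \<sigma>_lim])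
  qed
  have "(\<lambda>n. \<Sum>i<Suc n. ?V n (?B n i)) \<longlonglongrightarrow> v"
    using tendsto_diff[OF tendsto_diff[OF v d1] d2] by simp
  then have "(\<lambda>n. complex_of_real (exp (- ((\<Sum>i<Suc n. ?V n (?B n i)) / 2)))) \<longlonglongrightarrow> complex_of_real (exp (- (v / 2)))"
    by (intro tendsto_of_real tendsto_exp tendsto_minus tendsto_divide tendsto_const) simp_all
  moreover have "complex_of_real (exp (- ((\<Sum>i<Suc n. ?V n (?B n i)) / 2))) = (\<Prod>i<Suc n. complex_of_real (exp (- (?V n (?B n i) / 2))))" for n
    unfolding of_real_prod[symmetric] exp_sum[OF finite_lessThan, symmetric] by (simp only: sum_negf sum_divide_distrib)
  ultimately have "(\<lambda>n. \<Prod>i<Suc n. complex_of_real (exp (- (?V n (?B n i) / 2)))) \<longlonglongrightarrow> complex_of_real (exp (- (v / 2)))"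
    by (simp only:)
  from tendsto_add[OF tendsto_add[OF tendsto_add[OF step1 step2] step3] this]
  show ?thesis by simp
qed

end

section \<open>Limiting variance\<close>

lemma sum_int_interval: "(\<Sum>t\<in>{1..int n}. f t) = (\<Sum>t=1..n. f (int t))"
  by (rule sum.reindex_bij_witness[of _ int nat]) auto

text \<open>\<open>jn n / n\<close> tends to \<open>lam / (2 * pi)\<close>, strictly between 0 and
  1/2. Up to bounded shifts, a single index and a sum of two indices therefore eventually lie
  strictly between 0 and \<open>n\<close>, where there is no multiple of \<open>n\<close>.\<close>

lemma not_dvd_fourier_frequency:
  assumes lim: "(\<lambda>n. 2 * pi * real_of_int (jn n) / real n) \<longlonglongrightarrow> lam" and lam: "0 < lam" "lam < pi"
  shows "eventually (\<lambda>n. \<not> int n dvd jn n + j) sequentially"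
    and "eventually (\<lambda>n. \<not> int n dvd (jn n + j) + (jn n + l)) sequentially"
proof -
  have n1: "eventually (\<lambda>n::nat. n \<ge> 1) sequentially" by (rule eventually_ge_at_top)
  \<comment> \<open>Used with \<open>k = 1\<close> for single indices and \<open>k = 2\<close> for
    sums.\<close>
  have *: "eventually (\<lambda>n. \<not> int n dvd k * jn n + i) sequentially"
    if k: "0 < real_of_int k * lam / (2 * pi)" "real_of_int k * lam / (2 * pi) < 1" for k i :: int
  proof -
    have "(\<lambda>n. real_of_int i / real n) \<longlonglongrightarrow> 0"
      by real_asymp
    with lim have "(\<lambda>n. real_of_int k * (2 * pi * real_of_int (jn n) / real n) / (2 * pi) + real_of_int i / real n) \<longlonglongrightarrow> real_of_int k * lam / (2 * pi) + 0"
      by (intro tendsto_intros) auto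
    then have l: "(\<lambda>n. real_of_int (k * jn n + i) / real n) \<longlonglongrightarrow> real_of_int k * lam / (2 * pi)"
      by (simp add: field_simps add_divide_distrib)
    show ?thesis
      using order_tendstoD(1)[OF l k(1)] order_tendstoD(2)[OF l k(2)] n1
    proof eventually_elim
      case (elim n)
      then have "0 < real_of_int (k * jn n + i)" "real_of_int (k * jn n + i) < real_of_int (int n)"
        by (simp_all only: zero_less_divide_iff divide_less_eq) auto
      then have "0 < k * jn n + i" "k * jn n + i < int n"
        by (simp_all only: of_int_0_less_iff of_int_less_iff)
      then show ?case by (rule zdvd_not_zless)
    qed
  qed
  show "eventually (\<lambda>n. \<not> int n dvd jn n + j) sequentially"
    using *[of 1 j] lam by simp
  show "eventually (\<lambda>n. \<not> int n dvd (jn n + j) + (jn n + l)) sequentially"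
    using *[of 2 "j + l"] lam by (simp add: algebra_simps)
qed

lemma not_dvd_difference:
  fixes d :: int assumes "d \<noteq> 0" shows "eventually (\<lambda>n. \<not> int n dvd d) sequentially"
  using eventually_gt_at_top[of "nat \<bar>d\<bar>"]
proof eventually_elim
  case (elim n)
  then show ?case using assms dvd_imp_le_int[of d "int n"] by auto
qed

lemma fourier_frequencies_nondegenerate:
  assumes "finite I" and lim: "(\<lambda>n. 2 * pi * real_of_int (jn n) / real n) \<longlonglongrightarrow> lam" and lam: "0 < lam" "lam < pi"
  shows "eventually (\<lambda>n. n \<ge> 1 \<and> (\<forall>j\<in>I. \<not> int n dvd jn n + j) \<and> (\<forall>j\<in>I. \<forall>l\<in>I. \<not> int n dvd (jn n + j) + (jn n + l)) \<and>
    (\<forall>j\<in>I. \<forall>l\<in>I. j \<noteq> l \<longrightarrow> \<not> int n dvd j - l)) sequentially"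
proof -
  have "eventually (\<lambda>n. j \<noteq> l \<longrightarrow> \<not> int n dvd j - l) sequentially" for j l
    using not_dvd_difference[of "j - l"] by (cases "j = l") auto
  then show ?thesis
    using not_dvd_fourier_frequency[OF lim lam]
    by (intro eventually_conj eventually_ball_finite ballI eventually_ge_at_top \<open>finite I\<close>)
qed

lemma summable_on_power_abs:
  assumes "0 < \<sigma>" "\<sigma> < (1::real)"
  shows "(\<lambda>u. \<sigma> ^ nat \<bar>u\<bar>) summable_on (UNIV :: int set)"
proof (rule nonneg_bdd_above_summable_on)
  show "bdd_above (sum (\<lambda>u. \<sigma> ^ nat \<bar>u\<bar>) ` {F. F \<subseteq> (UNIV :: int set) \<and> finite F})"
    using sum_power_dist_le[OF _ assms, of _ 0] by (intro bdd_aboveI[of _ "2 / (1 - \<sigma>)"]) auto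
qed (use assms in auto)

text \<open>First absolute moment of the geometric kernel. It pays for the edge effect and for the
  drift of the frequencies, two errors that grow linearly with the lag.\<close>

lemma sum_abs_power_abs_bounded:
  assumes "0 < \<sigma>" "\<sigma> < (1::real)"
  obtains R where "\<And>n. (\<Sum>u\<in>{- int n..int n}. \<bar>real_of_int u\<bar> * \<sigma> ^ nat \<bar>u\<bar>) \<le> R"
proof -
  have s: "summable (\<lambda>k. real k * \<sigma> ^ k)"
  proof (rule summable_comparison_test')
    show "summable (\<lambda>k. real (Suc k) * \<sigma> ^ k)"
      using geometric_deriv_sums[of \<sigma>] assms by (auto simp: sums_iff)
    show "norm (real k * \<sigma> ^ k) \<le> real (Suc k) * \<sigma> ^ k" for k
      using assms by (simp add: abs_mult)
  qed
  have "(\<Sum>u\<in>{- int n..int n}. \<bar>real_of_int u\<bar> * \<sigma> ^ nat \<bar>u\<bar>) \<le> 2 * (\<Sum>k. real k * \<sigma> ^ k)" for n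
    using sum_dist_le_suminf[OF _ s, of "{- int n..int n}" 0] assms by simp
  then show thesis by (rule that)
qed

section \<open>Quadratic forms arranged by lag\<close>

lemma sum_square_by_difference:
  "(\<Sum>s\<in>{1..int n}. \<Sum>t\<in>{1..int n}. f s t) =
   (\<Sum>u\<in>{- int n..int n}. \<Sum>s\<in>{s \<in> {1..int n}. s + u \<in> {1..int n}}. f s (s + u))"
proof -
  have "(\<Sum>t\<in>{1..int n}. f s t) = (\<Sum>u\<in>{- int n..int n}. if s + u \<in> {1..int n} then f s (s + u) else 0)"
    if "s \<in> {1..int n}" for s
  proof -
    have "(\<Sum>t\<in>{1..int n}. f s t) = (\<Sum>u\<in>{u \<in> {- int n..int n}. s + u \<in> {1..int n}}. f s (s + u))"
      by (rule sum.reindex_bij_witness[of _ "\<lambda>u. s + u" "\<lambda>t. t - s"]) (use that in auto)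
    also have "\<dots> = (\<Sum>u\<in>{- int n..int n}. if s + u \<in> {1..int n} then f s (s + u) else 0)"
      by (rule sum.inter_filter) simp
    finally show ?thesis .
  qed
  then have "(\<Sum>s\<in>{1..int n}. \<Sum>t\<in>{1..int n}. f s t) =
    (\<Sum>s\<in>{1..int n}. \<Sum>u\<in>{- int n..int n}. if s + u \<in> {1..int n} then f s (s + u) else 0)"
    by (rule sum.cong[OF refl])
  also have "\<dots> = (\<Sum>u\<in>{- int n..int n}. \<Sum>s\<in>{1..int n}. if s + u \<in> {1..int n} then f s (s + u) else 0)"
    by (rule sum.swap)
  also have "\<dots> = (\<Sum>u\<in>{- int n..int n}. \<Sum>s\<in>{s \<in> {1..int n}. s + u \<in> {1..int n}}. f s (s + u))"
    by (intro sum.cong refl sum.inter_filter[symmetric]) simp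
  finally show ?thesis .
qed

lemma card_shift_out_le: "real (card {s \<in> {1..int n}. s + u \<notin> {1..int n}}) \<le> \<bar>real_of_int u\<bar>"
proof -
  have "{s \<in> {1..int n}. s + u \<notin> {1..int n}} \<subseteq> (if 0 \<le> u then {int n - u + 1..int n} else {1..- u})"
    by auto
  then have "card {s \<in> {1..int n}. s + u \<notin> {1..int n}} \<le> card (if 0 \<le> u then {int n - u + 1..int n} else {1..- u})"
    by (intro card_mono) auto
  also have "\<dots> = nat \<bar>u\<bar>" by simp
  finally show ?thesis by linarith
qed

text \<open>For lag \<open>u\<close> the pairs inside the sample miss at most
  \<open>\<bar>u\<bar>\<close> terms of the untruncated correlation \<open>n * G u\<close>, each at
  most \<open>K^2\<close>. After division by \<open>n\<close> this is negligible as soon as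
  \<open>r\<close> has a finite first moment.\<close>

lemma weighted_quadratic_form_approx:
  fixes c r G :: "int \<Rightarrow> real"
  assumes K: "\<And>t. \<bar>c t\<bar> \<le> K" and n: "n \<ge> 1"
    and G: "\<And>u. (\<Sum>s\<in>{1..int n}. c s * c (s + u)) = real n * G u"
  shows "\<bar>(\<Sum>s\<in>{1..int n}. \<Sum>t\<in>{1..int n}. c s * c t * r (t - s)) / real n - (\<Sum>u\<in>{- int n..int n}. r u * G u)\<bar>
    \<le> (\<Sum>u\<in>{- int n..int n}. \<bar>r u\<bar> * \<bar>real_of_int u\<bar>) * (K\<^sup>2 / real n)"
proof -
  let ?P = "{1..int n}" and ?W = "{- int n..int n}"
  have K0: "0 \<le> K" using K[of 0] by linarith
  have cc: "\<bar>c s * c t\<bar> \<le> K\<^sup>2" for s t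
    unfolding abs_mult power2_eq_square by (intro mult_mono K K0) auto
  have "(\<Sum>s\<in>?P. \<Sum>t\<in>?P. c s * c t * r (t - s)) / real n - (\<Sum>u\<in>?W. r u * G u) =
      (\<Sum>u\<in>?W. r u * ((\<Sum>s\<in>{s \<in> ?P. s + u \<in> ?P}. c s * c (s + u)) / real n - G u))"
    unfolding sum_square_by_difference
    by (simp add: sum_subtractf right_diff_distrib sum_divide_distrib sum_distrib_left mult_ac)
  also have "\<bar>\<dots>\<bar> \<le> (\<Sum>u\<in>?W. \<bar>r u\<bar> * (\<bar>real_of_int u\<bar> * (K\<^sup>2 / real n)))"
  proof (rule order_trans[OF sum_abs], rule sum_mono)
    fix u
    let ?Q = "{s \<in> ?P. s + u \<notin> ?P}"
    have "(\<Sum>s\<in>?P. c s * c (s + u)) = (\<Sum>s\<in>{s \<in> ?P. s + u \<in> ?P}. c s * c (s + u)) + (\<Sum>s\<in>?Q. c s * c (s + u))"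
    proof -
      have fin: "finite {s \<in> ?P. Q s}" for Q by (rule finite_subset[of _ ?P]) auto
      have "(\<Sum>s\<in>{s \<in> ?P. s + u \<in> ?P} \<union> ?Q. c s * c (s + u)) =
          (\<Sum>s\<in>{s \<in> ?P. s + u \<in> ?P}. c s * c (s + u)) + (\<Sum>s\<in>?Q. c s * c (s + u))"
        by (rule sum.union_disjoint[OF fin fin]) blast
      moreover have "{s \<in> ?P. s + u \<in> ?P} \<union> ?Q = ?P" by blast
      ultimately show ?thesis by simp
    qed
    then have "(\<Sum>s\<in>{s \<in> ?P. s + u \<in> ?P}. c s * c (s + u)) = real n * G u - (\<Sum>s\<in>?Q. c s * c (s + u))"
      unfolding G by linarith
    then have "(\<Sum>s\<in>{s \<in> ?P. s + u \<in> ?P}. c s * c (s + u)) / real n - G u = - ((\<Sum>s\<in>?Q. c s * c (s + u)) / real n)"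
      using n by (simp only: diff_divide_distrib) simp
    moreover have "\<bar>\<Sum>s\<in>?Q. c s * c (s + u)\<bar> \<le> \<bar>real_of_int u\<bar> * K\<^sup>2"
    proof -
      have "\<bar>\<Sum>s\<in>?Q. c s * c (s + u)\<bar> \<le> (\<Sum>s\<in>?Q. K\<^sup>2)"
        by (intro order_trans[OF sum_abs] sum_mono cc)
      also have "\<dots> = real (card ?Q) * K\<^sup>2" by simp
      also have "\<dots> \<le> \<bar>real_of_int u\<bar> * K\<^sup>2"
        by (intro mult_right_mono card_shift_out_le) simp
      finally show ?thesis .
    qed
    then have "\<bar>(\<Sum>s\<in>?Q. c s * c (s + u)) / real n\<bar> \<le> \<bar>real_of_int u\<bar> * (K\<^sup>2 / real n)"
      using divide_right_mono[of _ "\<bar>real_of_int u\<bar> * K\<^sup>2" "real n"] by simp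
    ultimately show "\<bar>r u * ((\<Sum>s\<in>{s \<in> ?P. s + u \<in> ?P}. c s * c (s + u)) / real n - G u)\<bar> \<le> \<bar>r u\<bar> * (\<bar>real_of_int u\<bar> * (K\<^sup>2 / real n))"
      unfolding abs_mult by (intro mult_left_mono) (simp_all only: abs_minus_cancel abs_ge_zero)
  qed
  also have "\<dots> = (\<Sum>u\<in>?W. \<bar>r u\<bar> * \<bar>real_of_int u\<bar>) * (K\<^sup>2 / real n)"
    by (simp only: sum_distrib_right mult.assoc)
  finally show ?thesis .
qed

lemma abs_cos_diff_le: "\<bar>cos x - cos y\<bar> \<le> \<bar>x - y\<bar>" for x y :: real
proof -
  have "\<bar>cos x - cos y\<bar> = \<bar>Re (cis x - cis y)\<bar>" by simp
  also have "\<dots> \<le> cmod (cis x - cis y)" by (rule abs_Re_le_cmod)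
  also have "\<dots> \<le> \<bar>x - y\<bar>" using norm_iexp_diff_le[of x y] by (simp add: cis_conv_exp)
  finally show ?thesis .
qed

context mixing_functional
begin

definition acov :: "int \<Rightarrow> real" where
  "acov u = (\<integral>\<omega>. h (X 0 \<omega>) * h (X u \<omega>) \<partial>M)"

lemma acov_shift: "(\<integral>\<omega>. h (X s \<omega>) * h (X (s + u) \<omega>) \<partial>M) = acov u"
  using integral_h_stationary2[of "\<lambda>x y. h x * h y" 0 u s] by (simp add: acov_def add.commute)

lemma acov_le: "\<bar>acov u\<bar> \<le> D * \<sigma> ^ nat \<bar>u\<bar>"
  using cov_le[of 0 u] by (simp add: acov_def)

lemma acov_cos_summable: "(\<lambda>u. acov u * cos (real_of_int u * x)) summable_on UNIV"
proof (rule abs_summable_summable, rule summable_on_comparison_test)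
  show "(\<lambda>u. D * \<sigma> ^ nat \<bar>u\<bar>) summable_on (UNIV :: int set)"
    by (intro summable_on_cmult_right summable_on_power_abs \<sigma>)
  show "norm (acov u * cos (real_of_int u * x)) \<le> D * \<sigma> ^ nat \<bar>u\<bar>" for u
    using mult_mono[OF acov_le abs_cos_le_one[of "real_of_int u * x"]] D_nonneg \<sigma>
    by (simp add: abs_mult)
qed simp

text \<open>Three replacements: correlations cut off at the sample edges by exact ones, the shifted
  Fourier frequencies by \<open>lam\<close> using the Lipschitz bound for cosine, and finite lag
  windows by the whole series. The factor 1/2 is the mean of a squared cosine. That \<open>z\<close>
  enters only through the sum of \<open>|z j|^2\<close> expresses asymptotic independence across
  frequencies and between cosine and sine parts.\<close>

lemma trig_variance_limit:
  fixes jn :: "nat \<Rightarrow> int" and z :: "int \<Rightarrow> complex"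
  assumes "finite I" and lim: "(\<lambda>n. 2 * pi * real_of_int (jn n) / real n) \<longlonglongrightarrow> lam"
    and lam: "0 < lam" "lam < pi"
  defines "c \<equiv> \<lambda>n. trigw I z (jn n) n"
  shows "(\<lambda>n. \<integral>\<omega>. (lin (\<lambda>t. c n t / sqrt (real n)) {1..int n} \<omega>)\<^sup>2 \<partial>M) \<longlonglongrightarrow>
    (\<Sum>j\<in>I. (cmod (z j))\<^sup>2) / 2 * (\<Sum>\<^sub>\<infinity>u. acov u * cos (real_of_int u * lam))"
proof -
  define K where "K = (\<Sum>j\<in>I. cmod (z j))"
  have cK: "\<bar>c n t\<bar> \<le> K" for n t unfolding c_def K_def by (rule trigw_bound)
  have K0: "0 \<le> K" using cK[of 0 0] by linarith
  define Z where "Z = (\<Sum>j\<in>I. (cmod (z j))\<^sup>2)"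
  define w where "w n j = 2 * pi * real_of_int (jn n + j) / real n" for n j
  define G where "G n u = (\<Sum>j\<in>I. (cmod (z j))\<^sup>2 * cos (real_of_int u * w n j)) / 2" for n u
  define \<delta> where "\<delta> n = (\<Sum>j\<in>I. (cmod (z j))\<^sup>2 * \<bar>w n j - lam\<bar>)" for n
  obtain R where R: "\<And>n. (\<Sum>u\<in>{- int n..int n}. \<bar>real_of_int u\<bar> * \<sigma> ^ nat \<bar>u\<bar>) \<le> R"
    using sum_abs_power_abs_bounded[OF \<sigma>] by blast
  let ?W = "\<lambda>n. {- int n..int n}"
  have wlim: "(\<lambda>n. w n j) \<longlonglongrightarrow> lam" for j
  proof -
    have "(\<lambda>n. 2 * pi * real_of_int j / real n) \<longlonglongrightarrow> 0" by real_asymp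
    from tendsto_add[OF lim this] show ?thesis
      by (simp add: w_def distrib_left add_divide_distrib)
  qed
  have "\<delta> \<longlonglongrightarrow> (\<Sum>j\<in>I. (cmod (z j))\<^sup>2 * \<bar>lam - lam\<bar>)"
    unfolding \<delta>_def by (intro tendsto_intros wlim)
  then have \<delta>0: "\<delta> \<longlonglongrightarrow> 0" by simp
  have \<delta>_nonneg: "0 \<le> \<delta> n" for n unfolding \<delta>_def by (intro sum_nonneg) auto
  have sumW: "(\<Sum>u\<in>?W n. \<bar>acov u\<bar> * \<bar>real_of_int u\<bar>) \<le> D * R" for n
  proof -
    have "(\<Sum>u\<in>?W n. \<bar>acov u\<bar> * \<bar>real_of_int u\<bar>) \<le> (\<Sum>u\<in>?W n. D * (\<bar>real_of_int u\<bar> * \<sigma> ^ nat \<bar>u\<bar>))"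
    proof (rule sum_mono)
      fix u
      show "\<bar>acov u\<bar> * \<bar>real_of_int u\<bar> \<le> D * (\<bar>real_of_int u\<bar> * \<sigma> ^ nat \<bar>u\<bar>)"
        using mult_right_mono[OF acov_le[of u], of "\<bar>real_of_int u\<bar>"] by (simp add: mult_ac)
    qed
    also have "\<dots> \<le> D * R"
      unfolding sum_distrib_left[symmetric] by (intro mult_left_mono R D_nonneg)
    finally show ?thesis .
  qed
  have 1: "(\<lambda>n. (\<integral>\<omega>. (lin (\<lambda>t. c n t / sqrt (real n)) {1..int n} \<omega>)\<^sup>2 \<partial>M) - (\<Sum>u\<in>?W n. acov u * G n u)) \<longlonglongrightarrow> 0"
  proof (rule Lim_null_comparison)
    show "eventually (\<lambda>n. norm ((\<integral>\<omega>. (lin (\<lambda>t. c n t / sqrt (real n)) {1..int n} \<omega>)\<^sup>2 \<partial>M) - (\<Sum>u\<in>?W n. acov u * G n u))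
       \<le> K\<^sup>2 * (D * R) / real n) sequentially"
      using fourier_frequencies_nondegenerate[OF assms(1-4)]
    proof eventually_elim
      case (elim n)
      then have n: "n \<ge> 1" by simp
      let ?P = "{1..int n}"
      have shift: "(\<Sum>s\<in>?P. c n s * c n (s + u)) = real n * G n u" for u
      proof -
        have "(\<Sum>s\<in>?P. c n s * c n (s + u)) = (\<Sum>t=1..n. trigw I z (jn n) n (int t) * trigw I z (jn n) n (int t + u))"
          unfolding c_def by (rule sum_int_interval)
        also have "\<dots> = real n / 2 * (\<Sum>j\<in>I. (cmod (z j))\<^sup>2 * cos (real_of_int u * w n j))"
          unfolding w_def by (rule sum_trigw_shift) (use elim \<open>finite I\<close> in auto)
        finally show ?thesis by (simp add: G_def)
      qed
      have sq: "sqrt (real n) * sqrt (real n) = real n" by simp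
      have "(\<integral>\<omega>. (lin (\<lambda>t. c n t / sqrt (real n)) ?P \<omega>)\<^sup>2 \<partial>M) =
        (\<Sum>s\<in>?P. \<Sum>t\<in>?P. c n s / sqrt (real n) * (c n t / sqrt (real n)) * (\<integral>\<omega>. h (X s \<omega>) * h (X t \<omega>) \<partial>M))"
        unfolding power2_eq_square by (rule integral_lin_mult)
      also have "\<dots> = (\<Sum>s\<in>?P. \<Sum>t\<in>?P. c n s * c n t * acov (t - s)) / real n"
      proof -
        have "c n s / sqrt (real n) * (c n t / sqrt (real n)) * (\<integral>\<omega>. h (X s \<omega>) * h (X t \<omega>) \<partial>M) = c n s * c n t * acov (t - s) / real n" for s t
        proof -
          have "(\<integral>\<omega>. h (X s \<omega>) * h (X t \<omega>) \<partial>M) = acov (t - s)"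
            using acov_shift[of s "t - s"] by simp
          moreover have "c n s / sqrt (real n) * (c n t / sqrt (real n)) = c n s * c n t / real n"
            by (subst times_divide_times_eq) (simp only: sq)
          ultimately show ?thesis by (simp only: times_divide_eq_left)
        qed
        then show ?thesis by (simp only: sum_divide_distrib)
      qed
      finally have "norm ((\<integral>\<omega>. (lin (\<lambda>t. c n t / sqrt (real n)) ?P \<omega>)\<^sup>2 \<partial>M) - (\<Sum>u\<in>?W n. acov u * G n u))
          \<le> (\<Sum>u\<in>?W n. \<bar>acov u\<bar> * \<bar>real_of_int u\<bar>) * (K\<^sup>2 / real n)"
        using weighted_quadratic_form_approx[OF cK n shift, of acov] by (simp only: real_norm_def)
      also have "\<dots> \<le> D * R * (K\<^sup>2 / real n)"
        by (intro mult_right_mono sumW) simp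
      finally show ?case by (simp add: mult_ac)
    qed
    show "(\<lambda>n. K\<^sup>2 * (D * R) / real n) \<longlonglongrightarrow> 0"
      by (rule lim_const_over_n)
  qed
  have 2: "(\<lambda>n. (\<Sum>u\<in>?W n. acov u * G n u) - (\<Sum>u\<in>?W n. acov u * (Z / 2 * cos (real_of_int u * lam)))) \<longlonglongrightarrow> 0"
  proof (rule Lim_null_comparison)
    show "eventually (\<lambda>n. norm ((\<Sum>u\<in>?W n. acov u * G n u) - (\<Sum>u\<in>?W n. acov u * (Z / 2 * cos (real_of_int u * lam)))) \<le> D * R * \<delta> n) sequentially"
    proof (rule always_eventually, rule allI)
      fix n
      have Gd: "\<bar>G n u - Z / 2 * cos (real_of_int u * lam)\<bar> \<le> \<bar>real_of_int u\<bar> * \<delta> n" for u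
      proof -
        have "G n u - Z / 2 * cos (real_of_int u * lam) = (\<Sum>j\<in>I. (cmod (z j))\<^sup>2 * (cos (real_of_int u * w n j) - cos (real_of_int u * lam))) / 2"
          unfolding G_def Z_def by (simp add: sum_subtractf right_diff_distrib sum_distrib_right diff_divide_distrib)
        also have "\<bar>\<dots>\<bar> \<le> (\<Sum>j\<in>I. (cmod (z j))\<^sup>2 * (\<bar>real_of_int u\<bar> * \<bar>w n j - lam\<bar>)) / 2"
        proof -
          have "\<bar>\<Sum>j\<in>I. (cmod (z j))\<^sup>2 * (cos (real_of_int u * w n j) - cos (real_of_int u * lam))\<bar>
            \<le> (\<Sum>j\<in>I. (cmod (z j))\<^sup>2 * (\<bar>real_of_int u\<bar> * \<bar>w n j - lam\<bar>))"
          proof (rule order_trans[OF sum_abs], rule sum_mono)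
            fix j
            show "\<bar>(cmod (z j))\<^sup>2 * (cos (real_of_int u * w n j) - cos (real_of_int u * lam))\<bar> \<le> (cmod (z j))\<^sup>2 * (\<bar>real_of_int u\<bar> * \<bar>w n j - lam\<bar>)"
              using abs_cos_diff_le[of "real_of_int u * w n j" "real_of_int u * lam"]
              by (simp add: abs_mult mult_left_mono flip: right_diff_distrib)
          qed
          then show ?thesis by simp
        qed
        also have "\<dots> = \<bar>real_of_int u\<bar> * \<delta> n / 2"
          unfolding \<delta>_def by (simp add: sum_distrib_left mult_ac)
        also have "\<dots> \<le> \<bar>real_of_int u\<bar> * \<delta> n" using \<delta>_nonneg[of n] by simp
        finally show ?thesis .
      qed
      have "norm ((\<Sum>u\<in>?W n. acov u * G n u) - (\<Sum>u\<in>?W n. acov u * (Z / 2 * cos (real_of_int u * lam)))) =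
        \<bar>\<Sum>u\<in>?W n. acov u * (G n u - Z / 2 * cos (real_of_int u * lam))\<bar>"
        by (simp add: sum_subtractf right_diff_distrib)
      also have "\<dots> \<le> (\<Sum>u\<in>?W n. \<bar>acov u\<bar> * (\<bar>real_of_int u\<bar> * \<delta> n))"
        by (intro order_trans[OF sum_abs] sum_mono) (simp only: abs_mult mult_left_mono[OF Gd abs_ge_zero])
      also have "\<dots> = (\<Sum>u\<in>?W n. \<bar>acov u\<bar> * \<bar>real_of_int u\<bar>) * \<delta> n"
        by (simp add: sum_distrib_right mult.assoc)
      also have "\<dots> \<le> D * R * \<delta> n"
        by (intro mult_right_mono sumW \<delta>_nonneg)
      finally show "norm ((\<Sum>u\<in>?W n. acov u * G n u) - (\<Sum>u\<in>?W n. acov u * (Z / 2 * cos (real_of_int u * lam)))) \<le> D * R * \<delta> n" .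
    qed
    show "(\<lambda>n. D * R * \<delta> n) \<longlonglongrightarrow> 0" by (rule tendsto_mult_right_zero[OF \<delta>0])
  qed
  have 3: "(\<lambda>n. \<Sum>u\<in>?W n. acov u * (Z / 2 * cos (real_of_int u * lam))) \<longlonglongrightarrow> Z / 2 * (\<Sum>\<^sub>\<infinity>u. acov u * cos (real_of_int u * lam))"
  proof -
    \<comment> \<open>The unordered sum is a limit along finite sets directed by inclusion. The
      symmetric windows eventually contain any given finite set, so they compute the same
      limit.\<close>
    have W: "filterlim ?W (finite_subsets_at_top UNIV) sequentially"
      unfolding filterlim_finite_subsets_at_top
    proof (intro allI impI)
      fix F :: "int set" assume "finite F \<and> F \<subseteq> UNIV"
      define b where "b = Max (insert 0 (abs ` F))"
      have b: "\<bar>u\<bar> \<le> b" if "u \<in> F" for u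
        unfolding b_def using \<open>finite F \<and> F \<subseteq> UNIV\<close> that by (intro Max_ge) auto
      show "eventually (\<lambda>n. finite (?W n) \<and> F \<subseteq> ?W n \<and> ?W n \<subseteq> UNIV) sequentially"
        using eventually_ge_at_top[of "nat b"] by eventually_elim (use b in force)
    qed
    have "((\<lambda>u. acov u * cos (real_of_int u * lam)) has_sum (\<Sum>\<^sub>\<infinity>u. acov u * cos (real_of_int u * lam))) UNIV"
      by (rule has_sum_infsum[OF acov_cos_summable])
    then have "(\<lambda>n. \<Sum>u\<in>?W n. acov u * cos (real_of_int u * lam)) \<longlonglongrightarrow> (\<Sum>\<^sub>\<infinity>u. acov u * cos (real_of_int u * lam))"
      unfolding has_sum_def using W by (rule filterlim_compose)
    from tendsto_mult_left[OF this, of "Z / 2"] show ?thesis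
      by (simp add: sum_distrib_left mult_ac)
  qed
  from tendsto_add[OF tendsto_add[OF 1 2] 3] show ?thesis by (simp add: Z_def)
qed

end

section \<open>The empirical quantile\<close>

text \<open>Strict inequality as in \<open>Vfun\<close>, so that
  \<open>Vfun tau x y = tau - below x y\<close>. The mean of \<open>below x\<close> over the process
  agrees with the distribution function only where there is no atom.\<close>

definition below :: "real \<Rightarrow> real \<Rightarrow> real" where
  "below x y = (if y < x then 1 else 0)"

lemma below_measurable[measurable]: "below x \<in> borel_measurable borel"
  unfolding below_def[abs_def] by measurable

lemma below_bounds: "0 \<le> below x y" "below x y \<le> 1"
  unfolding below_def by auto

lemma below_mono: "x \<le> x' \<Longrightarrow> below x y \<le> below x' y"
  unfolding below_def by auto

text \<open>Subgradient inequality for the convex map sending \<open>z\<close> to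
  \<open>rho tau (x - z)\<close>: \<open>below y x - tau\<close> is its left derivative at
  \<open>y\<close>.\<close>

lemma rho_ge_right_tangent:
  assumes "y < z"
  shows "(z - y) * (below y x - tau) \<le> rho tau (x - z) - rho tau (x - y)"
  using assms unfolding rho_def below_def by (auto simp: algebra_simps)

lemma rho_ge_left_tangent:
  assumes "z < y"
  shows "(y - z) * (tau - below y x) \<le> rho tau (x - z) - rho tau (x - y)"
  using assms unfolding rho_def below_def by (auto simp: algebra_simps)

text \<open>Summed subgradient inequalities tell on which side of \<open>y\<close> a minimizer can
  lie. Each bound compares \<open>z\<close> with the single competitor \<open>y\<close>, so it
  applies to whichever minimizer has been selected.\<close>

lemma quantile_minimizer_bounds:
  fixes x :: "'i \<Rightarrow> real"
  assumes min: "\<And>y. (\<Sum>t\<in>S. rho tau (x t - z)) \<le> (\<Sum>t\<in>S. rho tau (x t - y))"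
  shows "y < z \<Longrightarrow> (\<Sum>t\<in>S. below y (x t) - tau) \<le> 0"
    and "z < y \<Longrightarrow> 0 \<le> (\<Sum>t\<in>S. below y (x t) - tau)"
proof -
  assume "y < z"
  have "(z - y) * (\<Sum>t\<in>S. below y (x t) - tau) \<le> (\<Sum>t\<in>S. rho tau (x t - z) - rho tau (x t - y))"
    unfolding sum_distrib_left by (intro sum_mono rho_ge_right_tangent \<open>y < z\<close>)
  also have "\<dots> \<le> 0" using min[of y] by (simp add: sum_subtractf)
  finally show "(\<Sum>t\<in>S. below y (x t) - tau) \<le> 0"
    using \<open>y < z\<close> by (simp add: mult_le_0_iff)
next
  assume "z < y"
  have "(y - z) * (\<Sum>t\<in>S. tau - below y (x t)) \<le> (\<Sum>t\<in>S. rho tau (x t - z) - rho tau (x t - y))"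
    unfolding sum_distrib_left by (intro sum_mono rho_ge_left_tangent \<open>z < y\<close>)
  also have "\<dots> \<le> 0" using min[of y] by (simp add: sum_subtractf)
  finally show "0 \<le> (\<Sum>t\<in>S. below y (x t) - tau)"
    using \<open>z < y\<close> by (simp add: mult_le_0_iff sum_subtractf)
qed

text \<open>All local information near \<open>x0\<close> with a common radius \<open>\<eta>\<close>:
  \<open>CF\<close> is a Lipschitz constant, \<open>cF\<close> a lower slope bound supplied by the
  density, and \<open>C\<close>, \<open>\<sigma>\<close> give a coupling bound uniform in the
  level.\<close>

locale quantile_process = stationary_process +
  fixes tau x0 \<eta> C \<sigma> CF cF :: real
  assumes pos: "0 < \<eta>" "0 < cF" "0 \<le> CF" "0 \<le> C"
    and \<sigma>: "0 < \<sigma>" "\<sigma> < 1"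
    and coup_below: "\<And>x n. \<bar>x - x0\<bar> < \<eta> \<Longrightarrow> coup_dist (below x) (int n) \<le> C * \<sigma> ^ n"
    and F_lipschitz: "\<And>x y. \<bar>x - x0\<bar> < \<eta> \<Longrightarrow> \<bar>y - x0\<bar> < \<eta> \<Longrightarrow>
       \<bar>(\<integral>\<omega>. below x (X 0 \<omega>) \<partial>M) - (\<integral>\<omega>. below y (X 0 \<omega>) \<partial>M)\<bar> \<le> CF * \<bar>x - y\<bar>"
    and F_x0: "(\<integral>\<omega>. below x0 (X 0 \<omega>) \<partial>M) = tau"
    and F_growth: "\<And>x. x0 \<le> x \<Longrightarrow> x < x0 + \<eta> \<Longrightarrow> cF * (x - x0) \<le> (\<integral>\<omega>. below x (X 0 \<omega>) \<partial>M) - tau"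
      "\<And>x. x0 - \<eta> < x \<Longrightarrow> x \<le> x0 \<Longrightarrow> cF * (x0 - x) \<le> tau - (\<integral>\<omega>. below x (X 0 \<omega>) \<partial>M)"
begin

definition F :: "real \<Rightarrow> real" where "F x = (\<integral>\<omega>. below x (X 0 \<omega>) \<partial>M)"

lemma integrable_below: "integrable M (\<lambda>\<omega>. below x (X t \<omega>))"
  by (rule integrable_const_bound[where B = 1]) (auto simp: below_bounds)

lemma F_bounds: "0 \<le> F x" "F x \<le> 1"
proof -
  show "0 \<le> F x" unfolding F_def by (simp add: below_bounds)
  have "F x \<le> (\<integral>\<omega>. 1 \<partial>M)" unfolding F_def
    by (intro integral_mono integrable_below) (auto simp: below_bounds)
  then show "F x \<le> 1" by (simp add: prob_space)
qed

lemma coup_dist_shift: "coup_dist (\<lambda>y. f y - c) n = coup_dist f n"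
  unfolding coup_dist_def by simp

text \<open>Uses \<open>(p - q)^2 \<le> 2 p^2 + 2 q^2\<close>, which yields the same constant
  \<open>2 * b\<close> as the L2 triangle inequality.\<close>

lemma coup_dist_diff_le:
  assumes [measurable]: "f \<in> borel_measurable borel" "g \<in> borel_measurable borel"
    and B: "\<And>y. \<bar>f y\<bar> \<le> 1" "\<And>y. \<bar>g y\<bar> \<le> 1" and "coup_dist f n \<le> b" "coup_dist g n \<le> b"
  shows "coup_dist (\<lambda>y. f y - g y) n \<le> 2 * b"
proof -
  let ?E = "\<lambda>f. \<integral>\<omega>. (f (Xcoup Y n \<omega>) - f (Xcoup' Y n \<omega>))\<^sup>2 \<partial>coupSpace L"
  have b: "0 \<le> b" using coup_dist_nonneg[of f n] assms(5) by linarith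
  have 1: "?E f \<le> b\<^sup>2" if "coup_dist f n \<le> b" for f
    using sqrt_le_D[OF that[unfolded coup_dist_def]] .
  have int: "integrable (coupSpace L) (\<lambda>\<omega>. (f (Xcoup Y n \<omega>) - f (Xcoup' Y n \<omega>))\<^sup>2)"
    if [measurable]: "f \<in> borel_measurable borel" and B: "\<And>y. \<bar>f y\<bar> \<le> 2" for f :: "real \<Rightarrow> real"
  proof (rule coup.integrable_const_bound[where B = "4\<^sup>2"], rule AE_I2)
    fix \<omega>
    have "\<bar>f (Xcoup Y n \<omega>) - f (Xcoup' Y n \<omega>)\<bar> \<le> 4"
      using B[of "Xcoup Y n \<omega>"] B[of "Xcoup' Y n \<omega>"] by linarith
    then show "norm ((f (Xcoup Y n \<omega>) - f (Xcoup' Y n \<omega>))\<^sup>2) \<le> 4\<^sup>2"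
      using abs_bound_imp_square_bound by (metis abs_power2 real_norm_def)
  qed simp
  have B2: "\<bar>f y\<bar> \<le> 2" "\<bar>g y\<bar> \<le> 2" "\<bar>f y - g y\<bar> \<le> 2" for y
    using B(1)[of y] B(2)[of y] by linarith+
  have "?E (\<lambda>y. f y - g y) \<le> (\<integral>\<omega>. 2 * (f (Xcoup Y n \<omega>) - f (Xcoup' Y n \<omega>))\<^sup>2 + 2 * (g (Xcoup Y n \<omega>) - g (Xcoup' Y n \<omega>))\<^sup>2 \<partial>coupSpace L)"
  proof (rule integral_mono)
    fix \<omega>
    have "(p - q)\<^sup>2 \<le> 2 * p\<^sup>2 + 2 * q\<^sup>2" for p q :: real
      using zero_le_power2[of "p + q"] unfolding power2_sum power2_diff by linarith
    from this[of "f (Xcoup Y n \<omega>) - f (Xcoup' Y n \<omega>)" "g (Xcoup Y n \<omega>) - g (Xcoup' Y n \<omega>)"]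
    show "(f (Xcoup Y n \<omega>) - g (Xcoup Y n \<omega>) - (f (Xcoup' Y n \<omega>) - g (Xcoup' Y n \<omega>)))\<^sup>2
      \<le> 2 * (f (Xcoup Y n \<omega>) - f (Xcoup' Y n \<omega>))\<^sup>2 + 2 * (g (Xcoup Y n \<omega>) - g (Xcoup' Y n \<omega>))\<^sup>2"
      by (simp add: algebra_simps)
  qed (use int[of f] int[of g] int[of "\<lambda>y. f y - g y"] B2 in auto)
  also have "\<dots> = 2 * ?E f + 2 * ?E g"
    using int[of f] int[of g] B2 by simp
  also have "\<dots> \<le> (2 * b)\<^sup>2"
    using 1[OF assms(5)] 1[OF assms(6)] by (simp add: power_mult_distrib)
  finally show ?thesis
    unfolding coup_dist_def using b by (intro real_le_lsqrt) auto
qed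

lemma below_variance_bound:
  assumes x: "\<bar>x - x0\<bar> < \<eta>" and a: "\<And>t. t \<in> S \<Longrightarrow> \<bar>a t\<bar> \<le> K" and "finite S"
  shows "(\<integral>\<omega>. (\<Sum>t\<in>S. a t * (below x (X t \<omega>) - F x))\<^sup>2 \<partial>M) \<le> K\<^sup>2 * real (card S) * (2 * C / (1 - \<sigma>))"
proof (rule weighted_variance_bound[where h = "\<lambda>y. below x y - F x" and B = 1])
  let ?h = "\<lambda>y. below x y - F x"
  show hm: "?h \<in> borel_measurable borel" by measurable
  show hb: "\<bar>?h y\<bar> \<le> 1" for y
    using below_bounds[of x y] F_bounds[of x] by linarith
  have c: "(\<integral>\<omega>. ?h (X 0 \<omega>) \<partial>M) = 0"
    using integrable_below[of x 0] by (simp add: prob_space F_def)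
  show "\<bar>\<integral>\<omega>. ?h (X s \<omega>) * ?h (X t \<omega>) \<partial>M\<bar> \<le> C * \<sigma> ^ nat \<bar>s - t\<bar>" for s t
  proof -
    have "(\<integral>\<omega>. (?h (X 0 \<omega>))\<^sup>2 \<partial>M) \<le> (\<integral>\<omega>. 1 \<partial>M)"
      using abs_bound_imp_square_bound[OF hb]
      by (intro integral_mono integrable_const_bound[where B = 1]) auto
    then show ?thesis
      using covariance_le_geometric[OF hm hb c, of 1 C \<sigma>] coup_below[OF x] by (simp add: prob_space coup_dist_shift)
  qed
qed (use assms \<sigma> in auto)

text \<open>The centred increment has variance at most \<open>CF * \<bar>x - y\<bar>\<close>, while
  its coupling distance is only known to be at most \<open>2 * C * \<sigma>^n\<close>. The
  covariance bound multiplies the standard deviation with the coupling distance, so the root of the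
  distance survives in the variance of the whole sum.\<close>

lemma below_increment_variance_bound:
  assumes x: "\<bar>x - x0\<bar> < \<eta>" and y: "\<bar>y - x0\<bar> < \<eta>" and a: "\<And>t. t \<in> S \<Longrightarrow> \<bar>a t\<bar> \<le> K" and "finite S"
  shows "(\<integral>\<omega>. (\<Sum>t\<in>S. a t * (below x (X t \<omega>) - below y (X t \<omega>) - (F x - F y)))\<^sup>2 \<partial>M)
    \<le> K\<^sup>2 * real (card S) * (2 * (sqrt (CF * \<bar>x - y\<bar>) * (2 * C)) / (1 - \<sigma>))"
proof (rule weighted_variance_bound[where h = "\<lambda>u. below x u - below y u - (F x - F y)" and B = 2])
  let ?h = "\<lambda>u. below x u - below y u - (F x - F y)"
  show hm: "?h \<in> borel_measurable borel" by measurable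
  show hb: "\<bar>?h u\<bar> \<le> 2" for u
    using below_bounds[of x u] F_bounds[of x] below_bounds[of y u] F_bounds[of y] by linarith
  have c: "(\<integral>\<omega>. ?h (X 0 \<omega>) \<partial>M) = 0"
    using integrable_below[of x 0] integrable_below[of y 0] by (simp add: prob_space F_def)
  have L2: "(\<integral>\<omega>. (?h (X 0 \<omega>))\<^sup>2 \<partial>M) \<le> CF * \<bar>x - y\<bar>"
  proof -
    let ?g = "\<lambda>\<omega>. below x (X 0 \<omega>) - below y (X 0 \<omega>)"
    have gi: "integrable M ?g" "integrable M (\<lambda>\<omega>. (?g \<omega>)\<^sup>2)"
      by (auto intro!: integrable_const_bound[where B = 1] simp: below_def)
    have "(\<integral>\<omega>. (?h (X 0 \<omega>))\<^sup>2 \<partial>M) = (\<integral>\<omega>. (?g \<omega>)\<^sup>2 - 2 * (F x - F y) * ?g \<omega> + (F x - F y)\<^sup>2 \<partial>M)"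
      by (simp add: power2_eq_square algebra_simps)
    also have "\<dots> = (\<integral>\<omega>. (?g \<omega>)\<^sup>2 \<partial>M) - 2 * (F x - F y) * (\<integral>\<omega>. ?g \<omega> \<partial>M) + (F x - F y)\<^sup>2"
      using gi by (simp add: prob_space)
    also have "(\<integral>\<omega>. ?g \<omega> \<partial>M) = F x - F y"
      using integrable_below[of x 0] integrable_below[of y 0] by (simp add: F_def)
    also have "(\<integral>\<omega>. (?g \<omega>)\<^sup>2 \<partial>M) - 2 * (F x - F y) * (F x - F y) + (F x - F y)\<^sup>2 \<le> (\<integral>\<omega>. (?g \<omega>)\<^sup>2 \<partial>M)"
    proof -
      have "p - 2 * d * d + d\<^sup>2 \<le> p" for p d :: real
        by (simp add: power2_eq_square)
      then show ?thesis .
    qed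
    \<comment> \<open>The two half-lines are nested, so the square of the increment is the increment
      itself up to a fixed sign.\<close>
    also have "\<dots> \<le> \<bar>\<integral>\<omega>. ?g \<omega> \<partial>M\<bar>"
    proof -
      have "(?g \<omega>)\<^sup>2 = (if y \<le> x then 1 else - 1) * ?g \<omega>" for \<omega> by (auto simp: below_def)
      then have "(\<integral>\<omega>. (?g \<omega>)\<^sup>2 \<partial>M) = (if y \<le> x then 1 else - 1) * (\<integral>\<omega>. ?g \<omega> \<partial>M)"
        by (simp only: integral_mult_right_zero)
      then show ?thesis by (auto split: if_splits)
    qed
    also have "\<dots> \<le> CF * \<bar>x - y\<bar>"
      using F_lipschitz[OF x y] integrable_below[of x 0] integrable_below[of y 0] by simp
    finally show ?thesis .
  qed
  show "\<bar>\<integral>\<omega>. ?h (X s \<omega>) * ?h (X t \<omega>) \<partial>M\<bar> \<le> sqrt (CF * \<bar>x - y\<bar>) * (2 * C) * \<sigma> ^ nat \<bar>s - t\<bar>" for s t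
  proof (rule covariance_le_geometric[OF hm hb c L2])
    show "coup_dist ?h (int n) \<le> 2 * C * \<sigma> ^ n" for n
      unfolding coup_dist_shift mult.assoc
      by (intro coup_dist_diff_le coup_below x y) (auto simp: below_bounds)
  qed
qed (use assms \<sigma> in auto)

lemma prob_deviation_le:
  assumes [measurable]: "f \<in> borel_measurable M" and int: "integrable M (\<lambda>\<omega>. (f \<omega>)\<^sup>2)" and "0 < e"
  shows "prob {\<omega> \<in> space M. e \<le> \<bar>f \<omega>\<bar>} \<le> (\<integral>\<omega>. (f \<omega>)\<^sup>2 \<partial>M) / e\<^sup>2"
proof -
  have "{\<omega> \<in> space M. e \<le> \<bar>f \<omega>\<bar>} = {\<omega> \<in> space M. e\<^sup>2 \<le> (f \<omega>)\<^sup>2}"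
    using \<open>0 < e\<close> by (auto simp flip: abs_le_square_iff)
  then show ?thesis
    using integral_Markov_inequality_measure[OF int, of "space M" "e\<^sup>2"] \<open>0 < e\<close> by simp
qed


lemma integrable_sum_below:
  assumes "finite S"
  shows "integrable M (\<lambda>\<omega>. (\<Sum>t\<in>S. a t * (below x (X t \<omega>) - y))\<^sup>2)"
    and "integrable M (\<lambda>\<omega>. (\<Sum>t\<in>S. a t * (below x (X t \<omega>) - below z (X t \<omega>) - y))\<^sup>2)"
proof -
  have 1: "\<bar>below x u - y\<bar> \<le> 1 + \<bar>y\<bar>" "\<bar>below x u - below z u - y\<bar> \<le> 1 + \<bar>y\<bar>" for u
    by (auto simp: below_def)
  have 2: "\<bar>\<Sum>t\<in>S. a t * f t\<bar> \<le> (\<Sum>t\<in>S. \<bar>a t\<bar> * (1 + \<bar>y\<bar>))" if "\<And>t. \<bar>f t\<bar> \<le> 1 + \<bar>y\<bar>" for f :: "int \<Rightarrow> real"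
    by (intro order_trans[OF sum_abs] sum_mono) (simp add: abs_mult mult_left_mono that)
  have 3: "norm ((\<Sum>t\<in>S. a t * f t)\<^sup>2) \<le> (\<Sum>t\<in>S. \<bar>a t\<bar> * (1 + \<bar>y\<bar>))\<^sup>2" if "\<And>t. \<bar>f t\<bar> \<le> 1 + \<bar>y\<bar>" for f :: "int \<Rightarrow> real"
    using abs_bound_imp_square_bound[OF 2[OF that]] by simp
  show "integrable M (\<lambda>\<omega>. (\<Sum>t\<in>S. a t * (below x (X t \<omega>) - y))\<^sup>2)"
    "integrable M (\<lambda>\<omega>. (\<Sum>t\<in>S. a t * (below x (X t \<omega>) - below z (X t \<omega>) - y))\<^sup>2)"
    by (rule integrable_bounded[OF _ 3], measurable, rule 1)+
qed

text \<open>If the estimate exceeds \<open>x0 + r\<close> with \<open>r = b / sqrt n\<close>,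
  minimality allows at most \<open>n * tau\<close> observations below \<open>x0 + r\<close>, whereas
  their mean number exceeds this by at least \<open>n * cF * r = cF * b * sqrt n\<close>. For a sum
  with variance of order \<open>n\<close>, Chebyshev bounds the probability of such a deviation by a
  multiple of \<open>b^(-2)\<close>, uniformly in \<open>n\<close>. The lower side is
  symmetric.\<close>

lemma root_n_consistent:
  assumes meas[measurable]: "\<And>n. xihat n \<in> borel_measurable M"
    and min: "\<And>n \<omega> x. \<omega> \<in> space M \<Longrightarrow>
       (\<Sum>t\<in>{1..int n}. rho tau (X t \<omega> - xihat n \<omega>)) \<le> (\<Sum>t\<in>{1..int n}. rho tau (X t \<omega> - x))"
    and "0 < b" "n \<ge> 1" and small: "b / sqrt (real n) < \<eta>"
  shows "prob {\<omega> \<in> space M. b / sqrt (real n) < \<bar>xihat n \<omega> - x0\<bar>} \<le> 2 * (2 * C / (1 - \<sigma>)) / (cF * b)\<^sup>2"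
proof -
  let ?r = "b / sqrt (real n)" and ?P = "{1..int n}"
  define N where "N y \<omega> = (\<Sum>t\<in>?P. 1 * (below y (X t \<omega>) - F y))" for y \<omega>
  have r: "0 < ?r" using assms by simp
  have sq: "real n * ?r = b * sqrt (real n)"
    using \<open>n \<ge> 1\<close> by (simp add: field_simps)
  have up: "cF * b * sqrt (real n) \<le> \<bar>N (x0 + ?r) \<omega>\<bar>" if "\<omega> \<in> space M" "x0 + ?r < xihat n \<omega>" for \<omega>
  proof -
    have "(\<Sum>t\<in>?P. below (x0 + ?r) (X t \<omega>) - tau) \<le> 0"
      using quantile_minimizer_bounds(1)[OF min] that by blast
    then have "N (x0 + ?r) \<omega> \<le> real n * (tau - F (x0 + ?r))"
      by (simp add: N_def sum_subtractf algebra_simps)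
    also have "\<dots> \<le> real n * (- (cF * ?r))"
      using F_growth(1)[of "x0 + ?r"] r small by (intro mult_left_mono) (auto simp: F_def)
    also have "\<dots> = - (cF * (real n * ?r))" by simp
    finally show ?thesis unfolding sq by simp
  qed
  have down: "cF * b * sqrt (real n) \<le> \<bar>N (x0 - ?r) \<omega>\<bar>" if "\<omega> \<in> space M" "xihat n \<omega> < x0 - ?r" for \<omega>
  proof -
    have "0 \<le> (\<Sum>t\<in>?P. below (x0 - ?r) (X t \<omega>) - tau)"
      using quantile_minimizer_bounds(2)[OF min] that by blast
    then have 1: "real n * (tau - F (x0 - ?r)) \<le> N (x0 - ?r) \<omega>"
      by (simp add: N_def sum_subtractf algebra_simps)
    have "real n * (cF * ?r) \<le> real n * (tau - F (x0 - ?r))"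
      using F_growth(2)[of "x0 - ?r"] r small by (intro mult_left_mono) (auto simp: F_def)
    moreover have "real n * (cF * ?r) = cF * (real n * ?r)" by simp
    ultimately show ?thesis using 1 unfolding sq by simp
  qed
  have Nm[measurable]: "N y \<in> borel_measurable M" for y unfolding N_def by measurable
  let ?e = "cF * b * sqrt (real n)"
  have e: "0 < ?e" using assms pos by simp
  have P: "prob {\<omega> \<in> space M. ?e \<le> \<bar>N y \<omega>\<bar>} \<le> (2 * C / (1 - \<sigma>)) / (cF * b)\<^sup>2" if y: "\<bar>y - x0\<bar> < \<eta>" for y
  proof -
    have "prob {\<omega> \<in> space M. ?e \<le> \<bar>N y \<omega>\<bar>} \<le> (\<integral>\<omega>. (N y \<omega>)\<^sup>2 \<partial>M) / ?e\<^sup>2"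
      by (rule prob_deviation_le[OF Nm _ e]) (unfold N_def, rule integrable_sum_below(1), simp)
    also have "\<dots> \<le> (1\<^sup>2 * real (card ?P) * (2 * C / (1 - \<sigma>))) / ?e\<^sup>2"
      unfolding N_def by (intro divide_right_mono below_variance_bound[OF y]) auto
    also have "\<dots> = (2 * C / (1 - \<sigma>)) / (cF * b)\<^sup>2"
    proof -
      have "?e\<^sup>2 = real n * (cF * b)\<^sup>2"
        by (simp add: power_mult_distrib)
      moreover have "1\<^sup>2 * real (card ?P) = real n" by simp
      ultimately show ?thesis
        using \<open>n \<ge> 1\<close> by (simp only: mult_divide_mult_cancel_left_if) simp
    qed
    finally show ?thesis .
  qed
  have sub: "{\<omega> \<in> space M. ?r < \<bar>xihat n \<omega> - x0\<bar>} \<subseteq>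
      {\<omega> \<in> space M. ?e \<le> \<bar>N (x0 + ?r) \<omega>\<bar>} \<union> {\<omega> \<in> space M. ?e \<le> \<bar>N (x0 - ?r) \<omega>\<bar>}"
  proof
    fix \<omega> assume "\<omega> \<in> {\<omega> \<in> space M. ?r < \<bar>xihat n \<omega> - x0\<bar>}"
    then have "\<omega> \<in> space M" "x0 + ?r < xihat n \<omega> \<or> xihat n \<omega> < x0 - ?r" by auto
    then show "\<omega> \<in> {\<omega> \<in> space M. ?e \<le> \<bar>N (x0 + ?r) \<omega>\<bar>} \<union> {\<omega> \<in> space M. ?e \<le> \<bar>N (x0 - ?r) \<omega>\<bar>}"
      using up down by blast
  qed
  have "prob {\<omega> \<in> space M. ?r < \<bar>xihat n \<omega> - x0\<bar>} \<le>
      prob ({\<omega> \<in> space M. ?e \<le> \<bar>N (x0 + ?r) \<omega>\<bar>} \<union> {\<omega> \<in> space M. ?e \<le> \<bar>N (x0 - ?r) \<omega>\<bar>})"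
    by (intro finite_measure_mono sub) measurable
  also have "\<dots> \<le> prob {\<omega> \<in> space M. ?e \<le> \<bar>N (x0 + ?r) \<omega>\<bar>} + prob {\<omega> \<in> space M. ?e \<le> \<bar>N (x0 - ?r) \<omega>\<bar>}"
    by (intro measure_Un_le) measurable
  also have "\<dots> \<le> (2 * C / (1 - \<sigma>)) / (cF * b)\<^sup>2 + (2 * C / (1 - \<sigma>)) / (cF * b)\<^sup>2"
    using r small by (intro add_mono P) auto
  finally show ?thesis by simp
qed


text \<open>On the event that the empirical quantile is within \<open>M0 \<theta> / sqrt n\<close> of the true one, monotonicity of
  \<open>below\<close> sandwiches it between two neighbouring grid points of mesh \<open>\<theta> / sqrt n\<close>; the centring terms
  drop out because the weights sum to zero.\<close>

lemma weighted_below_grid_bound: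
  fixes x :: "int \<Rightarrow> real"
  assumes n: "n \<ge> 1" and \<theta>: "0 < \<theta>" and a: "\<And>t. \<bar>c t\<bar> \<le> K" and zero: "(\<Sum>t\<in>{1..int n}. c t) = 0"
    and near: "\<bar>z - x0\<bar> \<le> real M0 * (\<theta> / sqrt (real n))" and small: "(real M0 + 1) * (\<theta> / sqrt (real n)) < \<eta>"
  defines "g \<equiv> \<lambda>i::int. x0 + real_of_int i * (\<theta> / sqrt (real n))"
  defines "W \<equiv> \<lambda>d i. \<Sum>t\<in>{1..int n}. d t / sqrt (real n) * (below (g i) (x t) - below x0 (x t) - (F (g i) - F x0))"
  shows "\<bar>\<Sum>t\<in>{1..int n}. c t / sqrt (real n) * (below z (x t) - below x0 (x t))\<bar> \<le>
    (\<Sum>i\<in>{- int M0..int M0 + 1}. \<bar>W c i\<bar> + 2 * K * \<bar>W (\<lambda>_. 1) i\<bar>) + K * CF * \<theta>"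
proof -
  let ?P = "{1..int n}" and ?J = "{- int M0..int M0 + 1}" 
  define k where "k = \<theta> / sqrt (real n)"
  note near = near[folded k_def] and small = small[folded k_def] and g_def = g_def[folded k_def]
  have h: "0 < k" using n \<theta> by (simp add: k_def)
  have K0: "0 \<le> K" using a[of 0] by linarith
  define i where "i = \<lfloor>(z - x0) / k\<rfloor>"
  have gi: "g i \<le> z" "z \<le> g (i + 1)"
  proof -
    have "real_of_int i \<le> (z - x0) / k" "(z - x0) / k \<le> real_of_int (i + 1)" unfolding i_def by linarith+
    then have "real_of_int i * k \<le> z - x0" "z - x0 \<le> real_of_int (i + 1) * k"
      using h by (simp_all only: pos_le_divide_eq pos_divide_le_eq)
    then show "g i \<le> z" "z \<le> g (i + 1)" unfolding g_def by linarith+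
  qed
  have "\<bar>(z - x0) / k\<bar> \<le> real M0"
    using near h unfolding abs_divide by (simp add: pos_divide_le_eq)
  then have iJ: "- int M0 \<le> i" "i \<le> int M0" unfolding i_def by linarith+
  \<comment> \<open>As \<open>i\<close> may equal \<open>M0\<close>, its right neighbour requires
    the extra grid point \<open>M0 + 1\<close>.\<close>
  then have iJ': "i \<in> ?J" "i + 1 \<in> ?J" by auto
  have inner: "\<bar>g l - x0\<bar> < \<eta>" if "l \<in> {- int M0..int M0 + 1}" for l
  proof -
    have "\<bar>real_of_int l\<bar> \<le> real M0 + 1" using that by auto
    then have "\<bar>real_of_int l\<bar> * k \<le> (real M0 + 1) * k" using h by (intro mult_right_mono) auto
    moreover have "\<bar>g l - x0\<bar> = \<bar>real_of_int l\<bar> * k" using h by (simp add: g_def abs_mult)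
    ultimately show ?thesis using small by linarith
  qed
  have "(\<Sum>t\<in>?P. c t / sqrt (real n) * (below z (x t) - below x0 (x t))) =
     (\<Sum>t\<in>?P. c t / sqrt (real n) * (below (g i) (x t) - below x0 (x t) - (F (g i) - F x0))) +
     (\<Sum>t\<in>?P. c t / sqrt (real n) * (below z (x t) - below (g i) (x t))) + (\<Sum>t\<in>?P. c t / sqrt (real n) * (F (g i) - F x0))"
    unfolding sum.distrib[symmetric] distrib_left[symmetric] by simp
  moreover have "(\<Sum>t\<in>?P. c t / sqrt (real n) * (F (g i) - F x0)) = 0"
    using zero unfolding sum_distrib_right[symmetric] sum_divide_distrib[symmetric] by simp
  ultimately have eq: "(\<Sum>t\<in>?P. c t / sqrt (real n) * (below z (x t) - below x0 (x t))) =
     W c i + (\<Sum>t\<in>?P. c t / sqrt (real n) * (below z (x t) - below (g i) (x t)))"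
    by (simp only: W_def add_0_right)
  \<comment> \<open>Inside one grid cell only monotonicity is available. The signs of the weights
    are given up, and the remainder is dominated by an increment with constant weight, whose own
    drift survives as the mesh error \<open>K * CF * \<theta>\<close>.\<close>
  have "\<bar>\<Sum>t\<in>?P. c t / sqrt (real n) * (below z (x t) - below (g i) (x t))\<bar> \<le>
     (\<Sum>t\<in>?P. K / sqrt (real n) * (below (g (i + 1)) (x t) - below (g i) (x t)))"
  proof (rule order_trans[OF sum_abs], rule sum_mono)
    fix t
    have "0 \<le> below z (x t) - below (g i) (x t)" "below z (x t) - below (g i) (x t) \<le> below (g (i + 1)) (x t) - below (g i) (x t)"
      using below_mono[OF gi(1), of "x t"] below_mono[OF gi(2), of "x t"] by auto
    then show "\<bar>c t / sqrt (real n) * (below z (x t) - below (g i) (x t))\<bar> \<le> K / sqrt (real n) * (below (g (i + 1)) (x t) - below (g i) (x t))"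
      unfolding abs_mult using K0 by (intro mult_mono) (auto simp: a divide_right_mono)
  qed
  also have "\<dots> = K * (\<Sum>t\<in>?P. 1 / sqrt (real n) * ((below (g (i + 1)) (x t) - below x0 (x t) - (F (g (i + 1)) - F x0)) -
       (below (g i) (x t) - below x0 (x t) - (F (g i) - F x0)) + (F (g (i + 1)) - F (g i))))"
    by (simp add: sum_distrib_left)
  also have "\<dots> = K * (W (\<lambda>_. 1) (i + 1) - W (\<lambda>_. 1) i + (\<Sum>t\<in>?P. 1 / sqrt (real n) * (F (g (i + 1)) - F (g i))))"
    unfolding W_def sum.distrib[symmetric] sum_subtractf[symmetric]
    by (intro arg_cong2[where f = "(*)"] refl sum.cong) (simp add: algebra_simps)
  also have "(\<Sum>t\<in>?P. 1 / sqrt (real n) * (F (g (i + 1)) - F (g i))) = sqrt (real n) * (F (g (i + 1)) - F (g i))"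
    using real_div_sqrt[of "real n"] by (simp add: mult.commute flip: times_divide_eq_left)
  also have "\<dots> \<le> sqrt (real n) * (CF * k)"
  proof (rule mult_left_mono)
    have "F (g (i + 1)) - F (g i) \<le> CF * \<bar>g (i + 1) - g i\<bar>"
      using F_lipschitz[OF inner inner, OF iJ'(2,1)] unfolding F_def by linarith
    also have "g (i + 1) - g i = k" by (simp add: g_def algebra_simps)
    finally show "F (g (i + 1)) - F (g i) \<le> CF * k" using h by simp
  qed simp
  also have "sqrt (real n) * (CF * k) = CF * \<theta>" using n by (simp add: k_def)
  finally have B: "\<bar>\<Sum>t\<in>?P. c t / sqrt (real n) * (below z (x t) - below (g i) (x t))\<bar> \<le>
      K * (W (\<lambda>_. 1) (i + 1) - W (\<lambda>_. 1) i + CF * \<theta>)"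
    using K0 by (simp add: mult_left_mono)
  have S1: "\<bar>W c i\<bar> \<le> (\<Sum>i\<in>?J. \<bar>W c i\<bar>)"
    by (rule member_le_sum[OF iJ'(1)]) auto
  have S2: "\<bar>W (\<lambda>_. 1) j\<bar> \<le> (\<Sum>i\<in>?J. \<bar>W (\<lambda>_. 1) i\<bar>)" if "j \<in> ?J" for j
    by (rule member_le_sum[OF that]) auto
  have "K * (W (\<lambda>_. 1) (i + 1) - W (\<lambda>_. 1) i + CF * \<theta>) \<le> K * (2 * (\<Sum>i\<in>?J. \<bar>W (\<lambda>_. 1) i\<bar>) + CF * \<theta>)"
    using S2[OF iJ'(1)] S2[OF iJ'(2)] by (intro mult_left_mono K0) linarith
  then have "\<bar>\<Sum>t\<in>?P. c t / sqrt (real n) * (below z (x t) - below x0 (x t))\<bar> \<le>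
      (\<Sum>i\<in>?J. \<bar>W c i\<bar>) + K * (2 * (\<Sum>i\<in>?J. \<bar>W (\<lambda>_. 1) i\<bar>) + CF * \<theta>)"
    unfolding eq using B S1 by linarith
  then show ?thesis
    by (simp add: sum.distrib sum_distrib_left algebra_simps)
qed


end

context quantile_process
begin

text \<open>The order of the choices matters: \<open>\<theta>\<close> makes the mesh error small,
  then \<open>M0\<close> makes it improbable that the estimate leaves the grid, and only then does
  \<open>n\<close> grow, while finitely many increments tend to zero in mean.\<close>

lemma plug_in_negligible:
  fixes c :: "nat \<Rightarrow> int \<Rightarrow> real"
  assumes meas[measurable]: "\<And>n. xihat n \<in> borel_measurable M"
    and min: "\<And>n \<omega> x. \<omega> \<in> space M \<Longrightarrow>
       (\<Sum>t\<in>{1..int n}. rho tau (X t \<omega> - xihat n \<omega>)) \<le> (\<Sum>t\<in>{1..int n}. rho tau (X t \<omega> - x))"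
    and K: "\<And>n t. \<bar>c n t\<bar> \<le> K"
    and zero: "eventually (\<lambda>n. (\<Sum>t\<in>{1..int n}. c n t) = 0) sequentially"
  shows "(\<lambda>n. (\<integral>\<omega>. iexp (\<Sum>t\<in>{1..int n}. c n t / sqrt (real n) * Vfun tau (xihat n \<omega>) (X t \<omega>)) \<partial>M) -
     (\<integral>\<omega>. iexp (\<Sum>t\<in>{1..int n}. c n t / sqrt (real n) * Vfun tau x0 (X t \<omega>)) \<partial>M)) \<longlonglongrightarrow> 0"
proof (rule tendsto_norm_zero_cancel, rule LIMSEQ_I)
  fix e :: real assume "0 < e"
  let ?d = "\<lambda>n. (\<integral>\<omega>. iexp (\<Sum>t\<in>{1..int n}. c n t / sqrt (real n) * Vfun tau (xihat n \<omega>) (X t \<omega>)) \<partial>M) -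
     (\<integral>\<omega>. iexp (\<Sum>t\<in>{1..int n}. c n t / sqrt (real n) * Vfun tau x0 (X t \<omega>)) \<partial>M)"
  have V: "Vfun tau x y = tau - below x y" for x y by (simp add: Vfun_def below_def)
  have K0: "0 \<le> K" using K[of 0 0] by linarith
  have KCF: "0 \<le> K * CF" using K0 pos by simp
  \<comment> \<open>Adding 1 avoids a division by zero when \<open>K * CF = 0\<close>.\<close>
  define u where "u = K * CF + 1"
  have u: "0 < u" "K * CF \<le> u" unfolding u_def using KCF by linarith+
  define \<theta> where "\<theta> = e / (4 * u)"
  have \<theta>: "0 < \<theta>" unfolding \<theta>_def using \<open>0 < e\<close> u(1) by simp
  have \<theta>e: "K * CF * \<theta> < e / 2"
  proof -
    have "K * CF * \<theta> \<le> u * \<theta>" using \<theta> u(2) by (intro mult_right_mono) auto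
    also have "\<dots> = e / 4" unfolding \<theta>_def using u(1) by simp
    also have "\<dots> < e / 2" using \<open>0 < e\<close> by simp
    finally show ?thesis .
  qed
  define C1 where "C1 = 2 * (2 * C / (1 - \<sigma>))"
  have "(\<lambda>m::nat. 2 * (C1 / (cF * (real m * \<theta>))\<^sup>2)) \<longlonglongrightarrow> 0"
  proof -
    have "filterlim (\<lambda>m::nat. (cF * (real m * \<theta>))\<^sup>2) at_top sequentially"
      using pos \<theta> by real_asymp
    then have "(\<lambda>m::nat. C1 / (cF * (real m * \<theta>))\<^sup>2) \<longlonglongrightarrow> 0"
      by (intro tendsto_divide_0[OF tendsto_const] filterlim_at_top_imp_at_infinity)
    from tendsto_mult_right_zero[OF this] show ?thesis by simp
  qed
  then have "eventually (\<lambda>m::nat. 2 * (C1 / (cF * (real m * \<theta>))\<^sup>2) < e / 4 \<and> 1 \<le> m) sequentially"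
    using \<open>0 < e\<close> by (intro eventually_conj order_tendstoD(2) eventually_ge_at_top) auto
  then obtain M0 :: nat where M0: "2 * (C1 / (cF * (real M0 * \<theta>))\<^sup>2) < e / 4" "1 \<le> M0"
    by (auto simp: eventually_sequentially)
  let ?J = "{- int M0..int M0 + 1}" and ?P = "\<lambda>n. {1..int n}"
  define g where "g n i = x0 + real_of_int i * (\<theta> / sqrt (real n))" for n :: nat and i :: int
  define W where "W n d i \<omega> = (\<Sum>t\<in>?P n. d t / sqrt (real n) * (below (g n i) (X t \<omega>) - below x0 (X t \<omega>) - (F (g n i) - F x0)))"
    for n :: nat and d :: "int \<Rightarrow> real" and i \<omega>
  \<comment> \<open>Variance bound for a normalized increment at the farthest grid point; it is of
    order at most \<open>n^(-1/4)\<close>.\<close>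
  define v where "v n = 2 * (sqrt (CF * ((real M0 + 1) * (\<theta> / sqrt (real n)))) * (2 * C)) / (1 - \<sigma>)" for n :: nat
  have Wm[measurable]: "W n d i \<in> borel_measurable M" for n d i unfolding W_def by measurable
  have W2: "integrable M (\<lambda>\<omega>. (W n d i \<omega>)\<^sup>2)" for n d i
    unfolding W_def by (rule integrable_sum_below(2)) simp
  have W1: "integrable M (\<lambda>\<omega>. \<bar>W n d i \<omega>\<bar>)" for n d i
    using square_integrable_imp_integrable[OF Wm W2] by (rule integrable_abs)
  have EW: "(\<integral>\<omega>. \<bar>W n d i \<omega>\<bar> \<partial>M) \<le> B * sqrt (v n)"
    if n: "n \<ge> 1" and small: "(real M0 + 1) * (\<theta> / sqrt (real n)) < \<eta>" and d: "\<And>t. \<bar>d t\<bar> \<le> B" and i: "i \<in> ?J" for n d i B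
  proof -
    have B0: "0 \<le> B" using d[of 0] by linarith
    have h: "0 < \<theta> / sqrt (real n)" using n \<theta> by simp
    have "\<bar>real_of_int i\<bar> \<le> real M0 + 1" using i by auto
    then have "\<bar>real_of_int i\<bar> * (\<theta> / sqrt (real n)) \<le> (real M0 + 1) * (\<theta> / sqrt (real n))"
      using h by (intro mult_right_mono) auto
    moreover have "\<bar>g n i - x0\<bar> = \<bar>real_of_int i\<bar> * (\<theta> / sqrt (real n))"
      unfolding g_def by (simp only: add_diff_cancel_left' abs_mult abs_of_pos[OF h])
    ultimately have gle: "\<bar>g n i - x0\<bar> \<le> (real M0 + 1) * (\<theta> / sqrt (real n))" by linarith
    have "(\<integral>\<omega>. (W n d i \<omega>)\<^sup>2 \<partial>M) \<le> (B / sqrt (real n))\<^sup>2 * real (card (?P n)) * (2 * (sqrt (CF * \<bar>g n i - x0\<bar>) * (2 * C)) / (1 - \<sigma>))"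
      unfolding W_def
      by (rule below_increment_variance_bound) (use gle small pos d in \<open>auto simp: divide_right_mono\<close>)
    also have "\<dots> = B\<^sup>2 * (2 * (sqrt (CF * \<bar>g n i - x0\<bar>) * (2 * C)) / (1 - \<sigma>))"
      using n by (simp add: power_divide)
    also have "\<dots> \<le> B\<^sup>2 * v n"
      unfolding v_def using gle pos \<sigma>
      by (intro mult_left_mono divide_right_mono mult_right_mono real_sqrt_le_mono) auto
    finally have "sqrt (\<integral>\<omega>. (W n d i \<omega>)\<^sup>2 \<partial>M) \<le> sqrt (B\<^sup>2 * v n)" by (rule real_sqrt_le_mono)
    also have "\<dots> = B * sqrt (v n)" using B0 by (simp add: real_sqrt_mult)
    finally show ?thesis
      using expectation_abs_le_sqrt[OF Wm W2, of n d i] by linarith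
  qed
  define R where "R n \<omega> = (\<Sum>i\<in>?J. \<bar>W n (c n) i \<omega>\<bar> + 2 * K * \<bar>W n (\<lambda>_. 1) i \<omega>\<bar>)" for n \<omega>
  have Ri: "integrable M (R n)" for n
    unfolding R_def[abs_def] by (intro Bochner_Integration.integrable_sum Bochner_Integration.integrable_add integrable_mult_right W1)
  have ER: "(\<integral>\<omega>. R n \<omega> \<partial>M) \<le> real (card ?J) * (3 * K * sqrt (v n))"
    if n: "n \<ge> 1" and small: "(real M0 + 1) * (\<theta> / sqrt (real n)) < \<eta>" for n
  proof -
    have "(\<integral>\<omega>. R n \<omega> \<partial>M) = (\<Sum>i\<in>?J. (\<integral>\<omega>. \<bar>W n (c n) i \<omega>\<bar> \<partial>M) + 2 * K * (\<integral>\<omega>. \<bar>W n (\<lambda>_. 1) i \<omega>\<bar> \<partial>M))"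
      unfolding R_def using W1 by (simp add: Bochner_Integration.integral_sum)
    also have "\<dots> \<le> (\<Sum>i\<in>?J. K * sqrt (v n) + 2 * K * (1 * sqrt (v n)))"
      using K0 by (intro sum_mono add_mono mult_left_mono EW n small K) auto
    finally show ?thesis by (simp add: algebra_simps)
  qed
  have vlim: "(\<lambda>n. real (card ?J) * (3 * K * sqrt (v n))) \<longlonglongrightarrow> 0"
  proof -
    have "(\<lambda>n. \<theta> / sqrt (real n)) \<longlonglongrightarrow> 0" by real_asymp
    then have "(\<lambda>n. real (card ?J) * (3 * K * sqrt (v n))) \<longlonglongrightarrow> real (card ?J) * (3 * K * sqrt (2 * (sqrt (CF * ((real M0 + 1) * 0)) * (2 * C)) / (1 - \<sigma>)))"
      unfolding v_def using \<sigma> by (intro tendsto_intros) auto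
    then show ?thesis by simp
  qed
  have ev_small: "eventually (\<lambda>n. (real M0 + 1) * (\<theta> / sqrt (real n)) < \<eta>) sequentially"
  proof -
    have "(\<lambda>n. (real M0 + 1) * (\<theta> / sqrt (real n))) \<longlonglongrightarrow> 0" by real_asymp
    then show ?thesis using pos by (intro order_tendstoD(2)) auto
  qed
  have "eventually (\<lambda>n. real (card ?J) * (3 * K * sqrt (v n)) < e / 4) sequentially"
    by (rule order_tendstoD(2)[OF vlim]) (use \<open>0 < e\<close> in simp)
  with ev_small zero eventually_ge_at_top[of 1]
  have "eventually (\<lambda>n. norm (norm (?d n) - 0) < e) sequentially"
  proof eventually_elim
    case (elim n)
    note small = elim(1) and zero = elim(2) and n = elim(3)
    let ?r = "real M0 * (\<theta> / sqrt (real n))"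
    let ?A = "{\<omega> \<in> space M. ?r < \<bar>xihat n \<omega> - x0\<bar>}"
    define T' where "T' \<omega> = (\<Sum>t\<in>?P n. c n t / sqrt (real n) * Vfun tau (xihat n \<omega>) (X t \<omega>))" for \<omega>
    define T where "T \<omega> = (\<Sum>t\<in>?P n. c n t / sqrt (real n) * Vfun tau x0 (X t \<omega>))" for \<omega>
    have [measurable]: "T' \<in> borel_measurable M" "T \<in> borel_measurable M"
      unfolding T'_def T_def Vfun_def by measurable
    have A[measurable]: "?A \<in> sets M" by measurable
    have PA: "prob ?A \<le> C1 / (cF * (real M0 * \<theta>))\<^sup>2"
    proof -
      have "0 < \<theta> / sqrt (real n)" using n \<theta> by simp
      then have "real M0 * \<theta> / sqrt (real n) < \<eta>"
        using small unfolding distrib_right by (simp only: times_divide_eq_right mult_1)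
      then show ?thesis
        using root_n_consistent[OF meas min, of "real M0 * \<theta>" n] n \<theta> M0(2) by (simp add: C1_def)
    qed
    \<comment> \<open>The grid bound applies while the estimate stays on the grid; otherwise two
      numbers of modulus one differ by at most 2.\<close>
    have pt: "cmod (iexp (T' \<omega>) - iexp (T \<omega>)) \<le> R n \<omega> + K * CF * \<theta> + 2 * indicator ?A \<omega>" if "\<omega> \<in> space M" for \<omega>
    proof (cases "\<omega> \<in> ?A")
      case True
      have "cmod (iexp (T' \<omega>) - iexp (T \<omega>)) \<le> 1 + 1"
        by (rule order_trans[OF norm_triangle_ineq4]) simp
      moreover have "0 \<le> R n \<omega>" unfolding R_def using K0 by (intro sum_nonneg) auto
      moreover have "0 \<le> K * CF * \<theta>" using KCF \<theta> by simp
      ultimately show ?thesis using True by simp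
    next
      case False
      then have near: "\<bar>xihat n \<omega> - x0\<bar> \<le> ?r" using that by auto
      have "T' \<omega> - T \<omega> = - (\<Sum>t\<in>?P n. c n t / sqrt (real n) * (below (xihat n \<omega>) (X t \<omega>) - below x0 (X t \<omega>)))"
        unfolding T'_def T_def V sum_subtractf[symmetric] sum_negf[symmetric]
        by (intro sum.cong refl) (simp only: mult_minus_right[symmetric] right_diff_distrib[symmetric], simp)
      then have "\<bar>T' \<omega> - T \<omega>\<bar> = \<bar>\<Sum>t\<in>?P n. c n t / sqrt (real n) * (below (xihat n \<omega>) (X t \<omega>) - below x0 (X t \<omega>))\<bar>"
        by simp
      also have "\<dots> \<le> R n \<omega> + K * CF * \<theta>"
        unfolding R_def W_def g_def by (rule weighted_below_grid_bound[OF n \<theta> K zero near small])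
      finally show ?thesis
        using norm_iexp_diff_le[of "T' \<omega>" "T \<omega>"] False by simp
    qed
    have i: "integrable M (\<lambda>\<omega>. iexp (T' \<omega>))" "integrable M (\<lambda>\<omega>. iexp (T \<omega>))"
      by (rule integrable_bounded[where B = 1]; simp)+
    have iA: "integrable M (indicator ?A :: _ \<Rightarrow> real)"
      by (rule integrable_bounded[where B = 1]) (auto simp: indicator_def)
    have "cmod ((\<integral>\<omega>. iexp (T' \<omega>) \<partial>M) - (\<integral>\<omega>. iexp (T \<omega>) \<partial>M)) = cmod (\<integral>\<omega>. iexp (T' \<omega>) - iexp (T \<omega>) \<partial>M)"
      using i by simp
    also have "\<dots> \<le> (\<integral>\<omega>. R n \<omega> + K * CF * \<theta> + 2 * indicator ?A \<omega> \<partial>M)"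
      using i Ri iA by (intro norm_integral_le_integral pt) auto
    also have "\<dots> = (\<integral>\<omega>. R n \<omega> \<partial>M) + K * CF * \<theta> + 2 * prob ?A"
      using Ri iA by (simp add: prob_space)
    \<comment> \<open>Budget: \<open>e / 4\<close> from the increments, \<open>e / 2\<close> from
      the mesh, \<open>e / 4\<close> from twice the exceptional probability.\<close>
    also have "\<dots> < e"
      using ER[OF n small] elim(4) \<theta>e PA M0(1) by linarith
    finally show ?case unfolding T'_def T_def by simp
  qed
  then show "\<exists>no. \<forall>n\<ge>no. norm (norm (?d n) - 0) < e"
    by (simp add: eventually_sequentially)
qed

end

section \<open>Gaussian linearization and Laplace transforms\<close>

text \<open>The integrand times the standard normal density is \<open>1 / sqrt (1 + s)\<close> times
  the centred normal density with variance \<open>1 / (1 + s)\<close>.\<close>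

lemma integral_std_normal_exp_square:
  assumes "0 \<le> (s::real)"
  shows "(\<integral>y. exp (- (s * y\<^sup>2 / 2)) \<partial>std_normal_distribution) = 1 / sqrt (1 + s)"
proof -
  have s: "0 < 1 + s" using assms by simp
  have "(\<integral>y. exp (- (s * y\<^sup>2 / 2)) \<partial>std_normal_distribution) = (\<integral>y. std_normal_density y * exp (- (s * y\<^sup>2 / 2)) \<partial>lborel)"
    by (subst integral_density) auto
  also have "\<dots> = (\<integral>y. 1 / sqrt (1 + s) * normal_density 0 (1 / sqrt (1 + s)) y \<partial>lborel)"
  proof (intro Bochner_Integration.integral_cong refl)
    fix y :: real
    have "normal_density 0 (1 / sqrt (1 + s)) y = sqrt (1 + s) / sqrt (2 * pi) * exp (- ((1 + s) * y\<^sup>2 / 2))"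
      unfolding normal_density_def using s
      by (simp add: power_divide real_sqrt_divide mult_ac)
    then have "1 / sqrt (1 + s) * normal_density 0 (1 / sqrt (1 + s)) y = 1 / sqrt (2 * pi) * exp (- ((1 + s) * y\<^sup>2 / 2))"
      using s by simp
    also have "exp (- ((1 + s) * y\<^sup>2 / 2)) = exp (- y\<^sup>2 / 2) * exp (- (s * y\<^sup>2 / 2))"
      unfolding exp_add[symmetric] by (rule arg_cong[where f = exp]) (simp add: field_simps)
    finally show "std_normal_density y * exp (- (s * y\<^sup>2 / 2)) = 1 / sqrt (1 + s) * normal_density 0 (1 / sqrt (1 + s)) y"
      by (simp add: std_normal_density_def)
  qed
  also have "\<dots> = 1 / sqrt (1 + s)" using s by (simp del: divide_divide_eq_right)
  finally show ?thesis .
qed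

text \<open>Exponential tilting turns the density with rate \<open>l\<close> into
  \<open>l / (l + m)\<close> times the one with rate \<open>l + m\<close>.\<close>

lemma integral_exponential_laplace:
  assumes "0 < l" "0 \<le> (m::real)"
  shows "(\<integral>x. exp (- (m * x)) \<partial>density lborel (exponential_density l)) = l / (l + m)"
proof -
  have lm: "0 < l + m" using assms by simp
  interpret E: prob_space "density lborel (exponential_density (l + m))"
    using lm by (rule prob_space_exponential_density)
  have nn: "0 \<le> exponential_density (l + m) x" "0 \<le> exponential_density l x" for x
    using assms lm by (auto simp: exponential_density_def)
  have 1: "(\<integral>x. exponential_density (l + m) x \<partial>lborel) = 1"
    using integral_density[of "\<lambda>_. 1 :: real" lborel "exponential_density (l + m)"] nn E.prob_space by simp
  have "(\<integral>x. exp (- (m * x)) \<partial>density lborel (exponential_density l)) = (\<integral>x. exponential_density l x * exp (- (m * x)) \<partial>lborel)"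
    using nn by (subst integral_density) auto
  also have "\<dots> = (\<integral>x. l / (l + m) * exponential_density (l + m) x \<partial>lborel)"
  proof (intro Bochner_Integration.integral_cong refl)
    fix x :: real
    have "exp (- (x * l)) * exp (- (m * x)) = exp (- (x * (l + m)))"
      unfolding exp_add[symmetric] by (rule arg_cong[where f = exp]) (simp add: algebra_simps)
    then show "exponential_density l x * exp (- (m * x)) = l / (l + m) * exponential_density (l + m) x"
      using lm by (simp add: exponential_density_def)
  qed
  also have "\<dots> = l / (l + m)" using 1 by simp
  finally show ?thesis .
qed

text \<open>Averaging the characteristic function of a random vector over independent standard normal
  arguments yields the Laplace transform of the squares of its components.\<close>

lemma gaussian_linearization_limit:
  fixes T :: "nat \<Rightarrow> 'i \<Rightarrow> 'a \<Rightarrow> real"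
  assumes "prob_space M" and "finite J" and T[measurable]: "\<And>n i. i \<in> J \<Longrightarrow> T n i \<in> borel_measurable M"
    and s: "\<And>i. i \<in> J \<Longrightarrow> 0 \<le> s i"
    and lim: "\<And>x :: 'i \<Rightarrow> real. (\<lambda>n. \<integral>\<omega>. iexp (\<Sum>i\<in>J. x i * T n i \<omega>) \<partial>M) \<longlonglongrightarrow> complex_of_real (exp (- (\<Sum>i\<in>J. s i * (x i)\<^sup>2) / 2))"
  shows "(\<lambda>n. \<integral>\<omega>. exp (- (\<Sum>i\<in>J. (T n i \<omega>)\<^sup>2) / 2) \<partial>M) \<longlonglongrightarrow> (\<Prod>i\<in>J. 1 / sqrt (1 + s i))"
proof -
  interpret M: prob_space M by fact
  let ?N = "std_normal_distribution"
  interpret N: real_distribution ?N by (rule real_dist_normal_dist)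
  interpret product_sigma_finite "\<lambda>_::'i. ?N"
    by (intro product_sigma_finite.intro N.sigma_finite_measure_axioms)
  let ?P = "PiM J (\<lambda>_. ?N)"
  interpret P: prob_space ?P
    by (intro prob_space_PiM N.prob_space_axioms)
  interpret MP: pair_prob_space M ?P ..
  let ?f = "\<lambda>n \<omega> x. iexp (\<Sum>i\<in>J. x i * T n i \<omega>)"
  have comp[measurable]: "(\<lambda>x. x i) \<in> borel_measurable ?P" if "i \<in> J" for i
    using measurable_component_singleton[OF that, of "\<lambda>_. ?N"] by simp
  have fm[measurable]: "(\<lambda>(\<omega>, x). ?f n \<omega> x) \<in> borel_measurable (M \<Otimes>\<^sub>M ?P)" for n
  proof -
    have "(\<lambda>p. \<Sum>i\<in>J. snd p i * T n i (fst p)) \<in> borel_measurable (M \<Otimes>\<^sub>M ?P)"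
      by (intro borel_measurable_sum borel_measurable_times measurable_compose[OF measurable_snd comp]
            measurable_compose[OF measurable_fst T])
    then show ?thesis by (simp add: case_prod_beta)
  qed
  have inner: "(\<integral>x. ?f n \<omega> x \<partial>?P) = complex_of_real (exp (- (\<Sum>i\<in>J. (T n i \<omega>)\<^sup>2) / 2))" for n \<omega>
  proof -
    have "(\<integral>x. ?f n \<omega> x \<partial>?P) = (\<integral>x. (\<Prod>i\<in>J. iexp (T n i \<omega> * x i)) \<partial>?P)"
      using \<open>finite J\<close> by (simp add: exp_sum sum_distrib_left mult.commute)
    also have "\<dots> = (\<Prod>i\<in>J. \<integral>y. iexp (T n i \<omega> * y) \<partial>?N)"
      by (rule product_integral_prod[OF \<open>finite J\<close>]) (auto intro!: N.integrable_const_bound[where B = 1])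
    also have "\<dots> = (\<Prod>i\<in>J. complex_of_real (exp (- (T n i \<omega>)\<^sup>2 / 2)))"
      using char_std_normal_distribution by (simp add: char_def fun_eq_iff)
    also have "\<dots> = complex_of_real (exp (- (\<Sum>i\<in>J. (T n i \<omega>)\<^sup>2) / 2))"
      unfolding of_real_prod[symmetric] exp_sum[OF \<open>finite J\<close>, symmetric]
      by (simp only: sum_divide_distrib[symmetric] sum_negf)
    finally show ?thesis .
  qed
  have swap: "complex_of_real (\<integral>\<omega>. exp (- (\<Sum>i\<in>J. (T n i \<omega>)\<^sup>2) / 2) \<partial>M) = (\<integral>x. (\<integral>\<omega>. ?f n \<omega> x \<partial>M) \<partial>?P)" for n
  proof -
    have int: "integrable (M \<Otimes>\<^sub>M ?P) (\<lambda>(\<omega>, x). ?f n \<omega> x)"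
      by (rule MP.integrable_const_bound[where B = 1]) (auto simp: fm)
    show ?thesis
      unfolding MP.Fubini_integral[OF int] inner by simp
  qed
  \<comment> \<open>Convergence is given for each fixed \<open>x\<close>; the bound 1 on
    characteristic functions permits passing to the limit under the Gaussian average.\<close>
  have "(\<lambda>n. \<integral>x. (\<integral>\<omega>. ?f n \<omega> x \<partial>M) \<partial>?P) \<longlonglongrightarrow> (\<integral>x. complex_of_real (exp (- (\<Sum>i\<in>J. s i * (x i)\<^sup>2) / 2)) \<partial>?P)"
  proof (rule integral_dominated_convergence[where w = "\<lambda>_. 1"])
    have [measurable]: "(\<lambda>(x, \<omega>). ?f n \<omega> x) \<in> borel_measurable (?P \<Otimes>\<^sub>M M)" for n
      using measurable_compose[OF measurable_pair_swap' fm[of n]] by (simp add: case_prod_beta)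
    show "(\<lambda>x. \<integral>\<omega>. ?f n \<omega> x \<partial>M) \<in> borel_measurable ?P" for n
      by (rule M.borel_measurable_lebesgue_integral) simp
    show "(\<lambda>x. complex_of_real (exp (- (\<Sum>i\<in>J. s i * (x i)\<^sup>2) / 2))) \<in> borel_measurable ?P"
      by measurable
    show "AE x in ?P. (\<lambda>n. \<integral>\<omega>. ?f n \<omega> x \<partial>M) \<longlonglongrightarrow> complex_of_real (exp (- (\<Sum>i\<in>J. s i * (x i)\<^sup>2) / 2))"
      using lim by simp
    show "AE x in ?P. cmod (\<integral>\<omega>. ?f n \<omega> x \<partial>M) \<le> 1" for n
    proof (rule AE_I2)
      fix x
      have "(\<lambda>\<omega>. ?f n \<omega> x) \<in> borel_measurable M" by measurable
      then have "integrable M (\<lambda>\<omega>. ?f n \<omega> x)" by (intro M.integrable_const_bound[where B = 1]) auto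
      then show "cmod (\<integral>\<omega>. ?f n \<omega> x \<partial>M) \<le> 1"
        using norm_integral_le_integral[of M "\<lambda>\<omega>. ?f n \<omega> x" "\<lambda>_. 1"] by (simp add: M.prob_space)
    qed
  qed simp
  moreover have "(\<integral>x. complex_of_real (exp (- (\<Sum>i\<in>J. s i * (x i)\<^sup>2) / 2)) \<partial>?P) = complex_of_real (\<Prod>i\<in>J. 1 / sqrt (1 + s i))"
  proof -
    have "(\<integral>x. exp (- (\<Sum>i\<in>J. s i * (x i)\<^sup>2) / 2) \<partial>?P) = (\<integral>x. (\<Prod>i\<in>J. exp (- (s i * (x i)\<^sup>2 / 2))) \<partial>?P)"
      unfolding exp_sum[OF \<open>finite J\<close>, symmetric] by (simp add: sum_divide_distrib sum_negf)
    also have "\<dots> = (\<Prod>i\<in>J. \<integral>y. exp (- (s i * y\<^sup>2 / 2)) \<partial>?N)"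
      by (rule product_integral_prod[OF \<open>finite J\<close>]) (auto intro!: N.integrable_const_bound[where B = 1] simp: s)
    also have "\<dots> = (\<Prod>i\<in>J. 1 / sqrt (1 + s i))"
      by (intro prod.cong refl integral_std_normal_exp_square s)
    finally show ?thesis by (simp only: integral_complex_of_real)
  qed
  ultimately have "(\<lambda>n. complex_of_real (\<integral>\<omega>. exp (- (\<Sum>i\<in>J. (T n i \<omega>)\<^sup>2) / 2) \<partial>M)) \<longlonglongrightarrow> complex_of_real (\<Prod>i\<in>J. 1 / sqrt (1 + s i))"
    by (simp only: swap)
  then show ?thesis by (simp only: tendsto_of_real_iff)
qed

context quantile_process
begin

text \<open>\<open>Vfun tau x0\<close> is \<open>tau - below x0\<close>; neither the constant nor
  the sign changes the coupling distance.\<close>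

lemma mixing_functional_Vfun: "mixing_functional M N eps Y (Vfun tau x0) C \<sigma>"
proof unfold_locales
  have V: "Vfun tau x0 = (\<lambda>y. tau - below x0 y)" by (auto simp: Vfun_def below_def)
  have tau: "0 \<le> tau" "tau \<le> 1" using F_bounds[of x0] F_x0 by (simp_all add: F_def)
  show "Vfun tau x0 \<in> borel_measurable borel" unfolding V by measurable
  show "\<bar>Vfun tau x0 y\<bar> \<le> 1" for y
    using tau below_bounds[of x0 y] unfolding V by linarith
  show "(\<integral>\<omega>. Vfun tau x0 (X 0 \<omega>) \<partial>M) = 0"
    unfolding V using integrable_below[of x0 0] F_x0 by (simp add: prob_space)
  show "coup_dist (Vfun tau x0) (int n) \<le> C * \<sigma> ^ n" for n
  proof -
    have "coup_dist (Vfun tau x0) (int n) = coup_dist (below x0) (int n)"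
      unfolding coup_dist_def V by (simp add: power2_commute)
    then show ?thesis using coup_below[of x0 n] pos by simp
  qed
qed (rule \<sigma>)+

text \<open>The plug-in error is removed at the level of characteristic functions. The 4 in the
  exponent combines the 2 of the averaged squared cosine with the 2 of the Gaussian
  exponent.\<close>

lemma char_limit:
  fixes jn :: "nat \<Rightarrow> int" and z :: "int \<Rightarrow> complex"
  assumes meas: "\<And>n. xihat n \<in> borel_measurable M"
    and min: "\<And>n \<omega> x. \<omega> \<in> space M \<Longrightarrow>
       (\<Sum>t\<in>{1..int n}. rho tau (X t \<omega> - xihat n \<omega>)) \<le> (\<Sum>t\<in>{1..int n}. rho tau (X t \<omega> - x))"
    and fin: "finite I" and lim: "(\<lambda>n. 2 * pi * real_of_int (jn n) / real n) \<longlonglongrightarrow> lam"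
    and lam: "0 < lam" "lam < pi"
  shows "(\<lambda>n. \<integral>\<omega>. iexp (\<Sum>t\<in>{1..int n}. trigw I z (jn n) n t / sqrt (real n) * Vfun tau (xihat n \<omega>) (X t \<omega>)) \<partial>M)
    \<longlonglongrightarrow> complex_of_real (exp (- ((\<Sum>j\<in>I. (cmod (z j))\<^sup>2) *
        (\<Sum>\<^sub>\<infinity>u. (\<integral>\<omega>. Vfun tau x0 (X 0 \<omega>) * Vfun tau x0 (X u \<omega>) \<partial>M) * cos (real_of_int u * lam)) / 4)))"
proof -
  interpret V: mixing_functional M N eps Y "Vfun tau x0" C \<sigma>
    by (rule mixing_functional_Vfun)
  let ?G = "\<Sum>\<^sub>\<infinity>u. (\<integral>\<omega>. Vfun tau x0 (X 0 \<omega>) * Vfun tau x0 (X u \<omega>) \<partial>M) * cos (real_of_int u * lam)"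
  have 1: "(\<lambda>n. \<integral>\<omega>. (V.lin (\<lambda>t. trigw I z (jn n) n t / sqrt (real n)) {1..int n} \<omega>)\<^sup>2 \<partial>M) \<longlonglongrightarrow> (\<Sum>j\<in>I. (cmod (z j))\<^sup>2) / 2 * ?G"
    using V.trig_variance_limit[OF fin lim lam, of z] unfolding V.acov_def .
  have 2: "(\<lambda>n. \<integral>\<omega>. iexp (V.lin (\<lambda>t. trigw I z (jn n) n t / sqrt (real n)) {1..int n} \<omega>) \<partial>M) \<longlonglongrightarrow> complex_of_real (exp (- ((\<Sum>j\<in>I. (cmod (z j))\<^sup>2) / 2 * ?G / 2)))"
    by (rule V.block_clt[OF trigw_bound 1])
  have 3: "(\<lambda>n. (\<integral>\<omega>. iexp (\<Sum>t\<in>{1..int n}. trigw I z (jn n) n t / sqrt (real n) * Vfun tau (xihat n \<omega>) (X t \<omega>)) \<partial>M) -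
     (\<integral>\<omega>. iexp (\<Sum>t\<in>{1..int n}. trigw I z (jn n) n t / sqrt (real n) * Vfun tau x0 (X t \<omega>)) \<partial>M)) \<longlonglongrightarrow> 0"
  proof (rule plug_in_negligible[OF meas min trigw_bound])
    show "eventually (\<lambda>n. (\<Sum>t\<in>{1..int n}. trigw I z (jn n) n t) = 0) sequentially"
      using fourier_frequencies_nondegenerate[OF fin lim lam]
    proof eventually_elim
      case (elim n)
      then show ?case unfolding sum_int_interval by (intro sum_trigw) auto
    qed
  qed
  from tendsto_add[OF 3 2[unfolded V.lin_def]] show ?thesis by (simp add: mult_ac)
qed

end

section \<open>Weak convergence from Laplace transforms\<close>

lemma integrable_continuous_on_compact_support:
  fixes g :: "'b::topological_space \<Rightarrow> real"
  assumes "prob_space P" and sets: "sets P = sets borel" and "compact S" and AE: "AE x in P. x \<in> S"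
    and g: "continuous_on UNIV g"
  shows "integrable P g"
proof -
  interpret prob_space P by fact
  have "bounded (g ` S)"
    using \<open>compact S\<close> g continuous_on_subset compact_continuous_image compact_imp_bounded by blast
  then obtain B where B: "\<And>x. x \<in> S \<Longrightarrow> norm (g x) \<le> B"
    unfolding bounded_iff by auto
  show ?thesis
  proof (rule integrable_const_bound[where B = B])
    show "AE x in P. norm (g x) \<le> B"
      using AE B by auto
    show "g \<in> borel_measurable P"
      using borel_measurable_continuous_onI[OF g] sets by (simp cong: measurable_cong_sets)
  qed
qed

text \<open>Coordinates outside \<open>I\<close> are pinned to 0. The cube is then compact in the
  full function space by Tychonoff, and its points can differ only in coordinates from
  \<open>I\<close>.\<close>

lemma compact_cube_fun:
  fixes I :: "'i set"
  shows "compact {x :: 'i \<Rightarrow> real. \<forall>i. x i \<in> (if i \<in> I then {0..1} else {0})}" 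
proof -
  let ?S = "\<lambda>i. if i \<in> I then {0..1::real} else {0}"
  have "compactin (product_topology (\<lambda>_. euclidean) UNIV) (PiE UNIV ?S)"
    unfolding compactin_PiE by auto
  moreover have "{x. \<forall>i. x i \<in> ?S i} = PiE UNIV ?S"
    by (auto simp: PiE_def Pi_def)
  ultimately show ?thesis
    by (metis compactin_euclidean_iff euclidean_product_topology)
qed

text \<open>Coordinates from \<open>I\<close> separate the points of the cube, so Stone-Weierstrass
  approximates \<open>g\<close> uniformly there; as all measures are carried by the cube, the
  approximation passes to the integrals.\<close>

lemma moments_imp_weak_conv_cube:
  fixes P :: "nat \<Rightarrow> ('i::countable \<Rightarrow> real) measure" and P' :: "('i \<Rightarrow> real) measure"
    and I :: "'i set"
  defines "S \<equiv> {x. \<forall>i. x i \<in> (if i \<in> I then {0..1} else {0})}"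
  assumes "finite I"
    and prob: "\<And>n. prob_space (P n)" "prob_space P'"
    and sets: "\<And>n. sets (P n) = sets borel" "sets P' = sets borel"
    and AE: "\<And>n. AE x in P n. x \<in> S" "AE x in P'. x \<in> S"
    and mom: "\<And>m :: 'i \<Rightarrow> nat. (\<lambda>n. \<integral>x. (\<Prod>i\<in>I. x i ^ m i) \<partial>P n) \<longlonglongrightarrow> (\<integral>x. (\<Prod>i\<in>I. x i ^ m i) \<partial>P')"
    and g: "continuous_on UNIV g"
  shows "(\<lambda>n. \<integral>x. g x \<partial>P n) \<longlonglongrightarrow> (\<integral>x. (g x :: real) \<partial>P')"
proof -
  have S: "compact S" unfolding S_def by (rule compact_cube_fun)
  have int: "integrable (P n) f" "integrable P' f" if "continuous_on UNIV f" for f :: "_ \<Rightarrow> real" and n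
    using integrable_continuous_on_compact_support[OF prob(1) sets(1) S AE(1) that]
      integrable_continuous_on_compact_support[OF prob(2) sets(2) S AE(2) that] by auto
  have cont_coord[continuous_intros]: "continuous_on UNIV (\<lambda>x::'i \<Rightarrow> real. x i)" for i :: 'i
    by simp
  have cont_prod[continuous_intros]: "continuous_on UNIV (\<lambda>x::'i \<Rightarrow> real. \<Prod>i\<in>I. x i ^ m i)" for m :: "'i \<Rightarrow> nat"
    by (intro continuous_on_prod continuous_on_power cont_coord)
  \<comment> \<open>Testing against every monomial makes the property stable under multiplication by
    a coordinate, which merely raises one exponent.\<close>
  define Good where "Good q \<longleftrightarrow> continuous_on UNIV q \<and> (\<forall>m :: 'i \<Rightarrow> nat.
     (\<lambda>n. \<integral>x. q x * (\<Prod>i\<in>I. x i ^ m i) \<partial>P n) \<longlonglongrightarrow> (\<integral>x. q x * (\<Prod>i\<in>I. x i ^ m i) \<partial>P'))" for q :: "('i \<Rightarrow> real) \<Rightarrow> real"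
  \<comment> \<open>Demanding stability under multiplication makes \<open>R\<close> a ring without describing its elements.\<close>
  define R where "R = {p. \<forall>q. Good q \<longrightarrow> Good (\<lambda>x. p x * q x)}"
  have Good1: "Good (\<lambda>_. 1)"
    unfolding Good_def using mom by simp
  have R_Good: "Good p" if "p \<in> R" for p
    using that Good1 unfolding R_def by fastforce
  interpret R: function_ring_on R S
  proof
    show "compact S" by fact
    show "continuous_on S f" if "f \<in> R" for f
      using R_Good[OF that] continuous_on_subset unfolding Good_def by blast
    show "(\<lambda>x. f x + h x) \<in> R" if "f \<in> R" "h \<in> R" for f h
      unfolding R_def
    proof (intro CollectI allI impI)
      fix q assume q: "Good q"
      have 1: "Good (\<lambda>x. f x * q x)" "Good (\<lambda>x. h x * q x)"
        using that q by (auto simp: R_def)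
      show "Good (\<lambda>x. (f x + h x) * q x)"
        unfolding Good_def
      proof (intro conjI allI)
        show "continuous_on UNIV (\<lambda>x. (f x + h x) * q x)"
          using 1 by (auto simp: Good_def distrib_right intro!: continuous_on_add)
        fix m :: "'i \<Rightarrow> nat"
        let ?p = "\<lambda>x. \<Prod>i\<in>I. x i ^ m i"
        have c: "continuous_on UNIV (\<lambda>x. f x * q x * ?p x)" "continuous_on UNIV (\<lambda>x. h x * q x * ?p x)"
          using 1 by (auto simp: Good_def intro!: continuous_on_mult cont_prod)
        have "(\<lambda>n. (\<integral>x. f x * q x * ?p x \<partial>P n) + (\<integral>x. h x * q x * ?p x \<partial>P n)) \<longlonglongrightarrow>
           (\<integral>x. f x * q x * ?p x \<partial>P') + (\<integral>x. h x * q x * ?p x \<partial>P')"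
          using 1 by (auto simp: Good_def intro!: tendsto_add)
        then show "(\<lambda>n. \<integral>x. (f x + h x) * q x * ?p x \<partial>P n) \<longlonglongrightarrow> (\<integral>x. (f x + h x) * q x * ?p x \<partial>P')"
          using int[OF c(1)] int[OF c(2)] by (simp add: distrib_right)
      qed
    qed
    show "(\<lambda>x. f x * h x) \<in> R" if "f \<in> R" "h \<in> R" for f h
      using that by (simp add: R_def mult.assoc)
    show "(\<lambda>_. c) \<in> R" for c
      unfolding R_def Good_def by (auto simp: mult.assoc intro!: continuous_intros tendsto_mult)
    have coord: "(\<lambda>x. x i) \<in> R" if "i \<in> I" for i
      unfolding R_def
    proof (intro CollectI allI impI)
      fix q assume q: "Good q"
      show "Good (\<lambda>x. x i * q x)"
        unfolding Good_def
      proof (intro conjI allI)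
        show "continuous_on UNIV (\<lambda>x. x i * q x)"
          using q by (auto simp: Good_def intro!: continuous_on_mult)
        fix m :: "'i \<Rightarrow> nat"
        have "(\<Prod>j\<in>I - {i}. x j ^ (m(i := Suc (m i))) j) = (\<Prod>j\<in>I - {i}. x j ^ m j)" for x :: "'i \<Rightarrow> real"
          by (intro prod.cong) auto
        then have "(\<Prod>j\<in>I. x j ^ (m(i := Suc (m i))) j) = x i * (\<Prod>j\<in>I. x j ^ m j)" for x :: "'i \<Rightarrow> real"
          by (simp add: prod.remove[OF \<open>finite I\<close> that] mult.assoc)
        then have "x i * q x * (\<Prod>j\<in>I. x j ^ m j) = q x * (\<Prod>j\<in>I. x j ^ (m(i := Suc (m i))) j)" for x
          by (simp add: mult_ac)
        then show "(\<lambda>n. \<integral>x. x i * q x * (\<Prod>j\<in>I. x j ^ m j) \<partial>P n) \<longlonglongrightarrow> (\<integral>x. x i * q x * (\<Prod>j\<in>I. x j ^ m j) \<partial>P')"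
          using q unfolding Good_def by (simp only:)
      qed
    qed
    show "\<exists>f\<in>R. f x \<noteq> f y" if "x \<in> S" "y \<in> S" "x \<noteq> y" for x y
    proof -
      obtain i where i: "x i \<noteq> y i" using \<open>x \<noteq> y\<close> by auto
      then have "i \<in> I" using that by (force simp: S_def split: if_splits)
      show ?thesis
        using coord[OF \<open>i \<in> I\<close>] i by (intro bexI[of _ "\<lambda>x. x i"]) auto
    qed
  qed
  show ?thesis
  proof (rule LIMSEQ_I)
    fix e :: real assume "0 < e"
    obtain p where p: "p \<in> R" "\<And>x. x \<in> S \<Longrightarrow> \<bar>g x - p x\<bar> < e / 3"
      using R.Stone_Weierstrass_basic[of g "e/3"] continuous_on_subset[OF g] \<open>0 < e\<close> by auto
    have cp: "continuous_on UNIV p" and lim: "(\<lambda>n. \<integral>x. p x \<partial>P n) \<longlonglongrightarrow> (\<integral>x. p x \<partial>P')"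
      using R_Good[OF p(1)] unfolding Good_def by (auto dest: spec[of _ "\<lambda>_. 0"])
    have close: "\<bar>(\<integral>x. g x \<partial>Q) - (\<integral>x. p x \<partial>Q)\<bar> \<le> e / 3"
      if "prob_space Q" "integrable Q g" "integrable Q p" "AE x in Q. x \<in> S" for Q
    proof -
      interpret prob_space Q by fact
      have "\<bar>(\<integral>x. g x \<partial>Q) - (\<integral>x. p x \<partial>Q)\<bar> = \<bar>\<integral>x. g x - p x \<partial>Q\<bar>"
        using that by simp
      also have "\<dots> \<le> (\<integral>x. \<bar>g x - p x\<bar> \<partial>Q)"
        by (rule integral_abs_bound)
      also have "\<dots> \<le> (\<integral>x. e / 3 \<partial>Q)"
        using that(2-4) p(2) by (intro integral_mono_AE) (auto elim!: eventually_mono simp: less_imp_le)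
      finally show ?thesis by (simp add: prob_space)
    qed
    obtain N where N: "\<And>n. n \<ge> N \<Longrightarrow> \<bar>(\<integral>x. p x \<partial>P n) - (\<integral>x. p x \<partial>P')\<bar> < e / 3"
      using LIMSEQ_D[OF lim, of "e/3"] \<open>0 < e\<close> by auto
    have "norm ((\<integral>x. g x \<partial>P n) - (\<integral>x. g x \<partial>P')) < e" if "n \<ge> N" for n
      using N[OF that] close[OF prob(1) int(1)[OF g] int(1)[OF cp] AE(1), of n]
        close[OF prob(2) int(2)[OF g] int(2)[OF cp] AE(2)] by (simp only: real_norm_def)
    then show "\<exists>no. \<forall>n\<ge>no. norm ((\<integral>x. g x \<partial>P n) - (\<integral>x. g x \<partial>P')) < e"
      by blast
  qed
qed


text \<open>Used with \<open>v = 0\<close> to land in the cube and with \<open>v = undefined\<close>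
  to rebuild extensional functions. Countability of the index type identifies the product
  sigma-algebra with the Borel sets.\<close>

lemma measurable_extend_PiM:
  fixes I :: "'i::countable set" and u :: "real \<Rightarrow> real"
  assumes [measurable]: "u \<in> borel_measurable borel"
  shows "(\<lambda>x i. if i \<in> I then u (x i) else v) \<in> PiM I (\<lambda>_. borel) \<rightarrow>\<^sub>M borel"
proof -
  have "(\<lambda>x i. if i \<in> I then u (x i) else v) \<in> PiM I (\<lambda>_. borel) \<rightarrow>\<^sub>M PiM UNIV (\<lambda>_. borel)"
  proof (rule measurable_PiM_single')
    show "(\<lambda>x. if i \<in> I then u (x i) else v) \<in> borel_measurable (PiM I (\<lambda>_. borel))" for i
      by (cases "i \<in> I") simp_all
  qed (simp add: PiE_def)
  then show ?thesis
    by (simp add: measurable_cong_sets[OF refl sets_PiM_equal_borel])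
qed

text \<open>Elements of the product space are extensional, so a continuous function of all coordinates is
  evaluated there with the remaining coordinates frozen at \<open>undefined\<close>.\<close>

lemma borel_measurable_PiM_continuous:
  fixes f :: "('i::countable \<Rightarrow> real) \<Rightarrow> real"
  assumes "continuous_on UNIV f"
  shows "f \<in> borel_measurable (PiM I (\<lambda>_. borel))"
proof -
  have "(\<lambda>x. f (\<lambda>i. if i \<in> I then x i else undefined)) \<in> borel_measurable (PiM I (\<lambda>_. borel))"
    by (rule measurable_compose[OF measurable_extend_PiM[of "\<lambda>u. u"] borel_measurable_continuous_onI[OF assms]]) simp
  moreover have "f (\<lambda>i. if i \<in> I then x i else undefined) = f x" if "x \<in> space (PiM I (\<lambda>_. borel))" for x
    using that by (intro arg_cong[where f = f]) (auto simp: space_PiM PiE_def extensional_def)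
  ultimately show ?thesis
    by (subst measurable_cong[where g = "\<lambda>x. f (\<lambda>i. if i \<in> I then x i else undefined)"]) auto
qed

text \<open>With \<open>y i = exp (- x i)\<close>, Laplace transforms at integer arguments become
  moments on the unit cube. A bounded continuous function of \<open>x\<close> need not extend
  continuously to the faces \<open>y i = 0\<close>, the image of infinity; a cutoff away from these
  faces removes the problem.\<close>

lemma laplace_imp_weak_conv:
  fixes P :: "nat \<Rightarrow> ('i::countable \<Rightarrow> real) measure" and P' :: "('i \<Rightarrow> real) measure"
    and f :: "('i \<Rightarrow> real) \<Rightarrow> real"
  assumes "finite I"
    and prob: "\<And>n. prob_space (P n)" "prob_space P'"
    and sets: "\<And>n. sets (P n) = sets (PiM I (\<lambda>_. borel))" "sets P' = sets (PiM I (\<lambda>_. borel))"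
    and nonneg: "\<And>n. AE x in P n. \<forall>i\<in>I. 0 \<le> x i" "AE x in P'. \<forall>i\<in>I. 0 \<le> x i"
    and lap: "\<And>m :: 'i \<Rightarrow> nat. (\<lambda>n. \<integral>x. exp (- (\<Sum>i\<in>I. m i * x i)) \<partial>P n)
                \<longlonglongrightarrow> (\<integral>x. exp (- (\<Sum>i\<in>I. m i * x i)) \<partial>P')"
    and f: "continuous_on UNIV f" "bounded (range f)"
  shows "(\<lambda>n. \<integral>x. f x \<partial>P n) \<longlonglongrightarrow> (\<integral>x. f x \<partial>P')"
proof -
  let ?B = "PiM I (\<lambda>_. borel) :: ('i \<Rightarrow> real) measure"
  \<comment> \<open>Collects what \<open>P n\<close> and \<open>P'\<close> have in common, so that
    each estimate is proved once for both.\<close>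
  define adm where "adm \<nu> \<longleftrightarrow> prob_space \<nu> \<and> sets \<nu> = sets ?B \<and> (AE x in \<nu>. \<forall>i\<in>I. 0 \<le> x i)" for \<nu>
  have adm: "adm (P n)" "adm P'" for n
    unfolding adm_def using prob sets nonneg by auto
  have meas: "h \<in> borel_measurable \<nu>" if "adm \<nu>" "h \<in> borel_measurable ?B" for h :: "_ \<Rightarrow> real" and \<nu>
    using that measurable_cong_sets[of \<nu> ?B borel borel] unfolding adm_def by blast
  have int: "integrable \<nu> h" if "adm \<nu>" "h \<in> borel_measurable ?B" "\<And>x. \<bar>h x\<bar> \<le> b" for h :: "_ \<Rightarrow> real" and \<nu> b
    using that meas[OF that(1,2)] unfolding adm_def
    by (auto intro!: finite_measure.integrable_const_bound[where B = b] prob_space.finite_measure)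
  \<comment> \<open>\<open>max 0\<close> keeps the values in the cube for every argument; it is
    inactive almost everywhere.\<close>
  define \<phi> :: "('i \<Rightarrow> real) \<Rightarrow> ('i \<Rightarrow> real)" where "\<phi> x = (\<lambda>i. if i \<in> I then exp (- max 0 (x i)) else 0)" for x
  have \<phi>[measurable]: "\<phi> \<in> ?B \<rightarrow>\<^sub>M borel"
    unfolding \<phi>_def by (rule measurable_extend_PiM) simp
  let ?S = "{x. \<forall>i. x i \<in> (if i \<in> I then {0..1::real} else {0})}"
  have \<phi>S: "\<phi> x \<in> ?S" for x
    by (simp add: \<phi>_def)
  have S: "compact ?S" by (rule compact_cube_fun)
  have cont_meas: "g \<in> borel_measurable borel" if "continuous_on UNIV g" for g :: "('i \<Rightarrow> real) \<Rightarrow> real"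
    using that by (rule borel_measurable_continuous_onI)
  have conv: "(\<lambda>n. \<integral>x. g (\<phi> x) \<partial>P n) \<longlonglongrightarrow> (\<integral>x. g (\<phi> x) \<partial>P')"
    if g: "continuous_on UNIV g" for g :: "_ \<Rightarrow> real"
  proof -
    have \<phi>\<nu>: "\<phi> \<in> \<nu> \<rightarrow>\<^sub>M borel" if "adm \<nu>" for \<nu>
      using \<phi> measurable_cong_sets[of \<nu> ?B borel borel] that unfolding adm_def by blast
    have Sb: "{x \<in> space borel. x \<in> ?S} \<in> sets borel"
      using borel_closed[OF compact_imp_closed[OF S]] by simp
    have AE_S: "AE x in distr \<nu> borel \<phi>. x \<in> ?S" if "adm \<nu>" for \<nu>
      by (subst AE_distr_iff[OF \<phi>\<nu>[OF that] Sb]) (use \<phi>S in auto)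
    have "(\<lambda>n. \<integral>x. g x \<partial>distr (P n) borel \<phi>) \<longlonglongrightarrow> (\<integral>x. g x \<partial>distr P' borel \<phi>)"
    proof (rule moments_imp_weak_conv_cube[OF \<open>finite I\<close>])
      show "prob_space (distr (P n) borel \<phi>)" "prob_space (distr P' borel \<phi>)" for n
        using prob adm by (auto intro!: prob_space.prob_space_distr \<phi>\<nu>)
      show "continuous_on UNIV g" by fact
      fix m :: "'i \<Rightarrow> nat"
      let ?p = "\<lambda>x :: 'i \<Rightarrow> real. \<Prod>i\<in>I. x i ^ m i"
      have p_meas: "?p \<in> borel_measurable borel"
        by (intro cont_meas continuous_on_prod continuous_on_power) simp
      have eq: "?p (\<phi> x) = exp (- (\<Sum>i\<in>I. m i * x i))" if "\<forall>i\<in>I. 0 \<le> x i" for x :: "'i \<Rightarrow> real"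
      proof -
        have "?p (\<phi> x) = (\<Prod>i\<in>I. exp (- (m i * x i)))"
          using that by (intro prod.cong) (auto simp: \<phi>_def exp_of_nat_mult[symmetric])
        then show ?thesis by (simp add: exp_sum[OF \<open>finite I\<close>] sum_negf[symmetric])
      qed
      have "(\<integral>x. ?p x \<partial>distr \<nu> borel \<phi>) = (\<integral>x. exp (- (\<Sum>i\<in>I. m i * x i)) \<partial>\<nu>)" if \<nu>: "adm \<nu>" for \<nu>
      proof -
        have "(\<integral>x. ?p (\<phi> x) \<partial>\<nu>) = (\<integral>x. exp (- (\<Sum>i\<in>I. m i * x i)) \<partial>\<nu>)"
        proof (rule integral_cong_AE)
          show "AE x in \<nu>. ?p (\<phi> x) = exp (- (\<Sum>i\<in>I. m i * x i))"
            using \<nu> eq unfolding adm_def by (auto elim!: eventually_mono)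
        qed (auto intro!: meas[OF \<nu>] measurable_compose[OF \<phi> p_meas])
        then show ?thesis by (simp only: integral_distr[OF \<phi>\<nu>[OF \<nu>] p_meas])
      qed
      then show "(\<lambda>n. \<integral>x. ?p x \<partial>distr (P n) borel \<phi>) \<longlonglongrightarrow> (\<integral>x. ?p x \<partial>distr P' borel \<phi>)"
        using lap[of m] adm by simp
    qed (rule sets_distr AE_S[OF adm(1)] AE_S[OF adm(2)])+
    then show ?thesis using adm by (simp add: integral_distr[OF \<phi>\<nu> cont_meas[OF g]])
  qed
  \<comment> \<open>The cutoff vanishes unless every \<open>y i\<close> exceeds \<open>1 / k\<close>, so \<open>f\<close> composed with \<open>- ln\<close> becomes
    continuous on the whole cube after multiplication with it; its mean tends to 1, which replaces tightness.\<close>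
  \<comment> \<open>The cutoff vanishes unless every \<open>y i\<close> exceeds \<open>1 / k\<close>, so \<open>f\<close> composed with \<open>- ln\<close> becomes
    continuous on the whole cube after multiplication with it; its mean tends to 1, which replaces tightness.\<close>
  define h where "h k y = (\<Prod>i\<in>I. max 0 (min 1 (real k * y i - 1)))" for k and y :: "'i \<Rightarrow> real"
  have h_cont: "continuous_on UNIV (h k)" for k
    unfolding h_def by (intro continuous_on_prod continuous_intros) auto
  have h01: "0 \<le> h k y" "h k y \<le> 1" for k y
    unfolding h_def by (auto intro!: prod_nonneg prod_le_1)
  \<comment> \<open>On nonnegative extensional points it inverts \<open>\<phi>\<close> where the
    cutoff is nonzero. The lower bound inside \<open>ln\<close> makes it continuous everywhere, and
    \<open>undefined\<close> outside \<open>I\<close> matches extensional functions.\<close>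
  define \<psi> :: "nat \<Rightarrow> ('i \<Rightarrow> real) \<Rightarrow> ('i \<Rightarrow> real)"
    where "\<psi> k y = (\<lambda>i. if i \<in> I then - ln (max (1 / real (Suc k)) (y i)) else undefined)" for k y
  have \<psi>_cont: "continuous_on UNIV (\<psi> k)" for k
  proof (rule continuous_on_coordinatewise_then_product)
    show "continuous_on UNIV (\<lambda>x. \<psi> k x i)" for i
    proof (cases "i \<in> I")
      case True
      have "max (1 / real (Suc k)) (x i) > 0" for x :: "'i \<Rightarrow> real"
        by (simp add: less_max_iff_disj)
      then show ?thesis
        unfolding \<psi>_def using True
        by (simp del: of_nat_Suc) (intro continuous_intros, auto simp: less_imp_neq[symmetric])
    qed (simp add: \<psi>_def)
  qed
  have \<psi>\<phi>: "\<psi> k (\<phi> x) = x" if "x \<in> extensional I" "\<forall>i\<in>I. 0 \<le> x i" "h (Suc k) (\<phi> x) \<noteq> 0" for k x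
  proof
    fix i
    show "\<psi> k (\<phi> x) i = x i"
    proof (cases "i \<in> I")
      case True
      then have "real (Suc k) * \<phi> x i - 1 > 0"
        using that(3) \<open>finite I\<close> by (force simp: h_def max_def min_def split: if_splits)
      then have "\<phi> x i \<ge> 1 / real (Suc k)"
        by (simp add: field_simps)
      then show ?thesis using True that(2) by (simp add: \<psi>_def \<phi>_def max_def)
    next
      case False
      then show ?thesis using that(1) by (simp add: \<psi>_def extensional_def)
    qed
  qed
  obtain b where "\<And>x. \<bar>f x\<bar> \<le> b" using f(2) by (auto simp: bounded_iff)
  then obtain B where B: "\<And>x. \<bar>f x\<bar> \<le> B" "B > 0"
    by (intro that[of "max b 1"]) (auto simp: le_max_iff_disj)
  have f_meas: "f \<in> borel_measurable ?B"
    using f(1) by (rule borel_measurable_PiM_continuous)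
  define g where "g k y = f (\<psi> k y) * h (Suc k) y" for k y
  have g_cont: "continuous_on UNIV (g k)" for k
    unfolding g_def
    by (intro continuous_on_mult h_cont continuous_on_compose2[OF f(1) \<psi>_cont]) auto
  have close: "\<bar>f x - g k (\<phi> x)\<bar> \<le> B * (1 - h (Suc k) (\<phi> x))"
    if "x \<in> extensional I" "\<forall>i\<in>I. 0 \<le> x i" for k x
  proof (cases "h (Suc k) (\<phi> x) = 0")
    case True
    then show ?thesis using B by (simp add: g_def)
  next
    case False
    then have "f x - g k (\<phi> x) = f x * (1 - h (Suc k) (\<phi> x))"
      using \<psi>\<phi>[OF that] by (simp add: g_def algebra_simps)
    then show ?thesis
      using B(1)[of x] h01(2)[of "Suc k" "\<phi> x"] by (simp add: abs_mult mult_right_mono)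
  qed
  have int_h: "integrable \<nu> (\<lambda>x. h k (\<phi> x))" if "adm \<nu>" for \<nu> k
    using h01 by (intro int[OF that measurable_compose[OF \<phi> cont_meas[OF h_cont]], of _ 1]) simp
  have close_int: "\<bar>(\<integral>x. f x \<partial>\<nu>) - (\<integral>x. g k (\<phi> x) \<partial>\<nu>)\<bar> \<le> B * (1 - (\<integral>x. h (Suc k) (\<phi> x) \<partial>\<nu>))" if \<nu>: "adm \<nu>" for \<nu> k
  proof -
    interpret \<nu>: prob_space \<nu> using \<nu> unfolding adm_def by simp
    have "\<bar>g k y\<bar> \<le> B * 1" for y
      unfolding g_def abs_mult using B h01 by (intro mult_mono) auto
    then have i: "integrable \<nu> f" "integrable \<nu> (\<lambda>x. g k (\<phi> x))"
      using B(1) by (auto intro!: int[OF \<nu> f_meas] int[OF \<nu> measurable_compose[OF \<phi> cont_meas[OF g_cont]], of _ B])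
    have "\<bar>(\<integral>x. f x \<partial>\<nu>) - (\<integral>x. g k (\<phi> x) \<partial>\<nu>)\<bar> = \<bar>\<integral>x. f x - g k (\<phi> x) \<partial>\<nu>\<bar>"
      using i by simp
    also have "\<dots> \<le> (\<integral>x. \<bar>f x - g k (\<phi> x)\<bar> \<partial>\<nu>)"
      by (rule integral_abs_bound)
    also have "\<dots> \<le> (\<integral>x. B * (1 - h (Suc k) (\<phi> x)) \<partial>\<nu>)"
    proof (rule integral_mono_AE)
      have "AE x in \<nu>. \<forall>i\<in>I. 0 \<le> x i" using \<nu> unfolding adm_def by simp
      then show "AE x in \<nu>. \<bar>f x - g k (\<phi> x)\<bar> \<le> B * (1 - h (Suc k) (\<phi> x))"
        using AE_space
      proof eventually_elim
        case (elim x)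
        then have "x \<in> extensional I"
          using sets_eq_imp_space_eq[of \<nu> ?B] \<nu> unfolding adm_def by (simp add: space_PiM PiE_def)
        then show ?case using elim by (intro close)
      qed
    qed (use i int_h[OF \<nu>] in auto)
    also have "\<dots> = B * (1 - (\<integral>x. h (Suc k) (\<phi> x) \<partial>\<nu>))"
      using int_h[OF \<nu>] by (simp add: \<nu>.prob_space)
    finally show ?thesis .
  qed
  interpret P': prob_space P' by (rule prob(2))
  have "(\<lambda>k. \<integral>x. h (Suc k) (\<phi> x) \<partial>P') \<longlonglongrightarrow> (\<integral>x. 1 \<partial>P')"
  proof (rule integral_dominated_convergence[where w = "\<lambda>_. 1"])
    show "AE x in P'. (\<lambda>k. h (Suc k) (\<phi> x)) \<longlonglongrightarrow> 1"
    proof (rule AE_I2)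
      fix x
      have "(\<lambda>k. h k (\<phi> x)) \<longlonglongrightarrow> (\<Prod>i\<in>I. 1)"
        unfolding h_def
      proof (intro tendsto_prod)
        fix i assume "i \<in> I"
        then have pos: "\<phi> x i > 0" by (simp add: \<phi>_def)
        have "eventually (\<lambda>k. real k \<ge> 2 / \<phi> x i) sequentially"
          using filterlim_real_sequentially unfolding filterlim_at_top by blast
        then have "eventually (\<lambda>k. max 0 (min 1 (real k * \<phi> x i - 1)) = 1) sequentially"
          by eventually_elim (use pos in \<open>simp add: field_simps\<close>)
        then show "(\<lambda>k. max 0 (min 1 (real k * \<phi> x i - 1))) \<longlonglongrightarrow> 1"
          by (rule tendsto_eventually)
      qed
      then show "(\<lambda>k. h (Suc k) (\<phi> x)) \<longlonglongrightarrow> 1"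
        by (intro LIMSEQ_Suc) simp
    qed
  qed (use h01 int_h[OF adm(2)] in auto)
  then have lim1: "(\<lambda>k. \<integral>x. h (Suc k) (\<phi> x) \<partial>P') \<longlonglongrightarrow> 1"
    by (simp add: P'.prob_space)
  show ?thesis
  proof (rule LIMSEQ_I)
    fix e :: real assume "0 < e"
    then have "e / (4 * B) > 0" using B by simp
    then obtain k where "\<bar>(\<integral>x. h (Suc k) (\<phi> x) \<partial>P') - 1\<bar> < e / (4 * B)"
      using LIMSEQ_D[OF lim1] by (metis order_refl real_norm_def)
    then have k: "B * (1 - (\<integral>x. h (Suc k) (\<phi> x) \<partial>P')) < e / 4"
      using B(2) by (simp add: field_simps abs_less_iff)
    have "eventually (\<lambda>n. \<bar>(\<integral>x. g k (\<phi> x) \<partial>P n) - (\<integral>x. g k (\<phi> x) \<partial>P')\<bar> < e / 4) sequentially"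
      using tendstoD[OF conv[OF g_cont[of k]], of "e/4"] \<open>0 < e\<close> by (simp add: dist_real_def)
    \<comment> \<open>The cutoff is itself continuous on the cube, so its mean under
      \<open>P n\<close> converges. Being close to 1 in the limit, it bounds the mass of
      \<open>P n\<close> far out for large \<open>n\<close>.\<close>
    moreover have "(\<lambda>n. B * (1 - (\<integral>x. h (Suc k) (\<phi> x) \<partial>P n))) \<longlonglongrightarrow> B * (1 - (\<integral>x. h (Suc k) (\<phi> x) \<partial>P'))"
      by (intro tendsto_intros conv h_cont)
    then have "eventually (\<lambda>n. B * (1 - (\<integral>x. h (Suc k) (\<phi> x) \<partial>P n)) < e / 4) sequentially"
      using k by (rule order_tendstoD)
    ultimately have "eventually (\<lambda>n. \<bar>(\<integral>x. f x \<partial>P n) - (\<integral>x. f x \<partial>P')\<bar> < e) sequentially"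
    proof eventually_elim
      case (elim n)
      then show ?case using close_int[OF adm(1), of n k] close_int[OF adm(2), of k] k by linarith
    qed
    then show "\<exists>no. \<forall>n\<ge>no. norm ((\<integral>x. f x \<partial>P n) - (\<integral>x. f x \<partial>P')) < e"
      by (simp add: eventually_sequentially)
  qed
qed

section \<open>Quantile periodograms\<close>

text \<open>The Lipschitz condition removes atoms near the quantile, so strict and weak inequality
  have equal probability there, and it makes the distribution function equal to \<open>tau\<close>
  at its quantile. The density enters through a positive lower bound near \<open>x0\<close>, which
  integrates to linear growth.\<close>

lemma (in stationary_process) quantile_process_of_conditions:
  assumes tau: "0 < tau" "tau < 1"
    and A: "\<exists>\<delta>>0. \<exists>\<sigma>. 0 < \<sigma> \<and> \<sigma> < 1 \<and>
              (\<lambda>n. SUP xi\<in>{xi. \<bar>quantile0 (cdfX M Y eps) tau - xi\<bar> \<le> \<delta>}.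
                      coupL2 L Y n xi) \<in> O(\<lambda>n. \<sigma> ^ n)"
    and B_lip: "\<exists>\<eta>>0. \<exists>C. \<forall>x y. \<bar>x - quantile0 (cdfX M Y eps) tau\<bar> < \<eta> \<longrightarrow>
                  \<bar>y - quantile0 (cdfX M Y eps) tau\<bar> < \<eta> \<longrightarrow>
                  \<bar>cdfX M Y eps x - cdfX M Y eps y\<bar> \<le> C * \<bar>x - y\<bar>"
    and B_dens: "\<exists>\<eta>>0. \<exists>f. (\<forall>x y. quantile0 (cdfX M Y eps) tau - \<eta> < y \<longrightarrow> y \<le> x \<longrightarrow>
                     x < quantile0 (cdfX M Y eps) tau + \<eta> \<longrightarrow>
                     (f has_integral (cdfX M Y eps x - cdfX M Y eps y)) {y..x})
                  \<and> isCont f (quantile0 (cdfX M Y eps) tau) \<and> f (quantile0 (cdfX M Y eps) tau) > 0"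
  obtains \<eta> C \<sigma> CF cF where "quantile_process M N eps Y tau (quantile0 (cdfX M Y eps) tau) \<eta> C \<sigma> CF cF"
proof -
  define G where "G = cdfX M Y eps"
  define x0 where "x0 = quantile0 G tau"
  let ?D = "distr M borel (X 0)"
  interpret D: real_distribution ?D
    by (simp add: prob_space.real_distribution_distr prob_space_axioms)
  have G_cdf: "G = cdf ?D"
    by (auto simp: G_def cdfX_def cdf_def measure_distr fun_eq_iff intro!: arg_cong[where f = prob])
  have G_mono: "x \<le> y \<Longrightarrow> G x \<le> G y" for x y
    unfolding G_cdf by (rule D.cdf_nondecreasing)
  \<comment> \<open>The levels \<open>xt\<close> and \<open>xb\<close> show that the set defining
    the quantile is nonempty and bounded below, so that \<open>Inf\<close> is a genuine
    infimum.\<close>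
  obtain xt where xt: "tau < G xt"
    using order_tendstoD(1)[OF D.cdf_lim_at_top_prob tau(2)] unfolding G_cdf
    by (auto dest!: eventually_happens)
  obtain xb where xb: "G xb < tau"
    using order_tendstoD(2)[OF D.cdf_lim_at_bot tau(1)] unfolding G_cdf
    by (auto dest!: eventually_happens)
  have bdd: "bdd_below {x. tau \<le> G x}"
    using G_mono xb by (intro bdd_belowI[of _ xb]) (metis linorder_not_le mem_Collect_eq order_trans linear)
  have lt: "G x < tau" if "x < x0" for x
    using cInf_lower[OF _ bdd, of x] that unfolding x0_def quantile0_def by (auto simp: not_le[symmetric])
  have gt: "tau \<le> G x" if x: "x0 < x" for x
  proof -
    have "{x. tau \<le> G x} \<noteq> {}" using less_imp_le[OF xt] by blast
    then obtain y where "y < x" "tau \<le> G y"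
      using cInf_lessD[of "{x. tau \<le> G x}" x] x unfolding x0_def quantile0_def by blast
    then show ?thesis using G_mono[of y x] by linarith
  qed
  obtain \<eta>1 CF0 where \<eta>1: "0 < \<eta>1" and lip0: "\<And>x y. \<bar>x - x0\<bar> < \<eta>1 \<Longrightarrow> \<bar>y - x0\<bar> < \<eta>1 \<Longrightarrow> \<bar>G x - G y\<bar> \<le> CF0 * \<bar>x - y\<bar>"
    using B_lip unfolding G_def[symmetric] x0_def[symmetric] by blast
  define CF where "CF = max 0 CF0"
  have lip: "\<bar>G x - G y\<bar> \<le> CF * \<bar>x - y\<bar>" if "\<bar>x - x0\<bar> < \<eta>1" "\<bar>y - x0\<bar> < \<eta>1" for x y
    by (rule order_trans[OF lip0[OF that]]) (simp add: CF_def mult_right_mono)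
  have cont: "(G \<longlongrightarrow> G x) (at x)" if x: "\<bar>x - x0\<bar> < \<eta>1" for x
  proof -
    have "((\<lambda>y. G y - G x) \<longlongrightarrow> 0) (at x)"
    proof (rule Lim_null_comparison)
      have "eventually (\<lambda>y. y \<in> {x0 - \<eta>1<..<x0 + \<eta>1}) (at x)"
        using x by (intro eventually_at_topological[THEN iffD2] exI[of _ "{x0 - \<eta>1<..<x0 + \<eta>1}"]) auto
      then show "eventually (\<lambda>y. norm (G y - G x) \<le> CF * \<bar>y - x\<bar>) (at x)"
        by eventually_elim (use lip[OF _ x] in \<open>auto simp: abs_less_iff\<close>)
      have "((\<lambda>y. CF * \<bar>y - x\<bar>) \<longlongrightarrow> CF * \<bar>x - x\<bar>) (at x)" by (intro tendsto_intros)
      then show "((\<lambda>y. CF * \<bar>y - x\<bar>) \<longlongrightarrow> 0) (at x)" by simp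
    qed
    then show ?thesis by (rule LIM_zero_cancel)
  qed
  \<comment> \<open>Values on the left are below \<open>tau\<close>, values on the right are at
    least \<open>tau\<close>, and \<open>G\<close> is continuous at \<open>x0\<close>.\<close>
  have G_x0: "G x0 = tau"
  proof (rule antisym)
    have "(G \<longlongrightarrow> G x0) (at x0)" using cont[of x0] \<eta>1 by simp
    then have l: "(G \<longlongrightarrow> G x0) (at_left x0)" and r: "(G \<longlongrightarrow> G x0) (at_right x0)"
      by (auto simp: filterlim_at_split)
    show "G x0 \<le> tau"
      using l by (rule tendsto_upperbound) (auto simp: eventually_at_filter intro!: always_eventually less_imp_le lt)
    show "tau \<le> G x0"
      using r by (rule tendsto_lowerbound) (auto simp: eventually_at_filter intro!: always_eventually gt)
  qed
  have below_G: "(\<integral>\<omega>. below x (X 0 \<omega>) \<partial>M) = G x" if x: "\<bar>x - x0\<bar> < \<eta>1" for x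
  proof -
    have ib: "integrable M (\<lambda>\<omega>. below x (X 0 \<omega>))"
      by (rule integrable_const_bound[where B = 1]) (auto simp: below_bounds)
    have "(\<integral>\<omega>. below x (X 0 \<omega>) \<partial>M) = (\<integral>\<omega>. indicator {\<omega> \<in> space M. X 0 \<omega> < x} \<omega> \<partial>M)"
      by (intro Bochner_Integration.integral_cong) (auto simp: below_def indicator_def)
    also have "\<dots> = prob {\<omega> \<in> space M. X 0 \<omega> < x}" by simp
    finally have e: "(\<integral>\<omega>. below x (X 0 \<omega>) \<partial>M) = prob {\<omega> \<in> space M. X 0 \<omega> < x}" .
    show ?thesis unfolding e
    proof (rule antisym)
      show "prob {\<omega> \<in> space M. X 0 \<omega> < x} \<le> G x"
        unfolding G_def cdfX_def by (rule finite_measure_mono) auto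
      have "(G \<longlongrightarrow> G x) (at_left x)" using cont[OF x] by (auto simp: filterlim_at_split)
      then show "G x \<le> prob {\<omega> \<in> space M. X 0 \<omega> < x}"
      proof (rule tendsto_upperbound)
        have "G y \<le> prob {\<omega> \<in> space M. X 0 \<omega> < x}" if "y < x" for y
          unfolding G_def cdfX_def using that by (intro finite_measure_mono) auto
        then show "eventually (\<lambda>y. G y \<le> prob {\<omega> \<in> space M. X 0 \<omega> < x}) (at_left x)"
          by (auto simp: eventually_at_filter intro!: always_eventually)
      qed simp
    qed
  qed
  obtain \<eta>2 f where \<eta>2: "0 < \<eta>2" and f: "\<And>x y. x0 - \<eta>2 < y \<Longrightarrow> y \<le> x \<Longrightarrow> x < x0 + \<eta>2 \<Longrightarrow> (f has_integral (G x - G y)) {y..x}"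
    and fc: "isCont f x0" and f0: "0 < f x0"
    using B_dens unfolding G_def[symmetric] x0_def[symmetric] by blast
  define cF where "cF = f x0 / 2"
  have cF: "0 < cF" "cF < f x0" unfolding cF_def using f0 by auto
  obtain \<eta>3 where \<eta>3: "0 < \<eta>3" "\<And>x. \<bar>x - x0\<bar> < \<eta>3 \<Longrightarrow> cF \<le> f x"
  proof -
    have "eventually (\<lambda>x. cF < f x) (at x0)"
      using order_tendstoD(1)[OF fc[unfolded isCont_def] cF(2)] .
    then obtain d where d: "0 < d" "\<And>x. x \<noteq> x0 \<Longrightarrow> dist x x0 < d \<Longrightarrow> cF < f x"
      unfolding eventually_at by auto
    have "cF \<le> f x" if "\<bar>x - x0\<bar> < d" for x
      using d(2)[of x] cF(2) that by (cases "x = x0") (auto simp: dist_real_def)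
    with d(1) show ?thesis by (rule that)
  qed
  have growth: "cF * (x - y) \<le> G x - G y"
    if "x0 - min \<eta>2 \<eta>3 < y" "y \<le> x" "x < x0 + min \<eta>2 \<eta>3" for x y
  proof -
    have 1: "(f has_integral (G x - G y)) {y..x}" using that by (intro f) auto
    have 2: "((\<lambda>_. cF) has_integral (x - y) *\<^sub>R cF) {y..x}"
      using has_integral_const_real[of cF y x] that by simp
    have 3: "cF \<le> f u" if "u \<in> {y..x}" for u
      using that \<open>x0 - min \<eta>2 \<eta>3 < y\<close> \<open>x < x0 + min \<eta>2 \<eta>3\<close> by (intro \<eta>3(2)) (simp, linarith)
    have "(x - y) *\<^sub>R cF \<le> G x - G y"
      by (rule has_integral_le[OF 2 1 3])
    then show ?thesis by (simp add: mult.commute)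
  qed
  obtain \<delta> \<sigma> where \<delta>: "0 < \<delta>" and \<sigma>: "0 < \<sigma>" "\<sigma> < 1"
    and O: "(\<lambda>n. SUP xi\<in>{xi. \<bar>x0 - xi\<bar> \<le> \<delta>}. coupL2 L Y n xi) \<in> O(\<lambda>n. \<sigma> ^ n)"
    using A unfolding G_def[symmetric] x0_def[symmetric] by blast
  have coupL2: "coupL2 L Y n xi = coup_dist (below xi) (int n)" for n xi
    unfolding coupL2_def coup_dist_def below_def ..
  \<comment> \<open>The bound 1 makes the suprema finite and also covers the finitely many
    \<open>n\<close> outside the range of the asymptotic bound.\<close>
  have c01: "0 \<le> coupL2 L Y n xi" "coupL2 L Y n xi \<le> 1" for n xi
  proof -
    show "0 \<le> coupL2 L Y n xi" unfolding coupL2_def by simp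
    have b: "\<bar>below xi a - below xi b\<bar> \<le> 1" for a b by (simp add: below_def)
    have "(\<integral>\<omega>. (below xi (Xcoup Y (int n) \<omega>) - below xi (Xcoup' Y (int n) \<omega>))\<^sup>2 \<partial>coupSpace L) \<le> (\<integral>\<omega>. 1 \<partial>coupSpace L)"
      using abs_bound_imp_square_bound[OF b]
      by (intro integral_mono coup.integrable_const_bound[where B = 1]) auto
    then show "coupL2 L Y n xi \<le> 1"
      unfolding coupL2 coup_dist_def by (simp add: coup.prob_space)
  qed
  obtain C0 n0 where C0: "\<And>n. n \<ge> n0 \<Longrightarrow> norm (SUP xi\<in>{xi. \<bar>x0 - xi\<bar> \<le> \<delta>}. coupL2 L Y n xi) \<le> C0 * norm (\<sigma> ^ n)"
  proof -
    obtain c where "eventually (\<lambda>n. norm (SUP xi\<in>{xi. \<bar>x0 - xi\<bar> \<le> \<delta>}. coupL2 L Y n xi) \<le> c * norm (\<sigma> ^ n)) sequentially"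
      by (rule landau_o.bigE[OF O])
    then show ?thesis using that unfolding eventually_sequentially by blast
  qed
  \<comment> \<open>The second term makes \<open>C * \<sigma>^n\<close> at least 1 for
    \<open>n < n0\<close>.\<close>
  define C where "C = max C0 (1 / \<sigma> ^ n0)"
  have coup_le: "coupL2 L Y n xi \<le> C * \<sigma> ^ n" if "\<bar>x0 - xi\<bar> \<le> \<delta>" for n xi
  proof (cases "n \<ge> n0")
    case True
    have "coupL2 L Y n xi \<le> (SUP xi\<in>{xi. \<bar>x0 - xi\<bar> \<le> \<delta>}. coupL2 L Y n xi)"
      using that c01 by (intro cSUP_upper bdd_aboveI2[where M = 1]) auto
    also have "\<dots> \<le> C0 * \<sigma> ^ n" using C0[OF True] \<sigma> by simp
    also have "\<dots> \<le> C * \<sigma> ^ n" using \<sigma> by (intro mult_right_mono) (auto simp: C_def)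
    finally show ?thesis .
  next
    case False
    then have "\<sigma> ^ n0 \<le> \<sigma> ^ n" using \<sigma> by (intro power_decreasing) auto
    then have "1 \<le> 1 / \<sigma> ^ n0 * \<sigma> ^ n" using \<sigma> by (simp add: field_simps)
    also have "\<dots> \<le> C * \<sigma> ^ n" using \<sigma> by (intro mult_right_mono) (auto simp: C_def)
    finally show ?thesis using c01(2)[of n xi] by linarith
  qed
  define \<eta> where "\<eta> = min (min \<eta>1 \<delta>) (min \<eta>2 \<eta>3)"
  have \<eta>: "0 < \<eta>" "\<eta> \<le> \<eta>1" "\<eta> \<le> \<delta>" "\<eta> \<le> min \<eta>2 \<eta>3"
    unfolding \<eta>_def using \<eta>1 \<delta> \<eta>2 \<eta>3(1) by auto
  have "quantile_process M N eps Y tau x0 \<eta> C \<sigma> CF cF"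
  proof unfold_locales
    show "0 < \<eta>" "0 < cF" "0 \<le> CF" by (fact \<eta> cF | simp add: CF_def)+
    show "0 \<le> C" unfolding C_def using \<sigma> by (simp add: le_max_iff_disj)
    show "0 < \<sigma>" "\<sigma> < 1" by (fact \<sigma>)+
    show "coup_dist (below x) (int n) \<le> C * \<sigma> ^ n" if "\<bar>x - x0\<bar> < \<eta>" for x n
      using coup_le[of x n] that \<eta> unfolding coupL2 by (simp add: abs_minus_commute)
    show "\<bar>(\<integral>\<omega>. below x (X 0 \<omega>) \<partial>M) - (\<integral>\<omega>. below y (X 0 \<omega>) \<partial>M)\<bar> \<le> CF * \<bar>x - y\<bar>"
      if "\<bar>x - x0\<bar> < \<eta>" "\<bar>y - x0\<bar> < \<eta>" for x y
      using below_G[of x] below_G[of y] lip[of x y] that \<eta> by simp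
    show "(\<integral>\<omega>. below x0 (X 0 \<omega>) \<partial>M) = tau"
      using below_G[of x0] \<eta>1 G_x0 by simp
    show "cF * (x - x0) \<le> (\<integral>\<omega>. below x (X 0 \<omega>) \<partial>M) - tau" if "x0 \<le> x" "x < x0 + \<eta>" for x
      using below_G[of x] growth[of x0 x] that \<eta> G_x0 by simp
    show "cF * (x0 - x) \<le> tau - (\<integral>\<omega>. below x (X 0 \<omega>) \<partial>M)" if "x0 - \<eta> < x" "x \<le> x0" for x
      using below_G[of x] growth[of x x0] that \<eta> G_x0 by simp
  qed
  then show thesis unfolding x0_def G_def by (rule that)
qed

lemma qpgram_eq:
  "qpgram Y eps tau xihat n l \<omega> =
    ((\<Sum>t=1..n. cos (real t * l) / sqrt (real n) * Vfun tau (xihat n \<omega>) (Xproc Y eps (int t) \<omega>))\<^sup>2 +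
     (\<Sum>t=1..n. sin (real t * l) / sqrt (real n) * Vfun tau (xihat n \<omega>) (Xproc Y eps (int t) \<omega>))\<^sup>2) / (2 * pi)"
proof -
  let ?V = "\<lambda>t. Vfun tau (xihat n \<omega>) (Xproc Y eps (int t) \<omega>)"
  let ?z = "(1 / sqrt (real n)) * (\<Sum>t=1..n. complex_of_real (?V t) * exp (- \<i> * complex_of_real (real t * l)))"
  have e: "exp (- \<i> * complex_of_real x) = cis (- x)" for x
    by (simp add: cis_conv_exp)
  have "Re ?z = (\<Sum>t=1..n. cos (real t * l) / sqrt (real n) * ?V t)"
    unfolding e by (simp add: sum_distrib_left mult_ac)
  moreover have "Im ?z = - (\<Sum>t=1..n. sin (real t * l) / sqrt (real n) * ?V t)"
    unfolding e by (simp add: sum_distrib_left sum_negf mult_ac)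
  ultimately show ?thesis
    unfolding qpgram_def cmod_power2 by simp
qed

lemma Re_Complex_cis: "Re (Complex a (- b) * cis x) = a * cos x + b * sin x"
  by simp

text \<open>A periodogram is the sum of the squares of a cosine and a sine sum, divided by
  \<open>2 * pi\<close>. These sums behave jointly like independent centred normal variables with
  variance \<open>pi * g\<close>, where \<open>g\<close> is the spectrum at \<open>lam\<close>, and
  such a sum of two squares over \<open>2 * pi\<close> is exponential with mean
  \<open>g\<close>.\<close>

theorem theorem3p2:
  fixes M :: "'a measure" and N :: "'e measure"
    and eps :: "int \<Rightarrow> 'a \<Rightarrow> 'e" and Y :: "(nat \<Rightarrow> 'e) \<Rightarrow> real"
    and tau lam :: real and xihat :: "nat \<Rightarrow> 'a \<Rightarrow> real" and jn :: "nat \<Rightarrow> int" and k :: nat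
  assumes "prob_space M"
    and "\<And>t. eps t \<in> M \<rightarrow>\<^sub>M N"
    and "prob_space.indep_vars M (\<lambda>_. N) eps UNIV"
    and "\<And>t. distr M N (eps t) = distr M N (eps 0)"
    and "Y \<in> borel_measurable (PiM UNIV (\<lambda>_::nat. N))"
    and "0 < tau" and "tau < 1"
    and A: "\<exists>\<delta>>0. \<exists>\<sigma>. 0 < \<sigma> \<and> \<sigma> < 1 \<and>
              (\<lambda>n. SUP xi\<in>{xi. \<bar>quantile0 (cdfX M Y eps) tau - xi\<bar> \<le> \<delta>}.
                      coupL2 (distr M N (eps 0)) Y n xi) \<in> O(\<lambda>n. \<sigma> ^ n)"
    and B_lip: "\<exists>\<eta>>0. \<exists>C. \<forall>x y. \<bar>x - quantile0 (cdfX M Y eps) tau\<bar> < \<eta> \<longrightarrow>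
                  \<bar>y - quantile0 (cdfX M Y eps) tau\<bar> < \<eta> \<longrightarrow>
                  \<bar>cdfX M Y eps x - cdfX M Y eps y\<bar> \<le> C * \<bar>x - y\<bar>"
    and B_dens: "\<exists>\<eta>>0. \<exists>f. (\<forall>x y. quantile0 (cdfX M Y eps) tau - \<eta> < y \<longrightarrow> y \<le> x \<longrightarrow>
                     x < quantile0 (cdfX M Y eps) tau + \<eta> \<longrightarrow>
                     (f has_integral (cdfX M Y eps x - cdfX M Y eps y)) {y..x})
                  \<and> isCont f (quantile0 (cdfX M Y eps) tau) \<and> f (quantile0 (cdfX M Y eps) tau) > 0"
    and xihat_min: "\<And>n \<omega> x. \<omega> \<in> space M \<Longrightarrow>
              (\<Sum>t=1..n. rho tau (Xproc Y eps (int t) \<omega> - xihat n \<omega>))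
                \<le> (\<Sum>t=1..n. rho tau (Xproc Y eps (int t) \<omega> - x))"
    and xihat_meas: "\<And>n. xihat n \<in> borel_measurable M"
    and "(\<lambda>n. 2 * pi * real_of_int (jn n) / real n) \<longlonglongrightarrow> lam"
    and "0 < lam" and "lam < pi"
    and "qspec M Y eps tau lam > 0"
  shows "conv_distr_vec M {- int k .. int k}
           (\<lambda>n \<omega>. restrict (\<lambda>j. qpgram Y eps tau xihat n
                      (2 * pi * real_of_int (jn n) / real n + 2 * pi * real_of_int j / real n) \<omega>)
                    {- int k .. int k})
           (PiM {- int k .. int k} (\<lambda>_. density lborel (exponential_density (1 / qspec M Y eps tau lam))))"
proof -
  interpret S: stationary_process M N eps Y
    using assms(1-5) by (intro stationary_process.intro iid_innovations.intro iid_innovations_axioms.intro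
      stationary_process_axioms.intro)
  obtain \<eta> C \<sigma> CF cF where "quantile_process M N eps Y tau (quantile0 (cdfX M Y eps) tau) \<eta> C \<sigma> CF cF"
    using S.quantile_process_of_conditions[OF assms(6,7) A B_lip B_dens] by blast
  then interpret Q: quantile_process M N eps Y tau "quantile0 (cdfX M Y eps) tau" \<eta> C \<sigma> CF cF .
  let ?I = "{- int k..int k}"
  define x0 where "x0 = quantile0 (cdfX M Y eps) tau"
  define g where "g = qspec M Y eps tau lam"
  have g: "0 < g" unfolding g_def by fact
  define w where "w n j = 2 * pi * real_of_int (jn n + j) / real n" for n j
  define V where "V n t \<omega> = Vfun tau (xihat n \<omega>) (Xproc Y eps t \<omega>)" for n t \<omega>
  have V_meas[measurable]: "V n t \<in> borel_measurable M" for n t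
    using xihat_meas[measurable] unfolding V_def Vfun_def by measurable
  define A where "A b n j \<omega> = (\<Sum>t=1..n. (if b then cos else sin) (real t * w n j) / sqrt (real n) * V n (int t) \<omega>)" for b n j \<omega>
  have A_meas[measurable]: "A b n j \<in> borel_measurable M" for b n j
    unfolding A_def by measurable
  have per: "qpgram Y eps tau xihat n (2 * pi * real_of_int (jn n) / real n + 2 * pi * real_of_int j / real n) \<omega>
     = ((A True n j \<omega>)\<^sup>2 + (A False n j \<omega>)\<^sup>2) / (2 * pi)" for n j \<omega>
    unfolding qpgram_eq A_def V_def w_def by (simp add: distrib_left add_divide_distrib)
  define Z where "Z n \<omega> = (\<lambda>j\<in>?I. ((A True n j \<omega>)\<^sup>2 + (A False n j \<omega>)\<^sup>2) / (2 * pi))" for n \<omega>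
  define \<mu> where "\<mu> = PiM ?I (\<lambda>_. density lborel (exponential_density (1 / g)))"
  let ?E = "density lborel (exponential_density (1 / g))"
  interpret E: prob_space ?E
    using g by (intro prob_space_exponential_density) simp
  interpret EE: product_sigma_finite "\<lambda>_::int. ?E"
    by (intro product_sigma_finite.intro E.sigma_finite_measure_axioms)
  have Z_meas: "Z n \<in> M \<rightarrow>\<^sub>M PiM ?I (\<lambda>_. borel)" for n
    unfolding Z_def[abs_def] by (rule measurable_restrict) measurable
  have min: "(\<Sum>t\<in>{1..int n}. rho tau (Xproc Y eps t \<omega> - xihat n \<omega>)) \<le> (\<Sum>t\<in>{1..int n}. rho tau (Xproc Y eps t \<omega> - x))"
    if "\<omega> \<in> space M" for n \<omega> x
    unfolding sum_int_interval by (rule xihat_min[OF that])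
  have G: "(\<Sum>\<^sub>\<infinity>u. (\<integral>\<omega>. Vfun tau x0 (Xproc Y eps 0 \<omega>) * Vfun tau x0 (Xproc Y eps u \<omega>) \<partial>M) * cos (real_of_int u * lam)) = 2 * pi * g"
    unfolding g_def qspec_def acovV_def Let_def x0_def by simp
  have lap: "(\<lambda>n. \<integral>\<omega>. exp (- (\<Sum>j\<in>?I. real (m j) * Z n \<omega> j)) \<partial>M) \<longlonglongrightarrow> (\<integral>x. exp (- (\<Sum>j\<in>?I. real (m j) * x j)) \<partial>\<mu>)"
    for m :: "int \<Rightarrow> nat"
  proof -
    let ?J = "?I \<times> (UNIV :: bool set)"
    \<comment> \<open>Scaled so that half the sum of the two squares at index \<open>j\<close> is
      \<open>m j * Z n \<omega> j\<close>; the limiting variance is then \<open>m j / pi\<close>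
      times \<open>pi * g\<close>, which is \<open>s\<close>.\<close>
    define T where "T n i \<omega> = sqrt (real (m (fst i)) / pi) * A (snd i) n (fst i) \<omega>" for n i \<omega>
    define s where "s i = g * real (m (fst i))" for i :: "int \<times> bool"
    have J: "(\<Sum>i\<in>?J. f i) = (\<Sum>j\<in>?I. f (j, True) + f (j, False))" for f :: "int \<times> bool \<Rightarrow> real"
    proof -
      have "(\<Sum>i\<in>?J. f i) = (\<Sum>j\<in>?I. \<Sum>b\<in>UNIV. f (j, b))"
        by (subst sum.cartesian_product) (simp add: case_prod_beta)
      then show ?thesis by (simp add: UNIV_bool add.commute)
    qed
    have "(\<lambda>n. \<integral>\<omega>. exp (- (\<Sum>i\<in>?J. (T n i \<omega>)\<^sup>2) / 2) \<partial>M) \<longlonglongrightarrow> (\<Prod>i\<in>?J. 1 / sqrt (1 + s i))"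
    proof (rule gaussian_linearization_limit)
      show "prob_space M" by fact
      show "T n i \<in> borel_measurable M" for n i unfolding T_def by measurable
      show "0 \<le> s i" for i unfolding s_def using g by simp
      fix x :: "int \<times> bool \<Rightarrow> real"
      define z where "z j = complex_of_real (sqrt (real (m j) / pi)) * Complex (x (j, True)) (- x (j, False))" for j
      have lin: "(\<Sum>i\<in>?J. x i * T n i \<omega>) = (\<Sum>t\<in>{1..int n}. trigw ?I z (jn n) n t / sqrt (real n) * V n t \<omega>)" for n \<omega>
      proof -
        have Re_z: "Re (z j * cis y) = sqrt (real (m j) / pi) * (x (j, True) * cos y + x (j, False) * sin y)" for j y
          unfolding z_def mult.assoc Re_complex_of_real_mult Re_Complex_cis ..
        have "(\<Sum>i\<in>?J. x i * T n i \<omega>) = (\<Sum>j\<in>?I. \<Sum>t=1..n. Re (z j * cis (real t * w n j)) / sqrt (real n) * V n (int t) \<omega>)"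
          unfolding J T_def A_def Re_z
          by (intro sum.cong refl) (simp add: sum_distrib_left sum.distrib[symmetric] algebra_simps add_divide_distrib)
        also have "\<dots> = (\<Sum>t=1..n. trigw ?I z (jn n) n (int t) / sqrt (real n) * V n (int t) \<omega>)"
          unfolding trigw_def w_def by (subst sum.swap) (simp add: sum_divide_distrib sum_distrib_right)
        finally show ?thesis unfolding sum_int_interval .
      qed
      have nz: "(cmod (z j))\<^sup>2 = real (m j) / pi * ((x (j, True))\<^sup>2 + (x (j, False))\<^sup>2)" for j
        unfolding z_def norm_mult power_mult_distrib by (simp add: cmod_power2)
      have "(\<Sum>j\<in>?I. (cmod (z j))\<^sup>2) * (2 * pi * g) / 4 = (\<Sum>i\<in>?J. s i * (x i)\<^sup>2) / 2"
        unfolding J nz s_def sum_distrib_right sum_divide_distrib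
        by (intro sum.cong refl) (simp add: field_simps)
      then show "(\<lambda>n. \<integral>\<omega>. iexp (\<Sum>i\<in>?J. x i * T n i \<omega>) \<partial>M) \<longlonglongrightarrow> complex_of_real (exp (- (\<Sum>i\<in>?J. s i * (x i)\<^sup>2) / 2))"
        using Q.char_limit[OF xihat_meas min _ assms(13-15), of ?I z] unfolding lin V_def x0_def[symmetric] G by simp
    qed simp
    moreover have "exp (- (\<Sum>i\<in>?J. (T n i \<omega>)\<^sup>2) / 2) = exp (- (\<Sum>j\<in>?I. real (m j) * Z n \<omega> j))" for n \<omega>
      unfolding J T_def Z_def by (simp add: power_mult_distrib sum_divide_distrib field_simps)
    moreover have "(\<Prod>i\<in>?J. 1 / sqrt (1 + s i)) = (\<integral>x. exp (- (\<Sum>j\<in>?I. real (m j) * x j)) \<partial>\<mu>)"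
    proof -
      \<comment> \<open>The cosine and sine factors at one index are equal, so their square roots
        combine.\<close>
      have "(\<Prod>i\<in>?J. 1 / sqrt (1 + s i)) = (\<Prod>j\<in>?I. 1 / (1 + g * real (m j)))"
      proof -
        have "(\<Prod>i\<in>?J. 1 / sqrt (1 + s i)) = (\<Prod>j\<in>?I. \<Prod>b\<in>(UNIV :: bool set). 1 / sqrt (1 + s (j, b)))"
          by (subst prod.cartesian_product) (simp add: case_prod_beta)
        then show ?thesis
          using g by (simp add: UNIV_bool s_def add_nonneg_nonneg)
      qed
      also have "\<dots> = (\<Prod>j\<in>?I. (1 / g) / (1 / g + real (m j)))"
        using g by (intro prod.cong refl) (simp add: field_simps)
      also have "\<dots> = (\<Prod>j\<in>?I. \<integral>x. exp (- (real (m j) * x)) \<partial>?E)"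
        using g by (intro prod.cong refl integral_exponential_laplace[symmetric]) auto
      also have "\<dots> = (\<integral>x. (\<Prod>j\<in>?I. exp (- (real (m j) * x j))) \<partial>\<mu>)"
        unfolding \<mu>_def
      proof (rule EE.product_integral_prod[symmetric])
        show "integrable ?E (\<lambda>x. exp (- (real (m j) * x)))" for j
        proof (rule E.integrable_const_bound[where B = 1])
          show "AE x in ?E. norm (exp (- (real (m j) * x))) \<le> 1"
            by (subst AE_density) (auto simp: exponential_density_def)
        qed simp
      qed simp
      finally show ?thesis by (simp add: exp_sum[symmetric] sum_negf)
    qed
    ultimately show ?thesis by (simp only:)
  qed
  have "conv_distr_vec M ?I Z \<mu>"
    unfolding conv_distr_vec_def
  proof (intro conjI allI impI)
    show "Z n \<in> M \<rightarrow>\<^sub>M PiM ?I (\<lambda>_. borel)" for n by (rule Z_meas)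
    fix f :: "(int \<Rightarrow> real) \<Rightarrow> real"
    assume f: "continuous_on UNIV f \<and> bounded (range f)"
    have "(\<lambda>n. \<integral>x. f x \<partial>distr M (PiM ?I (\<lambda>_. borel)) (Z n)) \<longlonglongrightarrow> (\<integral>x. f x \<partial>\<mu>)"
    proof (rule laplace_imp_weak_conv[where I = ?I])
      show "prob_space \<mu>" unfolding \<mu>_def by (intro prob_space_PiM E.prob_space_axioms)
      show "prob_space (distr M (PiM ?I (\<lambda>_. borel)) (Z n))" for n
        by (intro S.prob_space_distr Z_meas)
      show "sets \<mu> = sets (PiM ?I (\<lambda>_. borel))" unfolding \<mu>_def by (intro sets_PiM_cong) auto
      show "AE x in distr M (PiM ?I (\<lambda>_. borel)) (Z n). \<forall>i\<in>?I. 0 \<le> x i" for n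
        by (subst AE_distr_iff[OF Z_meas]) (auto simp: Z_def)
      have "AE x in ?E. 0 \<le> x"
        by (subst AE_density) (auto simp: exponential_density_def)
      then have "AE x in \<mu>. 0 \<le> x i" if "i \<in> ?I" for i
        unfolding \<mu>_def using that by (intro AE_PiM_component E.prob_space_axioms)
      then show "AE x in \<mu>. \<forall>i\<in>?I. 0 \<le> x i"
        by (intro AE_finite_allI) auto
      show "(\<lambda>n. \<integral>x. exp (- (\<Sum>i\<in>?I. real (m i) * x i)) \<partial>distr M (PiM ?I (\<lambda>_. borel)) (Z n))
          \<longlonglongrightarrow> (\<integral>x. exp (- (\<Sum>i\<in>?I. real (m i) * x i)) \<partial>\<mu>)" for m :: "int \<Rightarrow> nat"
        using lap[of m] by (subst integral_distr[OF Z_meas]) auto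
    qed (use f in auto)
    then show "(\<lambda>n. \<integral>\<omega>. f (Z n \<omega>) \<partial>M) \<longlonglongrightarrow> (\<integral>x. f x \<partial>\<mu>)"
      using f by (simp add: integral_distr[OF Z_meas borel_measurable_PiM_continuous])
  qed
  then show ?thesis
    unfolding Z_def[abs_def] \<mu>_def g_def per by (simp only: per)
qed

end
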